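(* Let $\lambda,\delta>0$. Suppose $\Omega\subset\mathbb{R}^n$ is a bounded convex domain, and $u(x,t)$ is a solution of $(F_{\lambda,\delta})$ which quenches in finite time $T$. Then the set of quenching points of $u$ is a compact subset of $\Omega$.
   Context: The parabolic problem $(F_{\lambda,\delta})$ is $$u_t-\Delta u=\lambda\frac{1+\delta|\nabla u|^2}{(1-u)^2}\ \text{ in }\Omega\times[0,T),\qquad u=0\ \text{ on }\partial\Omega\times[0,T),\qquad u(x,0)=0\ \text{ for }x\in\Omega.$$ The quenching time is $T=\sup\{t>0:\ \|u(\cdot,\tau)\|_\infty<1\ \ \forall\tau\in[0,t]\}$, and $u$ quenches in finite time if $T<\infty$. The set of quenching points is $$\Sigma=\{x\in\overline\Omega:\ \exists\,(x_k,t_k)\in\Omega\times[0,T)\text{ with }x_k\to x,\ t_k\to T,\ u(x_k,t_k)\to1\}.$$ *)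

theory Defs
  imports "HOL-Analysis.Analysis"
begin

definition time_interval :: "ereal \<Rightarrow> real set" where
  "time_interval S = {t. 0 \<le> t \<and> ereal t < S}"

text \<open>
  \<open>u\<close> is of class \<open>C\<^sup>2\<^sup>,\<^sup>1\<close> on \<open>\<Omega> \<times> I\<close> (twice in space, once in time) with time derivative \<open>ut\<close>,
  spatial gradient \<open>Du\<close> and spatial Hessian \<open>D2u\<close>.  The time derivative is taken
  within \<open>I\<close>, so it is one-sided at \<open>t = 0\<close>.
\<close>
definition C21_on ::
  "(real^'n) set \<Rightarrow> real set \<Rightarrow> (real^'n \<Rightarrow> real \<Rightarrow> real) \<Rightarrow> (real^'n \<Rightarrow> real \<Rightarrow> real) \<Rightarrow>
   (real^'n \<Rightarrow> real \<Rightarrow> real^'n) \<Rightarrow> (real^'n \<Rightarrow> real \<Rightarrow> real^'n^'n) \<Rightarrow> bool" where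
  "C21_on \<Omega> I u ut Du D2u \<longleftrightarrow>
     continuous_on (\<Omega> \<times> I) (\<lambda>(x, t). ut x t) \<and>
     continuous_on (\<Omega> \<times> I) (\<lambda>(x, t). Du x t) \<and>
     continuous_on (\<Omega> \<times> I) (\<lambda>(x, t). D2u x t) \<and>
     (\<forall>x\<in>\<Omega>. \<forall>t\<in>I.
        ((\<lambda>s. u x s) has_real_derivative ut x t) (at t within I) \<and>
        (GDERIV (\<lambda>y. u y t) x :> Du x t) \<and>
        ((\<lambda>y. Du y t) has_derivative (\<lambda>h. D2u x t *v h)) (at x))"

text \<open>
  Classical solutions of \<open>(F\<^sub>\<lambda>\<^sub>,\<^sub>\<delta>)\<close> on \<open>\<Omega> \<times> [0, S)\<close>, where \<open>S\<close> may be infinite.  Only the values of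
  \<open>u\<close> on \<open>closure \<Omega> \<times> [0, S)\<close> matter.  The condition \<open>u < 1\<close> is what makes the right-hand side
  meaningful; it has to be explicit because division by zero is total in HOL.
\<close>
definition solution_F ::
  "(real^'n) set \<Rightarrow> real \<Rightarrow> real \<Rightarrow> ereal \<Rightarrow> (real^'n \<Rightarrow> real \<Rightarrow> real) \<Rightarrow> bool" where
  "solution_F \<Omega> lam \<delta> S u \<longleftrightarrow>
     continuous_on (closure \<Omega> \<times> time_interval S) (\<lambda>(x, t). u x t) \<and>
     (\<exists>ut Du D2u. C21_on \<Omega> (time_interval S) u ut Du D2u \<and>
        (\<forall>x\<in>\<Omega>. \<forall>t\<in>time_interval S.
           u x t < 1 \<and>
           ut x t - (\<Sum>i\<in>UNIV. D2u x t $ i $ i)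
             = lam * ((1 + \<delta> * (norm (Du x t))\<^sup>2) / (1 - u x t)\<^sup>2))) \<and>
     (\<forall>x\<in>frontier \<Omega>. \<forall>t\<in>time_interval S. u x t = 0) \<and>
     (\<forall>x\<in>\<Omega>. u x 0 = 0)"

text \<open>
  The quenching time only makes sense for a solution followed for as long as it exists; otherwise
  every solution could be made to stop earlier by restricting it.
\<close>
definition maximal_solution_F ::
  "(real^'n) set \<Rightarrow> real \<Rightarrow> real \<Rightarrow> ereal \<Rightarrow> (real^'n \<Rightarrow> real \<Rightarrow> real) \<Rightarrow> bool" where
  "maximal_solution_F \<Omega> lam \<delta> S u \<longleftrightarrow>
     0 < S \<and> solution_F \<Omega> lam \<delta> S u \<and>
     \<not> (\<exists>S' w. S < S' \<and> solution_F \<Omega> lam \<delta> S' w \<and>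
          (\<forall>x\<in>closure \<Omega>. \<forall>t\<in>time_interval S. w x t = u x t))"

definition sup_norm_on :: "'a set \<Rightarrow> ('a \<Rightarrow> real) \<Rightarrow> ereal" where
  "sup_norm_on A f = (SUP x\<in>A. ereal \<bar>f x\<bar>)"

text \<open>
  \<open>u\<close> is a solution on \<open>[0, S)\<close>; the values of the total function \<open>u\<close> at times outside
  \<open>[0, S)\<close> carry no information, hence the restriction \<open>t < S\<close>.
\<close>
definition quenching_time :: "'a set \<Rightarrow> ereal \<Rightarrow> ('a \<Rightarrow> real \<Rightarrow> real) \<Rightarrow> ereal" where
  "quenching_time \<Omega> S u =
     Sup {ereal t |t. 0 < t \<and> ereal t < S \<and>
            (\<forall>\<tau>\<in>{0..t}. sup_norm_on \<Omega> (\<lambda>x. u x \<tau>) < 1)}"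

definition quenching_set :: "('a::topological_space) set \<Rightarrow> real \<Rightarrow> ('a \<Rightarrow> real \<Rightarrow> real) \<Rightarrow> 'a set" where
  "quenching_set \<Omega> T u =
     {x \<in> closure \<Omega>. \<exists>xs ts. (\<forall>k::nat. xs k \<in> \<Omega> \<and> ts k \<in> {0..<T}) \<and>
        xs \<longlonglongrightarrow> x \<and> ts \<longlonglongrightarrow> T \<and> (\<lambda>k. u (xs k) (ts k)) \<longlonglongrightarrow> 1}"

end

theory Submission
  imports Defs
begin

text \<open>
  Put \<open>k = \<lambda> \<delta>\<close> and let \<open>\<Phi>\<close> be the primitive of \<open>exp (k / (1 - s))\<close> with \<open>\<Phi> 0 = 0\<close>.  Then
  \<open>w = \<Phi>(u)\<close> solves \<open>w\<^sub>t - \<Delta> w = h(u)\<close> with no gradient term, the right-hand side is an increasing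
  and locally Lipschitz function of \<open>w\<close>, it is bounded below by a positive constant, and \<open>u\<close> gets
  close to 1 exactly where \<open>w\<close> gets large.  Closedness of the quenching set is immediate from its
  definition, so the point is that \<open>w\<close> stays bounded near every boundary point up to time \<open>T\<close>.

  In a smooth convex domain one would reflect in hyperplanes moving in from the boundary and learn
  that \<open>u\<close> increases along a cone of inward directions.  Without smoothness this fails:
  a cap of \<open>\<Omega>\<close> need not have its mirror image in \<open>\<Omega>\<close>, and no cap that contains the midpoint of the long side
  of an obtuse isosceles triangle has.  The reflection is therefore localised.  Suppose
  that \<open>w\<close> is unbounded near some boundary points, and let \<open>x\<^sub>0\<close> be such a point of largest norm.  Let
  \<open>\<nu>\<close> be an inner normal at \<open>x\<^sub>0\<close> that also points into \<open>\<Omega>\<close>, and tilt it to \<open>\<nu> - \<beta> x\<^sub>0\<close> with a small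
  \<open>\<beta>\<close>.  A hyperplane orthogonal to this direction and close to \<open>x\<^sub>0\<close> cuts a thin cap off \<open>\<Omega>\<close>, and inside
  a fixed ball around \<open>x\<^sub>0\<close> the mirror image of the cap stays in \<open>\<Omega>\<close>.  The maximality of the norm makes
  the side of the cap that lies on the surface of the ball stay away from the singular boundary
  points, so \<open>w\<close> is bounded near that side.

  The function \<open>D = w(mirror image) - w\<close> satisfies a linear equation with a nonnegative zero-order
  coefficient.  Where \<open>w\<close> is bounded and the cap is thin, \<open>D\<close> is positive (lemma
  \<open>thin_cap_reflection\<close>): along the boundary of \<open>\<Omega>\<close> it is at least a multiple of the squared depth,
  because \<open>w\<close> is at least a multiple of \<open>t d\<^sup>2\<close> at distance \<open>d\<close> from the boundary, whereas the unknown values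
  of \<open>D\<close> far away contribute an error of higher order in the depth.  This gives the sign of \<open>D\<close> on the
  side of the cap and at one initial time, and the minimum principle extends it to the whole cap
  up to time \<open>T\<close> (\<open>reflections_at_singular_bdry\<close>).

  Varying the hyperplane, \<open>u\<close> is nondecreasing in a whole cone of directions in a small ball that lies
  inside \<open>\<Omega>\<close> and strictly increasing in the axis direction \<open>v\<close> at the initial time.  An
  argument in the style of Friedman and McLeod then shows that \<open>v \<bullet> \<nabla>u\<close> keeps a positive lower bound in a
  smaller ball up to time \<open>T\<close> (\<open>gradient_lower_bound\<close>), and since \<open>u < 1\<close>, integrating along \<open>v\<close> keeps \<open>u\<close> away from 1
  there.  One more reflection carries this bound to a neighbourhood of \<open>x\<^sub>0\<close>, a contradiction.
\<close>

section \<open>Gradient and Laplacian at a point, and the parabolic minimum principle\<close>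

text \<open>
  The gradient has to exist in a neighbourhood of \<open>x\<close>, the second derivative only at \<open>x\<close>.  Its trace is
  independent of the basis, so no coordinates appear, and the Laplacian of every barrier
  function below can be computed by composing rules.
\<close>

definition has_grad_lap :: "('a::euclidean_space \<Rightarrow> real) \<Rightarrow> 'a \<Rightarrow> real \<Rightarrow> 'a \<Rightarrow> bool" where
  "has_grad_lap g p l x \<longleftrightarrow>
     (\<exists>G H. (\<forall>\<^sub>F y in nhds x. (g has_derivative (\<lambda>h. G y \<bullet> h)) (at y)) \<and>
        (G has_derivative H) (at x) \<and> G x = p \<and> l = (\<Sum>b\<in>Basis. H b \<bullet> b))"

lemma has_grad_lapI:
  assumes "\<forall>\<^sub>F y in nhds x. (g has_derivative (\<lambda>h. G y \<bullet> h)) (at y)"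
    and "(G has_derivative H) (at x)" and "G x = p" and "(\<Sum>b\<in>Basis. H b \<bullet> b) = l"
  shows "has_grad_lap g p l x"
  unfolding has_grad_lap_def using assms by blast

lemma has_grad_lap_derivative:
  assumes "has_grad_lap g p l x" shows "(g has_derivative (\<lambda>h. p \<bullet> h)) (at x)"
proof -
  obtain G where "\<forall>\<^sub>F y in nhds x. (g has_derivative (\<lambda>h. G y \<bullet> h)) (at y)" "G x = p"
    using assms unfolding has_grad_lap_def by blast
  then show ?thesis by (auto dest: eventually_nhds_x_imp_x)
qed

lemma has_grad_lap_eq:
  assumes "has_grad_lap g p l x" "p = p'" "l = l'" shows "has_grad_lap g p' l' x"
  using assms by simp

lemma has_grad_lap_affine: "has_grad_lap (\<lambda>x. v \<bullet> x + c) v 0 x"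
proof (rule has_grad_lapI[where G="\<lambda>y. v" and H="\<lambda>h. 0"])
  show "\<forall>\<^sub>F y in nhds x. ((\<lambda>x. v \<bullet> x + c) has_derivative (\<lambda>h. v \<bullet> h)) (at y)"
    by (intro always_eventually allI) (auto intro!: derivative_eq_intros)
qed auto

lemma has_grad_lap_const: "has_grad_lap (\<lambda>x. c) 0 0 x"
  using has_grad_lap_affine[of 0 c] by simp

lemma has_grad_lap_dist_square:
  "has_grad_lap (\<lambda>x. (x - z) \<bullet> (x - z)) (2 *\<^sub>R (x - z)) (2 * real DIM('a)) (x::'a::euclidean_space)"
proof (rule has_grad_lapI[where G="\<lambda>y. 2 *\<^sub>R (y - z)" and H="\<lambda>h. 2 *\<^sub>R h"])
  show "\<forall>\<^sub>F y in nhds x. ((\<lambda>x. (x - z) \<bullet> (x - z)) has_derivative (\<lambda>h. (2 *\<^sub>R (y - z)) \<bullet> h)) (at y)"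
    by (intro always_eventually allI) (auto intro!: derivative_eq_intros simp: inner_commute inner_diff)
  show "((\<lambda>y. 2 *\<^sub>R (y - z)) has_derivative (\<lambda>h. 2 *\<^sub>R h)) (at x)"
    by (auto intro!: derivative_eq_intros)
qed auto

lemma has_grad_lap_add:
  assumes "has_grad_lap f pf lf x" "has_grad_lap g pg lg x"
  shows "has_grad_lap (\<lambda>x. f x + g x) (pf + pg) (lf + lg) x"
proof -
  obtain F HF where F: "\<forall>\<^sub>F y in nhds x. (f has_derivative (\<lambda>h. F y \<bullet> h)) (at y)"
    "(F has_derivative HF) (at x)" "F x = pf" "lf = (\<Sum>b\<in>Basis. HF b \<bullet> b)"
    using assms(1) unfolding has_grad_lap_def by blast
  obtain G HG where G: "\<forall>\<^sub>F y in nhds x. (g has_derivative (\<lambda>h. G y \<bullet> h)) (at y)"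
    "(G has_derivative HG) (at x)" "G x = pg" "lg = (\<Sum>b\<in>Basis. HG b \<bullet> b)"
    using assms(2) unfolding has_grad_lap_def by blast
  show ?thesis
  proof (rule has_grad_lapI[where G="\<lambda>y. F y + G y" and H="\<lambda>h. HF h + HG h"])
    show "\<forall>\<^sub>F y in nhds x. ((\<lambda>x. f x + g x) has_derivative (\<lambda>h. (F y + G y) \<bullet> h)) (at y)"
      using F(1) G(1) by eventually_elim (auto intro!: derivative_eq_intros simp: inner_add_left)
  qed (use F G in \<open>auto intro!: has_derivative_add simp: inner_add_left sum.distrib\<close>)
qed

lemma has_grad_lap_mult:
  assumes "has_grad_lap f pf lf x" "has_grad_lap g pg lg x"
  shows "has_grad_lap (\<lambda>x. f x * g x) (f x *\<^sub>R pg + g x *\<^sub>R pf) (f x * lg + g x * lf + 2 * (pf \<bullet> pg)) x"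
proof -
  obtain F HF where F: "\<forall>\<^sub>F y in nhds x. (f has_derivative (\<lambda>h. F y \<bullet> h)) (at y)"
    "(F has_derivative HF) (at x)" "F x = pf" "lf = (\<Sum>b\<in>Basis. HF b \<bullet> b)"
    using assms(1) unfolding has_grad_lap_def by blast
  obtain G HG where G: "\<forall>\<^sub>F y in nhds x. (g has_derivative (\<lambda>h. G y \<bullet> h)) (at y)"
    "(G has_derivative HG) (at x)" "G x = pg" "lg = (\<Sum>b\<in>Basis. HG b \<bullet> b)"
    using assms(2) unfolding has_grad_lap_def by blast
  note df = has_grad_lap_derivative[OF assms(1)] has_grad_lap_derivative[OF assms(2)]
  show ?thesis
  proof (rule has_grad_lapI[where G="\<lambda>y. f y *\<^sub>R G y + g y *\<^sub>R F y"
        and H="\<lambda>h. (f x *\<^sub>R HG h + (pf \<bullet> h) *\<^sub>R pg) + (g x *\<^sub>R HF h + (pg \<bullet> h) *\<^sub>R pf)"])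
    show "\<forall>\<^sub>F y in nhds x. ((\<lambda>x. f x * g x) has_derivative (\<lambda>h. (f y *\<^sub>R G y + g y *\<^sub>R F y) \<bullet> h)) (at y)"
      using F(1) G(1)
      by eventually_elim (auto intro!: derivative_eq_intros simp: inner_add_left mult_ac)
    show "((\<lambda>y. f y *\<^sub>R G y + g y *\<^sub>R F y) has_derivative
       (\<lambda>h. (f x *\<^sub>R HG h + (pf \<bullet> h) *\<^sub>R pg) + (g x *\<^sub>R HF h + (pg \<bullet> h) *\<^sub>R pf))) (at x)"
      using has_derivative_add[OF has_derivative_scaleR[OF df(1) G(2)] has_derivative_scaleR[OF df(2) F(2)]]
      by (simp add: F G)
    show "(\<Sum>b\<in>Basis. (f x *\<^sub>R HG b + (pf \<bullet> b) *\<^sub>R pg + (g x *\<^sub>R HF b + (pg \<bullet> b) *\<^sub>R pf)) \<bullet> b)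
       = f x * lg + g x * lf + 2 * (pf \<bullet> pg)"
      unfolding F(4) G(4)
      by (subst euclidean_inner[of pf pg])
        (simp add: inner_add_left sum.distrib sum_distrib_left algebra_simps)
  qed (simp add: F G)
qed

lemma has_grad_lap_compose:
  assumes g: "has_grad_lap g p l x"
    and ph: "\<forall>\<^sub>F s in nhds (g x). (\<phi> has_real_derivative \<phi>' s) (at s)"
    and ph2: "(\<phi>' has_real_derivative \<phi>2) (at (g x))"
  shows "has_grad_lap (\<lambda>x. \<phi> (g x)) (\<phi>' (g x) *\<^sub>R p) (\<phi>' (g x) * l + \<phi>2 * (p \<bullet> p)) x"
proof -
  obtain G HG where G: "\<forall>\<^sub>F y in nhds x. (g has_derivative (\<lambda>h. G y \<bullet> h)) (at y)"
    "(G has_derivative HG) (at x)" "G x = p" "l = (\<Sum>b\<in>Basis. HG b \<bullet> b)"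
    using g unfolding has_grad_lap_def by blast
  note dg = has_grad_lap_derivative[OF g]
  have "isCont g x" using dg by (rule has_derivative_continuous)
  then have "(g \<longlongrightarrow> g x) (nhds x)"
    by (simp add: continuous_at_imp_continuous_within isCont_def tendsto_at_iff_tendsto_nhds)
  then have ev: "\<forall>\<^sub>F y in nhds x. (\<phi> has_real_derivative \<phi>' (g y)) (at (g y))"
    using ph by (rule eventually_compose_filterlim[rotated])
  show ?thesis
  proof (rule has_grad_lapI[where G="\<lambda>y. \<phi>' (g y) *\<^sub>R G y"
        and H="\<lambda>h. \<phi>' (g x) *\<^sub>R HG h + (\<phi>2 * (p \<bullet> h)) *\<^sub>R p"])
    show "\<forall>\<^sub>F y in nhds x. ((\<lambda>x. \<phi> (g x)) has_derivative (\<lambda>h. (\<phi>' (g y) *\<^sub>R G y) \<bullet> h)) (at y)"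
      using ev G(1)
    proof eventually_elim
      case (elim y)
      show ?case using has_derivative_compose[OF elim(2) elim(1)[unfolded has_field_derivative_def]] by simp
    qed
    have "((\<lambda>y. \<phi>' (g y)) has_derivative (\<lambda>h. \<phi>2 * (p \<bullet> h))) (at x)"
      using has_derivative_compose[OF dg ph2[unfolded has_field_derivative_def]] .
    from has_derivative_scaleR[OF this G(2)]
    show "((\<lambda>y. \<phi>' (g y) *\<^sub>R G y) has_derivative
       (\<lambda>h. \<phi>' (g x) *\<^sub>R HG h + (\<phi>2 * (p \<bullet> h)) *\<^sub>R p)) (at x)"
      by (simp add: G)
    show "(\<Sum>b\<in>Basis. (\<phi>' (g x) *\<^sub>R HG b + (\<phi>2 * (p \<bullet> b)) *\<^sub>R p) \<bullet> b) = \<phi>' (g x) * l + \<phi>2 * (p \<bullet> p)"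
      unfolding G(4)
      by (subst euclidean_inner[of p p])
        (simp add: inner_add_left sum.distrib sum_distrib_left algebra_simps)
  qed (simp add: G)
qed

lemma has_grad_lap_cmult:
  assumes "has_grad_lap g p l x" shows "has_grad_lap (\<lambda>x. c * g x) (c *\<^sub>R p) (c * l) x"
  by (rule has_grad_lap_eq[OF has_grad_lap_mult[OF has_grad_lap_const assms]]) auto

lemma has_grad_lap_diff:
  assumes "has_grad_lap f pf lf x" "has_grad_lap g pg lg x"
  shows "has_grad_lap (\<lambda>x. f x - g x) (pf - pg) (lf - lg) x"
  using has_grad_lap_add[OF assms(1) has_grad_lap_cmult[OF assms(2), of "-1"]] by simp

lemma has_grad_lap_translate:
  assumes "has_grad_lap g p l (x + c)" shows "has_grad_lap (\<lambda>x. g (x + c)) p l x"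
proof -
  obtain G HG where G: "\<forall>\<^sub>F y in nhds (x + c). (g has_derivative (\<lambda>h. G y \<bullet> h)) (at y)"
    "(G has_derivative HG) (at (x + c))" "G (x + c) = p" "l = (\<Sum>b\<in>Basis. HG b \<bullet> b)"
    using assms unfolding has_grad_lap_def by blast
  have "((\<lambda>x. x + c) \<longlongrightarrow> x + c) (nhds x)" by (intro tendsto_intros filterlim_ident)
  then have ev: "\<forall>\<^sub>F y in nhds x. (g has_derivative (\<lambda>h. G (y + c) \<bullet> h)) (at (y + c))"
    using G(1) by (rule eventually_compose_filterlim[rotated])
  have d: "((\<lambda>x. x + c) has_derivative (\<lambda>h. h)) (at y)" for y by (auto intro!: derivative_eq_intros)
  show ?thesis
  proof (rule has_grad_lapI[where G="\<lambda>y. G (y + c)" and H=HG])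
    show "\<forall>\<^sub>F y in nhds x. ((\<lambda>x. g (x + c)) has_derivative (\<lambda>h. G (y + c) \<bullet> h)) (at y)"
      using ev
    proof eventually_elim
      case (elim y) show ?case using has_derivative_compose[OF d elim] by simp
    qed
    show "((\<lambda>y. G (y + c)) has_derivative HG) (at x)" using has_derivative_compose[OF d G(2)] by simp
  qed (simp_all add: G)
qed

definition mirror :: "'a::euclidean_space \<Rightarrow> real \<Rightarrow> 'a \<Rightarrow> 'a" where
  "mirror e \<mu> x = x + (2 * (\<mu> - e \<bullet> x)) *\<^sub>R e"

text \<open>
  Reflections are isometries, so they leave the trace of the second derivative unchanged.
\<close>

lemma has_grad_lap_mirror:
  assumes e: "norm e = 1" and g: "has_grad_lap g p l (mirror e \<mu> x)"
  shows "has_grad_lap (\<lambda>x. g (mirror e \<mu> x)) (p - (2 * (e \<bullet> p)) *\<^sub>R e) l x"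
proof -
  have ee: "e \<bullet> e = 1" using e by (simp add: norm_eq_1)
  define S where "S h = h - (2 * (e \<bullet> h)) *\<^sub>R e" for h
  have Sadj: "a \<bullet> S h = S a \<bullet> h" for a h
    by (simp add: S_def inner_diff inner_commute)
  obtain G HG where G: "\<forall>\<^sub>F y in nhds (mirror e \<mu> x). (g has_derivative (\<lambda>h. G y \<bullet> h)) (at y)"
    "(G has_derivative HG) (at (mirror e \<mu> x))" "G (mirror e \<mu> x) = p" "l = (\<Sum>b\<in>Basis. HG b \<bullet> b)"
    using g unfolding has_grad_lap_def by blast
  have d: "(mirror e \<mu> has_derivative S) (at y)" for y
    unfolding mirror_def S_def by (auto intro!: derivative_eq_intros simp: algebra_simps)
  have dS: "(S has_derivative S) (at y)" for y
    unfolding S_def by (auto intro!: derivative_eq_intros)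
  have "isCont (mirror e \<mu>) x" using d by (rule has_derivative_continuous)
  then have "(mirror e \<mu> \<longlongrightarrow> mirror e \<mu> x) (nhds x)"
    by (simp add: isCont_def tendsto_at_iff_tendsto_nhds)
  then have ev: "\<forall>\<^sub>F y in nhds x. (g has_derivative (\<lambda>h. G (mirror e \<mu> y) \<bullet> h)) (at (mirror e \<mu> y))"
    using G(1) by (rule eventually_compose_filterlim[rotated])
  have linH: "linear HG" using G(2) by (rule has_derivative_linear)
  show ?thesis
  proof (rule has_grad_lapI[where G="\<lambda>y. S (G (mirror e \<mu> y))" and H="\<lambda>h. S (HG (S h))"])
    show "\<forall>\<^sub>F y in nhds x. ((\<lambda>x. g (mirror e \<mu> x)) has_derivative (\<lambda>h. S (G (mirror e \<mu> y)) \<bullet> h)) (at y)"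
      using ev
    proof eventually_elim
      case (elim y) show ?case using has_derivative_compose[OF d elim] by (simp add: Sadj)
    qed
    show "((\<lambda>y. S (G (mirror e \<mu> y))) has_derivative (\<lambda>h. S (HG (S h)))) (at x)"
      using has_derivative_compose[OF has_derivative_compose[OF d G(2)] dS] .
    show "S (G (mirror e \<mu> x)) = p - (2 * (e \<bullet> p)) *\<^sub>R e" by (simp add: S_def G)
    have HS: "HG (S b) = HG b - (2 * (e \<bullet> b)) *\<^sub>R HG e" for b
      unfolding S_def by (simp add: linear_diff[OF linH] linear_scale[OF linH])
    have eq: "S (HG (S b)) \<bullet> b = HG b \<bullet> b - 2 * ((e \<bullet> b) * (HG e \<bullet> b)) - 2 * ((e \<bullet> HG b) * (e \<bullet> b))
        + 4 * (e \<bullet> HG e) * ((e \<bullet> b) * (e \<bullet> b))" for b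
      unfolding HS by (simp add: S_def inner_diff inner_add algebra_simps)
    have "(\<Sum>b\<in>Basis. (e \<bullet> HG b) * (e \<bullet> b)) = e \<bullet> HG (\<Sum>b\<in>Basis. (e \<bullet> b) *\<^sub>R b)"
      by (simp add: linear_sum[OF linH] linear_scale[OF linH] inner_sum_right mult.commute)
    then have s1: "(\<Sum>b\<in>Basis. (e \<bullet> HG b) * (e \<bullet> b)) = e \<bullet> HG e" by (simp add: euclidean_representation)
    have s2: "(\<Sum>b\<in>Basis. (e \<bullet> b) * (HG e \<bullet> b)) = e \<bullet> HG e"
      by (rule euclidean_inner[symmetric])
    have s3: "(\<Sum>b\<in>Basis. (e \<bullet> b) * (e \<bullet> b)) = 1"
      using euclidean_inner[of e e] ee by simp
    show "(\<Sum>b\<in>Basis. S (HG (S b)) \<bullet> b) = l"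
      unfolding eq G(4) by (simp add: sum.distrib sum_subtractf s1 s2 s3 flip: sum_distrib_left)
  qed
qed

lemma has_grad_lap_local_min:
  assumes g: "has_grad_lap g p l x" and m: "\<forall>\<^sub>F y in nhds x. g x \<le> g y"
  shows "p = 0" "0 \<le> l"
proof -
  obtain G H where G: "\<forall>\<^sub>F y in nhds x. (g has_derivative (\<lambda>h. G y \<bullet> h)) (at y)"
    "(G has_derivative H) (at x)" "G x = p" "l = (\<Sum>b\<in>Basis. H b \<bullet> b)"
    using g unfolding has_grad_lap_def by blast
  obtain d where d: "d > 0" "\<And>y. dist y x < d \<Longrightarrow> g x \<le> g y \<and> (g has_derivative (\<lambda>h. G y \<bullet> h)) (at y)"
    using eventually_conj[OF m G(1)] unfolding eventually_nhds_metric by blast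
  have "(\<lambda>h. p \<bullet> h) = (\<lambda>h. 0)"
    by (rule has_derivative_local_min[OF has_grad_lap_derivative[OF g]])
      (use m in \<open>auto simp: eventually_at_filter elim: eventually_mono\<close>)
  then have "p \<bullet> p = 0" by meson
  then show p0: "p = 0" by simp
  have "0 \<le> H b \<bullet> b" if b: "b \<in> Basis" for b
  proof (rule ccontr)
    assume "\<not> 0 \<le> H b \<bullet> b"
    then have neg: "H b \<bullet> b < 0" by simp
    define \<phi>' where "\<phi>' r = G (x + r *\<^sub>R b) \<bullet> b" for r
    have der: "((\<lambda>r. g (x + r *\<^sub>R b)) has_real_derivative \<phi>' r) (at r)" if "\<bar>r\<bar> < d" for r
    proof -
      have "((\<lambda>r. x + r *\<^sub>R b) has_derivative (\<lambda>h. h *\<^sub>R b)) (at r)" by (auto intro!: derivative_eq_intros)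
      moreover have "dist (x + r *\<^sub>R b) x < d" using that b by (simp add: dist_norm)
      ultimately have "((\<lambda>r. g (x + r *\<^sub>R b)) has_derivative (\<lambda>h. G (x + r *\<^sub>R b) \<bullet> (h *\<^sub>R b))) (at r)"
        using has_derivative_compose d(2) by blast
      then show ?thesis unfolding has_field_derivative_def \<phi>'_def by (simp add: mult.commute[of _ "G _ \<bullet> b"])
    qed
    have "((\<lambda>r. x + r *\<^sub>R b) has_derivative (\<lambda>h. h *\<^sub>R b)) (at 0)" by (auto intro!: derivative_eq_intros)
    moreover have "(G has_derivative H) (at (x + 0 *\<^sub>R b))" using G(2) by simp
    ultimately have "((\<lambda>r. G (x + r *\<^sub>R b)) has_derivative (\<lambda>h. H (h *\<^sub>R b))) (at 0)"
      by (rule has_derivative_compose)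
    then have "(\<phi>' has_derivative (\<lambda>h. H (h *\<^sub>R b) \<bullet> b)) (at 0)"
      unfolding \<phi>'_def by (rule has_derivative_inner_left)
    then have "(\<phi>' has_real_derivative (H b \<bullet> b)) (at 0)"
      unfolding has_field_derivative_def
      by (simp add: linear_scale[OF has_derivative_linear[OF G(2)]] mult.commute[of _ "H b \<bullet> b"])
    from DERIV_neg_dec_right[OF this neg] obtain d2 where d2: "d2 > 0" "\<And>h. h > 0 \<Longrightarrow> h < d2 \<Longrightarrow> \<phi>' h < \<phi>' 0"
      by auto
    have "\<phi>' 0 = 0" using G(3) p0 by (simp add: \<phi>'_def)
    define r where "r = min d d2 / 2"
    have r: "0 < r" "r < d" "r < d2" using d(1) d2(1) by (auto simp: r_def min_def)
    obtain \<xi> where xi: "\<xi> > 0" "\<xi> < r" "g (x + r *\<^sub>R b) - g (x + 0 *\<^sub>R b) = (r - 0) * \<phi>' \<xi>"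
      using MVT2[OF r(1), of "\<lambda>r. g (x + r *\<^sub>R b)" \<phi>'] der r by auto
    have "\<phi>' \<xi> < 0" using d2(2)[of \<xi>] xi r \<open>\<phi>' 0 = 0\<close> by auto
    then have "g (x + r *\<^sub>R b) < g x" using xi(3) mult_pos_neg[OF r(1)] by fastforce
    moreover have "g x \<le> g (x + r *\<^sub>R b)" using d(2)[of "x + r *\<^sub>R b"] r b by (simp add: dist_norm)
    ultimately show False by simp
  qed
  then show "0 \<le> l" unfolding G(4) by (intro sum_nonneg) auto
qed

text \<open>
  At a negative
  minimum of \<open>exp (- \<Lambda> t) Z\<close> the gradient vanishes, the Laplacian is nonnegative and the time
  derivative of \<open>Z\<close> is at most \<open>\<Lambda> Z\<close>.  A large \<open>\<Lambda>\<close> absorbs a bounded zero-order term.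
\<close>

lemma parabolic_minimum_principle:
  fixes Z :: "'a::euclidean_space \<Rightarrow> real \<Rightarrow> real"
  assumes K: "compact K" and U: "open U" "U \<subseteq> K"
    and cont: "continuous_on (K \<times> {a..b}) (\<lambda>(x, t). Z x t)"
    and init: "\<And>x. x \<in> K \<Longrightarrow> 0 \<le> Z x a"
    and bdry: "\<And>x t. x \<in> K - U \<Longrightarrow> t \<in> {a..b} \<Longrightarrow> 0 \<le> Z x t"
    and inner: "\<And>x t. x \<in> U \<Longrightarrow> a < t \<Longrightarrow> t \<le> b \<Longrightarrow> Z x t < 0 \<Longrightarrow>
       \<exists>zt p l. (Z x has_real_derivative zt) (at t) \<and> has_grad_lap (\<lambda>y. Z y t) p l x \<and>
         (p = 0 \<longrightarrow> \<Lambda> * Z x t < zt - l)"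
    and x: "x \<in> K" and t: "t \<in> {a..b}"
  shows "0 \<le> Z x t"
proof (rule ccontr)
  assume neg: "\<not> 0 \<le> Z x t"
  define W where "W = (\<lambda>(x, t). exp (- \<Lambda> * t) * Z x t)"
  have "continuous_on (K \<times> {a..b}) W"
    unfolding W_def using cont by (auto intro!: continuous_intros simp: case_prod_beta)
  moreover have "compact (K \<times> {a..b})" using K by (intro compact_Times) auto
  moreover have "K \<times> {a..b} \<noteq> {}" using x t by auto
  ultimately obtain z where z: "z \<in> K \<times> {a..b}" "\<And>y. y \<in> K \<times> {a..b} \<Longrightarrow> W z \<le> W y"
    using continuous_attains_inf[of "K \<times> {a..b}" W] by blast
  obtain x0 t0 where z0: "z = (x0, t0)" by force
  have x0: "x0 \<in> K" "t0 \<in> {a..b}" using z(1) z0 by auto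
  have le: "exp (- \<Lambda> * t0) * Z x0 t0 \<le> exp (- \<Lambda> * s) * Z y s" if "y \<in> K" "s \<in> {a..b}" for y s
    using z(2)[of "(y, s)"] that by (auto simp: W_def z0)
  have "exp (- \<Lambda> * t) * Z x t < 0" using neg by (simp add: mult_pos_neg)
  then have "exp (- \<Lambda> * t0) * Z x0 t0 < 0" using le[OF x t] by linarith
  then have Z0: "Z x0 t0 < 0" by (simp add: mult_less_0_iff)
  have "x0 \<in> U" "t0 \<noteq> a" using Z0 bdry[of x0 t0] init[of x0] x0 by force+
  then have xt: "x0 \<in> U" "a < t0" "t0 \<le> b" using x0 by auto
  obtain zt p l where zt: "(Z x0 has_real_derivative zt) (at t0)" "has_grad_lap (\<lambda>y. Z y t0) p l x0"
    "p = 0 \<longrightarrow> \<Lambda> * Z x0 t0 < zt - l"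
    using inner[OF xt Z0] by blast
  have "\<forall>\<^sub>F y in nhds x0. Z x0 t0 \<le> Z y t0"
  proof -
    have "\<forall>\<^sub>F y in nhds x0. y \<in> U" using U(1) xt(1) by (simp add: eventually_nhds) blast
    then show ?thesis
    proof eventually_elim
      case (elim y) then show ?case using le[of y t0] U(2) x0(2) by auto
    qed
  qed
  from has_grad_lap_local_min[OF zt(2) this] have "0 \<le> l" "\<Lambda> * Z x0 t0 < zt - l" using zt(3) by auto
  then have gt: "\<Lambda> * Z x0 t0 < zt" by linarith
  have der: "((\<lambda>s. exp (- \<Lambda> * s) * Z x0 s) has_real_derivative
      (exp (- \<Lambda> * t0) * zt + exp (- \<Lambda> * t0) * (- \<Lambda>) * Z x0 t0)) (at t0)"
    using zt(1) by (auto intro!: derivative_eq_intros)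
  have "exp (- \<Lambda> * t0) * zt + exp (- \<Lambda> * t0) * (- \<Lambda>) * Z x0 t0 = exp (- \<Lambda> * t0) * (zt - \<Lambda> * Z x0 t0)"
    by (simp add: algebra_simps)
  also have "\<dots> > 0" using gt by simp
  finally have pos: "exp (- \<Lambda> * t0) * zt + exp (- \<Lambda> * t0) * (- \<Lambda>) * Z x0 t0 > 0" .
  obtain d where d: "d > 0" "\<And>h. h > 0 \<Longrightarrow> h < d \<Longrightarrow>
      exp (- \<Lambda> * (t0 - h)) * Z x0 (t0 - h) < exp (- \<Lambda> * t0) * Z x0 t0"
    using DERIV_pos_inc_left[OF der pos] by auto
  define h where "h = min d (t0 - a) / 2"
  have h: "h > 0" "h < d" "t0 - h \<in> {a..b}" using d(1) xt by (auto simp: h_def min_def field_simps)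
  show False using d(2)[OF h(1,2)] le[OF x0(1) h(3)] by linarith
qed

section \<open>A semilinear heat equation and its reflection in a hyperplane\<close>

text \<open>
  The reaction term enters only through its values \<open>q\<close>, which are a monotone and locally Lipschitz function
  of \<open>w\<close>.  The equation is required at positive times only; initial and boundary values are taken
  in the sense of continuity.
\<close>

locale reaction_heat =
  fixes \<Omega> :: "'a::euclidean_space set" and T m :: real and w q :: "'a \<Rightarrow> real \<Rightarrow> real"
  assumes open_dom: "open \<Omega>" and convex_dom: "convex \<Omega>" and bounded_dom: "bounded \<Omega>"
    and T_pos: "0 < T"
    and w_cont: "continuous_on (closure \<Omega> \<times> {0..<T}) (\<lambda>(x, t). w x t)"
    and w_nonneg: "\<And>x t. x \<in> closure \<Omega> \<Longrightarrow> t \<in> {0..<T} \<Longrightarrow> 0 \<le> w x t"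
    and w_init: "\<And>x. x \<in> closure \<Omega> \<Longrightarrow> w x 0 = 0"
    and w_bdry: "\<And>x t. x \<in> frontier \<Omega> \<Longrightarrow> t \<in> {0..<T} \<Longrightarrow> w x t = 0"
    and w_eq: "\<And>x t. x \<in> \<Omega> \<Longrightarrow> t \<in> {0<..<T} \<Longrightarrow> \<exists>wt p l. (w x has_real_derivative wt) (at t) \<and>
       has_grad_lap (\<lambda>y. w y t) p l x \<and> wt - l = q x t"
    and m_pos: "0 < m" and q_ge: "\<And>x t. x \<in> \<Omega> \<Longrightarrow> t \<in> {0<..<T} \<Longrightarrow> m \<le> q x t"
    and q_mono: "\<And>x y t. x \<in> \<Omega> \<Longrightarrow> y \<in> \<Omega> \<Longrightarrow> t \<in> {0<..<T} \<Longrightarrow> w x t \<le> w y t \<Longrightarrow> q x t \<le> q y t"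
    and q_lipschitz: "\<And>M. \<exists>K\<ge>0. \<forall>t\<in>{0<..<T}. \<forall>x\<in>\<Omega>. \<forall>y\<in>\<Omega>.
       w y t \<le> w x t \<longrightarrow> w x t \<le> M \<longrightarrow> q x t - q y t \<le> K * (w x t - w y t)"
begin

lemma compact_closure_dom: "compact (closure \<Omega>)"
  using bounded_dom by (simp add: compact_closure)

text \<open>
  The source is at least \<open>m\<close>, so \<open>\<eta> s (d\<^sup>2 - \<bar>y - x\<bar>\<^sup>2)\<close> is a subsolution on the ball for small \<open>\<eta>\<close>.  The
  quadratic growth in the distance to the boundary holds in every domain; near corners
  linear growth would be false.
\<close>

lemma interior_lower_bound:
  "\<exists>\<eta>>0. \<forall>x d t. 0 < d \<longrightarrow> ball x d \<subseteq> \<Omega> \<longrightarrow> t \<in> {0..<T} \<longrightarrow> \<eta> * t * d\<^sup>2 \<le> w x t"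
proof -
  obtain \<rho> where \<rho>: "\<rho> > 0" "\<And>x. x \<in> \<Omega> \<Longrightarrow> norm x \<le> \<rho>"
    using bounded_dom bounded_pos by metis
  define Q where "Q = 16 * \<rho>\<^sup>2 + 2 * T * real DIM('a)"
  define \<eta> where "\<eta> = m / (2 * Q)"
  have Q: "Q > 0" using \<rho> T_pos by (simp add: Q_def add_pos_nonneg)
  have \<eta>: "\<eta> > 0" using m_pos Q by (simp add: \<eta>_def)
  have \<eta>Q: "\<eta> * Q < m" using m_pos Q by (simp add: \<eta>_def)
  have "\<eta> * t * d\<^sup>2 \<le> w x t" if d: "0 < d" "ball x d \<subseteq> \<Omega>" and t: "t \<in> {0..<T}" for x d t
  proof -
    obtain b :: 'a where b: "b \<in> Basis" using nonempty_Basis by blast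
    have "x + (d/2) *\<^sub>R b \<in> \<Omega>" "x \<in> \<Omega>" using d b by (auto simp: subset_iff dist_norm)
    then have "norm ((x + (d/2) *\<^sub>R b) - x) \<le> \<rho> + \<rho>"
      using \<rho>(2) norm_triangle_ineq4 by (metis add_mono order_trans)
    then have "d \<le> 4 * \<rho>" using b d by simp
    then have d2: "d\<^sup>2 \<le> 16 * \<rho>\<^sup>2" using d power_mono[of d "4*\<rho>" 2] by (simp add: power_mult_distrib)
    have cb: "cball x d \<subseteq> closure \<Omega>" using closure_mono[OF d(2)] d(1) by simp
    define Z where "Z y s = w y s + s * (\<eta> * ((y - x) \<bullet> (y - x) + (- d\<^sup>2)))" for y s
    have "0 \<le> Z x t"
    proof (rule parabolic_minimum_principle[where K="cball x d" and U="ball x d" and a=0 and b=t and \<Lambda>=0 and Z=Z])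
      have "continuous_on (cball x d \<times> {0..t}) (\<lambda>(x, t). w x t)"
        using w_cont cb t by (elim continuous_on_subset) auto
      then show "continuous_on (cball x d \<times> {0..t}) (\<lambda>(x, t). Z x t)"
        unfolding Z_def by (auto intro!: continuous_intros simp: case_prod_beta)
      fix y s
      assume y: "y \<in> cball x d - ball x d" "s \<in> {0..t}"
      then have "norm (y - x) = d" by (simp add: dist_norm norm_minus_commute)
      then have "(y - x) \<bullet> (y - x) = d\<^sup>2" by (simp add: power2_norm_eq_inner[symmetric] dist_norm norm_minus_commute)
      then have "Z y s = w y s" by (simp add: Z_def)
      then show "0 \<le> Z y s" using w_nonneg[of y s] y cb t by auto
    next
      fix y s assume y: "y \<in> ball x d" and s: "0 < s" "s \<le> t"
      have yO: "y \<in> \<Omega>" "s \<in> {0<..<T}" using y d s t by auto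
      obtain wt p l where e: "(w y has_real_derivative wt) (at s)" "has_grad_lap (\<lambda>y. w y s) p l y" "wt - l = q y s"
        using w_eq[OF yO] by blast
      have 1: "(Z y has_real_derivative (wt + \<eta> * ((y - x) \<bullet> (y - x) + (- d\<^sup>2)))) (at s)"
        unfolding Z_def[abs_def] using e(1) by (auto intro!: derivative_eq_intros)
      note 2 = has_grad_lap_add[OF e(2) has_grad_lap_cmult[OF has_grad_lap_cmult[OF has_grad_lap_add[OF has_grad_lap_dist_square[of x y] has_grad_lap_const[of "-d\<^sup>2"]]], of s \<eta>]]
      have "\<eta> * (d\<^sup>2 - (y - x) \<bullet> (y - x)) + s * (\<eta> * (2 * real DIM('a))) \<le> \<eta> * Q"
      proof -
        have "d\<^sup>2 - (y - x) \<bullet> (y - x) \<le> 16 * \<rho>\<^sup>2" using d2 inner_ge_zero[of "y - x"] by linarith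
        moreover have "s * (2 * real DIM('a)) \<le> T * (2 * real DIM('a))" using yO by (intro mult_right_mono) auto
        ultimately have "d\<^sup>2 - (y - x) \<bullet> (y - x) + s * (2 * real DIM('a)) \<le> Q" unfolding Q_def by argo
        from mult_left_mono[OF this, of \<eta>] \<eta> show ?thesis by (simp add: algebra_simps)
      qed
      then have "0 < wt + \<eta> * ((y - x) \<bullet> (y - x) + (- d\<^sup>2)) - (l + s * (\<eta> * (2 * real DIM('a) + 0)))"
        using e(3) q_ge[OF yO] \<eta>Q by (simp add: algebra_simps)
      then show "\<exists>zt p l. (Z y has_real_derivative zt) (at s) \<and> has_grad_lap (\<lambda>y. Z y s) p l y \<and>
           (p = 0 \<longrightarrow> 0 * Z y s < zt - l)"
        using 1 2 unfolding Z_def[symmetric] by (intro exI conjI) auto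
    qed (use d t cb w_init w_nonneg in \<open>auto simp: Z_def\<close>)
    then show ?thesis by (simp add: Z_def algebra_simps)
  qed
  then show ?thesis using \<eta> by blast
qed

end

text \<open>
  The cap is the part of \<open>\<Omega>\<close> inside the ball of radius \<open>r\<close> around \<open>xc\<close> that lies below the hyperplane
  \<open>e \<bullet> x = \<mu>\<close>.  The cone condition says that \<open>\<Omega>\<close> is entered from its boundary along all directions
  close to \<open>e\<close>, and together with thinness it keeps the mirror image of the cap inside \<open>\<Omega>\<close>.  On the cap \<open>w\<close> is bounded by \<open>M\<close>
  up to time \<open>b\<close>, and \<open>K\<close> is the corresponding Lipschitz constant of the reaction term.
\<close>

locale reflected_cap = reaction_heat \<Omega> T m w q
  for \<Omega> :: "'a::euclidean_space set" and T m :: real and w q :: "'a \<Rightarrow> real \<Rightarrow> real" +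
  fixes e :: "'a" and \<mu> :: real and xc :: 'a and r b M K \<sigma> s\<^sub>0 :: real
  assumes norm_e: "norm e = 1" and \<sigma>: "0 < \<sigma>" and s\<^sub>0: "0 < s\<^sub>0"
    and cone: "\<And>x s \<omega>. x \<in> closure \<Omega> \<Longrightarrow> dist xc x < r \<Longrightarrow> 0 < s \<Longrightarrow> s \<le> s\<^sub>0 \<Longrightarrow> norm \<omega> \<le> \<sigma>
       \<Longrightarrow> x + s *\<^sub>R (e + \<omega>) \<in> \<Omega>"
    and b: "0 \<le> b" "b < T"
    and bdd: "\<And>x t. x \<in> \<Omega> \<Longrightarrow> dist xc x < r \<Longrightarrow> 0 < \<mu> - e \<bullet> x \<Longrightarrow> t \<in> {0..b} \<Longrightarrow> w x t \<le> M"
    and K: "0 \<le> K" and lip: "\<And>t x y. t \<in> {0<..b} \<Longrightarrow> x \<in> \<Omega> \<Longrightarrow> y \<in> \<Omega> \<Longrightarrow> w y t \<le> w x t \<Longrightarrow> w x t \<le> M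
       \<Longrightarrow> q x t - q y t \<le> K * (w x t - w y t)"
    and thin: "\<And>x. x \<in> closure \<Omega> \<Longrightarrow> dist xc x < r \<Longrightarrow> 2 * (\<mu> - e \<bullet> x) \<le> s\<^sub>0"
begin

text \<open>
  The depth below the reflecting hyperplane.
\<close>

definition Y :: "'a \<Rightarrow> real" where "Y x = \<mu> - e \<bullet> x"

definition D :: "'a \<Rightarrow> real \<Rightarrow> real" where "D x t = w (mirror e \<mu> x) t - w x t"

lemma ee: "e \<bullet> e = 1" using norm_e by (simp add: norm_eq_1)

lemma mirror_Y: "mirror e \<mu> x = x + (2 * Y x) *\<^sub>R e" by (simp add: mirror_def Y_def)

lemma has_grad_lap_Y: "has_grad_lap Y (- e) 0 x"
  using has_grad_lap_affine[of "- e" \<mu>] by (simp add: Y_def[abs_def])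

lemma continuous_Y: "continuous_on S Y"
  unfolding Y_def[abs_def] by (intro continuous_intros)

lemma mirror_in_dom:
  assumes "x \<in> closure \<Omega>" "dist xc x < r" "0 < Y x" shows "mirror e \<mu> x \<in> \<Omega>"
  using cone[OF assms(1,2), of "2 * Y x" 0] thin[OF assms(1,2)] assms(3) \<sigma> by (simp add: mirror_Y Y_def)

lemma mirror_in_closure:
  assumes "x \<in> closure \<Omega>" "dist xc x < r" "0 \<le> Y x" shows "mirror e \<mu> x \<in> closure \<Omega>"
  using mirror_in_dom[OF assms(1,2)] assms closure_subset[of \<Omega>] by (cases "Y x = 0") (auto simp: mirror_Y)

text \<open>
  The minimum principle for \<open>D + E\<close>.  Since \<open>D\<close> solves a linear equation whose zero-order coefficient lies
  between 0 and \<open>K\<close> where \<open>D < 0\<close>, and is nonnegative where \<open>D \<ge> 0\<close>, only the term \<open>K * min d 0\<close>, with \<open>d\<close> the value of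
  \<open>D\<close>, has to be beaten by the barrier.  On the boundary of \<open>\<Omega>\<close> the value of \<open>D\<close> is that of \<open>w\<close> at the mirror point, and on the
  hyperplane it is 0, so only the lateral part needs information on \<open>D\<close>.
\<close>

lemma reflection_comparison:
  assumes C: "compact C" "C \<subseteq> ball xc r" and V: "open V" "V \<subseteq> C" and ta: "0 \<le> ta" "tb \<le> b"
    and E_cont: "continuous_on ((closure \<Omega> \<inter> {x. 0 \<le> Y x} \<inter> C) \<times> {ta..tb}) (\<lambda>(x, t). E x t)"
    and bottom: "\<And>x t. x \<in> frontier \<Omega> \<Longrightarrow> x \<in> C \<Longrightarrow> 0 \<le> Y x \<Longrightarrow> t \<in> {ta..tb} \<Longrightarrow> 0 \<le> w (mirror e \<mu> x) t + E x t"
    and top: "\<And>x t. x \<in> closure \<Omega> \<Longrightarrow> x \<in> C \<Longrightarrow> Y x = 0 \<Longrightarrow> t \<in> {ta..tb} \<Longrightarrow> 0 \<le> E x t"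
    and lateral: "\<And>x t. x \<in> \<Omega> \<Longrightarrow> x \<in> C - V \<Longrightarrow> 0 < Y x \<Longrightarrow> t \<in> {ta..tb} \<Longrightarrow> 0 \<le> D x t + E x t"
    and init: "\<And>x. x \<in> closure \<Omega> \<Longrightarrow> x \<in> C \<Longrightarrow> 0 \<le> Y x \<Longrightarrow> 0 \<le> D x ta + E x ta"
    and inner: "\<And>x t. x \<in> \<Omega> \<Longrightarrow> x \<in> V \<Longrightarrow> 0 < Y x \<Longrightarrow> ta < t \<Longrightarrow> t \<le> tb \<Longrightarrow>
       \<exists>et p l. (E x has_real_derivative et) (at t) \<and> has_grad_lap (\<lambda>y. E y t) p l x \<and>
         (\<forall>d\<ge>-M. d + E x t < 0 \<longrightarrow> \<Lambda> * (d + E x t) < K * min d 0 + et - l)"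
    and x: "x \<in> closure \<Omega>" "x \<in> C" "0 \<le> Y x" and t: "t \<in> {ta..tb}"
  shows "0 \<le> D x t + E x t"
proof (rule parabolic_minimum_principle[where K="closure \<Omega> \<inter> {x. 0 \<le> Y x} \<inter> C" and U="\<Omega> \<inter> {x. 0 < Y x} \<inter> V"
      and Z="\<lambda>x t. D x t + E x t" and \<Lambda>=\<Lambda>])
  have Cr: "dist xc x < r" if "x \<in> C" for x using C(2) that by auto
  have tT: "t \<in> {0..<T}" if "t \<in> {ta..tb}" for t using that ta b by auto
  have clY: "closed {x. 0 \<le> Y x}" by (intro closed_Collect_le continuous_Y continuous_intros)
  show "compact (closure \<Omega> \<inter> {x. 0 \<le> Y x} \<inter> C)"
    using C(1) clY by (intro compact_Int closed_Int_compact) auto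
  have "open {x. 0 < Y x}" by (intro open_Collect_less continuous_Y continuous_intros)
  then show "open (\<Omega> \<inter> {x. 0 < Y x} \<inter> V)" using open_dom V(1) by auto
  show "\<Omega> \<inter> {x. 0 < Y x} \<inter> V \<subseteq> closure \<Omega> \<inter> {x. 0 \<le> Y x} \<inter> C" using V(2) closure_subset[of \<Omega>] by auto
  let ?S = "closure \<Omega> \<inter> {x. 0 \<le> Y x} \<inter> C"
  have c1: "continuous_on (?S \<times> {ta..tb}) (\<lambda>(x, t). w x t)"
    by (rule continuous_on_subset[OF w_cont]) (use tT in auto)
  have "continuous_on (?S \<times> {ta..tb}) (\<lambda>z. (\<lambda>(x, t). w x t) (mirror e \<mu> (fst z), snd z))"
  proof (rule continuous_on_compose2[OF w_cont])
    show "continuous_on (?S \<times> {ta..tb}) (\<lambda>z. (mirror e \<mu> (fst z), snd z))"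
      unfolding mirror_def by (intro continuous_intros)
    show "(\<lambda>z. (mirror e \<mu> (fst z), snd z)) ` (?S \<times> {ta..tb}) \<subseteq> closure \<Omega> \<times> {0..<T}"
      using mirror_in_closure tT Cr by auto
  qed
  then show "continuous_on (?S \<times> {ta..tb}) (\<lambda>(x, t). D x t + E x t)"
    using c1 E_cont unfolding D_def by (auto intro!: continuous_intros simp: case_prod_beta)
  show "0 \<le> D x ta + E x ta" if "x \<in> ?S" for x using init[of x] that by auto
  show "0 \<le> D x t + E x t" if xx: "x \<in> ?S - \<Omega> \<inter> {x. 0 < Y x} \<inter> V" "t \<in> {ta..tb}" for x t
  proof (cases "x \<in> \<Omega>")
    case False
    then have fr: "x \<in> frontier \<Omega>" using xx open_dom by (simp add: frontier_def interior_open)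
    then have "w x t = 0" using w_bdry tT xx by blast
    then show ?thesis using bottom[OF fr] xx by (simp add: D_def)
  next
    case True
    show ?thesis
    proof (cases "Y x = 0")
      case True
      then show ?thesis using top[of x t] xx by (simp add: D_def mirror_Y)
    next
      case False
      then show ?thesis using lateral[of x t] True xx by force
    qed
  qed
  show "\<exists>zt p l. ((\<lambda>t. D x t + E x t) has_real_derivative zt) (at t) \<and> has_grad_lap (\<lambda>y. D y t + E y t) p l x \<and>
       (p = 0 \<longrightarrow> \<Lambda> * (D x t + E x t) < zt - l)"
    if xx: "x \<in> \<Omega> \<inter> {x. 0 < Y x} \<inter> V" and tt: "ta < t" "t \<le> tb" and neg: "D x t + E x t < 0" for x t
  proof -
    have x1: "x \<in> \<Omega>" "x \<in> V" "0 < Y x" "x \<in> closure \<Omega>" "dist xc x < r"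
      using xx Cr V(2) closure_subset[of \<Omega>] by auto
    have tT': "t \<in> {0<..<T}" "t \<in> {0..<T}" "t \<in> {0<..b}" "t \<in> {0..b}" using tt ta b by auto
    note Rx = mirror_in_dom[OF x1(4,5,3)]
    have RC: "mirror e \<mu> x \<in> closure \<Omega>" using Rx closure_subset by blast
    obtain wt p l where 1: "(w x has_real_derivative wt) (at t)" "has_grad_lap (\<lambda>y. w y t) p l x" "wt - l = q x t"
      using w_eq[OF x1(1) tT'(1)] by blast
    obtain wt' p' l' where 2: "(w (mirror e \<mu> x) has_real_derivative wt') (at t)"
      "has_grad_lap (\<lambda>y. w y t) p' l' (mirror e \<mu> x)" "wt' - l' = q (mirror e \<mu> x) t"
      using w_eq[OF Rx tT'(1)] by blast
    obtain et pe le where 3: "(E x has_real_derivative et) (at t)" "has_grad_lap (\<lambda>y. E y t) pe le x"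
         "\<forall>d\<ge>-M. d + E x t < 0 \<longrightarrow> \<Lambda> * (d + E x t) < K * min d 0 + et - le"
      using inner[OF x1(1,2,3) tt] by blast
    have "((\<lambda>t. D x t + E x t) has_real_derivative (wt' - wt + et)) (at t)"
      unfolding D_def using 1 2 3 by (auto intro!: derivative_eq_intros)
    moreover note has_grad_lap_add[OF has_grad_lap_diff[OF has_grad_lap_mirror[OF norm_e 2(2)] 1(2)] 3(2)]
    moreover have "\<Lambda> * (D x t + E x t) < wt' - wt + et - (l' - l + le)"
    proof -
      have wM: "w x t \<le> M" using bdd[OF x1(1,5) _ tT'(4)] x1(3) by (simp add: Y_def)
      have "D x t \<ge> - M" using w_nonneg[OF RC tT'(2)] wM by (simp add: D_def)
      then have "\<Lambda> * (D x t + E x t) < K * min (D x t) 0 + et - le" using 3(3) neg by blast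
      moreover have "K * min (D x t) 0 \<le> q (mirror e \<mu> x) t - q x t"
      proof (cases "D x t \<ge> 0")
        case True
        then show ?thesis using q_mono[OF x1(1) Rx tT'(1)] by (simp add: D_def)
      next
        case False
        then show ?thesis using lip[OF tT'(3) x1(1) Rx _ wM] by (simp add: D_def algebra_simps)
      qed
      ultimately show ?thesis using 1(3) 2(3) by linarith
    qed
    ultimately show ?thesis unfolding D_def by (intro exI conjI impI) 
  qed
qed (use x t in auto)

lemma D_init: "x \<in> closure \<Omega> \<Longrightarrow> dist xc x < r \<Longrightarrow> 0 \<le> Y x \<Longrightarrow> D x 0 = 0"
  using mirror_in_closure[of x] w_init by (simp add: D_def)

text \<open>
  A priori \<open>D \<ge> -M\<close>.  Since \<open>D\<close> is nonnegative on the boundary of \<open>\<Omega>\<close> and vanishes on the hyperplane, the concave barrier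
  \<open>2 Y - Y\<^sup>2\<close>, corrected by a quadratic term that takes care of the lateral part, turns this into a bound that is linear
  in the depth and needs no regularity of the boundary.
\<close>

lemma reflection_lipschitz:
  assumes a: "0 < a" "cball x\<^sub>1 a \<subseteq> ball xc r" and x1: "x\<^sub>1 \<in> \<Omega>" "0 < Y x\<^sub>1"
    and Y2: "\<And>x. x \<in> closure \<Omega> \<Longrightarrow> dist xc x < r \<Longrightarrow> Y x \<le> 2"
    and P: "K * M + 2 * real DIM('a) * M / a\<^sup>2 < 2 * P" and t: "t \<in> {0..b}"
  shows "0 \<le> D x\<^sub>1 t + P * (2 * Y x\<^sub>1)"
proof -
  define E where "E x (t::real) = M / a\<^sup>2 * ((x - x\<^sub>1) \<bullet> (x - x\<^sub>1)) + P * (2 * Y x - Y x * Y x)" for x t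
  have x1c: "x\<^sub>1 \<in> closure \<Omega>" "x\<^sub>1 \<in> cball x\<^sub>1 a" "dist xc x\<^sub>1 < r"
    using x1 a closure_subset[of \<Omega>] subsetD[OF a(2), of x\<^sub>1] by auto
  have M: "0 \<le> M" using bdd[OF x1(1) x1c(3), of 0] x1 b w_init[OF x1c(1)] by (auto simp: Y_def)
  have P0: "0 < P"
  proof -
    have "0 \<le> K * M + 2 * real DIM('a) * M / a\<^sup>2" using K M by simp
    then show ?thesis using P by linarith
  qed
  have quad: "0 \<le> P * (2 * Y x - Y x * Y x)" if "x \<in> closure \<Omega>" "dist xc x < r" "0 \<le> Y x" for x
  proof -
    have "Y x * Y x \<le> 2 * Y x" using Y2[OF that(1,2)] that(3) by (intro mult_right_mono) auto
    then show ?thesis using P0 by simp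
  qed
  have E0: "0 \<le> E x t" if "x \<in> closure \<Omega>" "dist xc x < r" "0 \<le> Y x" for x t
    unfolding E_def using quad[OF that] M by simp
  have sub: "x \<in> cball x\<^sub>1 a \<Longrightarrow> dist xc x < r" for x using a by auto
  have frc: "x \<in> frontier \<Omega> \<Longrightarrow> x \<in> closure \<Omega>" for x by (simp add: frontier_def)
  have w0: "0 \<le> w (mirror e \<mu> x) t" if "x \<in> closure \<Omega>" "dist xc x < r" "0 \<le> Y x" "t \<in> {0..b}" for x t
    using w_nonneg[OF mirror_in_closure[OF that(1-3)], of t] that(4) b by auto
  have "0 \<le> D x\<^sub>1 t + E x\<^sub>1 t"
  proof (rule reflection_comparison[where C="cball x\<^sub>1 a" and V="ball x\<^sub>1 a" and \<Lambda>=0 and ta=0 and tb=b])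
    show "continuous_on ((closure \<Omega> \<inter> {x. 0 \<le> Y x} \<inter> cball x\<^sub>1 a) \<times> {0..b}) (\<lambda>(x, t). E x t)"
      unfolding E_def Y_def case_prod_beta by (intro continuous_intros)
    show "0 \<le> w (mirror e \<mu> x) t + E x t" if "x \<in> frontier \<Omega>" "x \<in> cball x\<^sub>1 a" "0 \<le> Y x" "t \<in> {0..b}" for x t
      using E0[of x t] w0[of x t] that sub[of x] frc[of x] by auto
    show "0 \<le> E x t" if "x \<in> closure \<Omega>" "x \<in> cball x\<^sub>1 a" "Y x = 0" for x t
      using E0[of x t] that sub[of x] by auto
    show "0 \<le> D x 0 + E x 0" if "x \<in> closure \<Omega>" "x \<in> cball x\<^sub>1 a" "0 \<le> Y x" for x
      using E0[of x 0] that sub[of x] D_init[of x] by auto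
    show "0 \<le> D x t + E x t" if "x \<in> \<Omega>" "x \<in> cball x\<^sub>1 a - ball x\<^sub>1 a" "0 < Y x" "t \<in> {0..b}" for x t
    proof -
      have xc: "x \<in> closure \<Omega>" using that closure_subset by blast
      have "norm (x - x\<^sub>1) = a" using that(2) by (simp add: dist_norm norm_minus_commute)
      then have "(x - x\<^sub>1) \<bullet> (x - x\<^sub>1) = a\<^sup>2"
        by (simp add: power2_norm_eq_inner[symmetric] dist_norm norm_minus_commute)
      then have "E x t \<ge> M" using quad[OF xc sub] that a by (simp add: E_def)
      moreover have "D x t \<ge> - M" using w0[of x t] bdd[of x t] that sub[of x] xc by (simp add: D_def Y_def)
      ultimately show ?thesis by linarith
    qed
    show "\<exists>et p l. (E x has_real_derivative et) (at t) \<and> has_grad_lap (\<lambda>y. E y t) p l x \<and>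
         (\<forall>d\<ge>-M. d + E x t < 0 \<longrightarrow> 0 * (d + E x t) < K * min d 0 + et - l)"
      if "x \<in> \<Omega>" "x \<in> ball x\<^sub>1 a" "0 < Y x" "0 < t" "t \<le> b" for x t
    proof (intro exI conjI allI impI)
      show "(E x has_real_derivative 0) (at t)" unfolding E_def[abs_def] by simp
      show "has_grad_lap (\<lambda>y. E y t) ((M / a\<^sup>2) *\<^sub>R (2 *\<^sub>R (x - x\<^sub>1)) + P *\<^sub>R (2 *\<^sub>R (- e) - (Y x *\<^sub>R (- e) + Y x *\<^sub>R (- e))))
         (M / a\<^sup>2 * (2 * real DIM('a)) + P * (2 * 0 - (Y x * 0 + Y x * 0 + 2 * ((- e) \<bullet> (- e))))) x"
        unfolding E_def
        by (intro has_grad_lap_add has_grad_lap_cmult has_grad_lap_diff has_grad_lap_mult has_grad_lap_Y has_grad_lap_dist_square)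
      fix d assume d: "- M \<le> d"
      have "K * min d 0 \<ge> K * (- M)" using d M K by (intro mult_left_mono) auto
      then show "0 * (d + E x t) < K * min d 0 + 0 - (M / a\<^sup>2 * (2 * real DIM('a)) + P * (2 * 0 - (Y x * 0 + Y x * 0 + 2 * ((- e) \<bullet> (- e)))))"
        using P ee by (simp add: algebra_simps)
    qed
  qed (use a x1 x1c t b in auto)
  moreover have "E x\<^sub>1 t \<le> P * (2 * Y x\<^sub>1)" using P0 by (simp add: E_def)
  ultimately show ?thesis by linarith
qed

end

section \<open>The error of a localised reflection near the edge of a cap\<close>

lemma has_grad_lap_powr:
  assumes g: "has_grad_lap g p 0 x" and pos: "0 < g x"
  shows "has_grad_lap (\<lambda>x. g x powr r) ((r * g x powr (r - 1)) *\<^sub>R p) (r * ((r - 1) * g x powr (r - 2)) * (p \<bullet> p)) x"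
proof -
  have ev: "\<forall>\<^sub>F s in nhds (g x). 0 < s"
    using pos eventually_nhds_in_open[of "{0<..}" "g x"] by simp
  have "has_grad_lap (\<lambda>x. g x powr r) ((r * g x powr (r - 1)) *\<^sub>R p)
      (r * g x powr (r - 1) * 0 + (r * ((r - 1) * g x powr (r - 1 - 1))) * (p \<bullet> p)) x"
  proof (rule has_grad_lap_compose[OF g, where \<phi>' = "\<lambda>s. r * s powr (r - 1)"])
    show "\<forall>\<^sub>F s in nhds (g x). ((\<lambda>s. s powr r) has_real_derivative r * s powr (r - 1)) (at s)"
      using ev by eventually_elim (rule has_real_derivative_powr)
    show "((\<lambda>s. r * s powr (r - 1)) has_real_derivative r * ((r - 1) * g x powr (r - 1 - 1))) (at (g x))"
      using has_real_derivative_powr[OF pos] by (rule DERIV_cmult)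
  qed
  then show ?thesis by simp
qed

lemma has_grad_lap_cube:
  assumes g: "has_grad_lap g p 0 x"
  shows "has_grad_lap (\<lambda>x. g x ^ 3) ((3 * (g x)\<^sup>2) *\<^sub>R p) (6 * g x * (p \<bullet> p)) x"
proof -
  have "has_grad_lap (\<lambda>x. g x ^ 3) ((3 * (g x)\<^sup>2) *\<^sub>R p) (3 * (g x)\<^sup>2 * 0 + (6 * g x) * (p \<bullet> p)) x"
    by (rule has_grad_lap_compose[OF g, where \<phi>' = "\<lambda>s. 3 * s\<^sup>2"])
      (auto intro!: always_eventually derivative_eq_intros)
  then show ?thesis by simp
qed

context reflected_cap
begin

text \<open>
  Here \<open>\<l>\<close> will be an affine function with gradient orthogonal to \<open>e\<close> that dominates the depth; up to a
  shift, it vanishes on the edge of a wedge that is bounded by the hyperplane and contains the cap.  As the wedge has an acute angle, it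
  carries positive supersolutions that vanish at the edge to an order slightly larger than 2,
  and \<open>Y \<l>\<^bsup>1+\<epsilon>\<^esup>\<close> with a cubic correction is an explicit one.  The last term dominates \<open>- D\<close> on the lateral part.
\<close>

definition edge_err :: "real \<Rightarrow> real \<Rightarrow> real \<Rightarrow> ('a \<Rightarrow> real) \<Rightarrow> 'a \<Rightarrow> real" where
  "edge_err A B \<epsilon> \<l> x =
     B * (Y x * \<l> x powr (1 + \<epsilon>) - 1/2 * (Y x ^ 3 * \<l> x powr (\<epsilon> - 1))) + A * (Y x * ((x - xc) \<bullet> (x - xc)))"

lemma edge_err_bounds:
  assumes \<l>: "0 < \<l> x" "0 \<le> Y x" "Y x \<le> \<l> x" and A: "0 \<le> A" "0 \<le> B"
  shows "A * (Y x * ((x - xc) \<bullet> (x - xc))) \<le> edge_err A B \<epsilon> \<l> x"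
    and "edge_err A B \<epsilon> \<l> x \<le> B * (Y x * \<l> x powr (1 + \<epsilon>)) + A * (Y x * ((x - xc) \<bullet> (x - xc)))"
proof -
  have p: "\<l> x powr (1 + \<epsilon>) = \<l> x powr (\<epsilon> - 1) * (\<l> x)\<^sup>2"
    using \<l>(1) powr_add[of "\<l> x" "\<epsilon> - 1" 2] by (simp add: add.commute)
  have "Y x ^ 3 * \<l> x powr (\<epsilon> - 1) = Y x * \<l> x powr (\<epsilon> - 1) * (Y x)\<^sup>2"
    by (simp add: power2_eq_square power3_eq_cube)
  also have "\<dots> \<le> Y x * \<l> x powr (\<epsilon> - 1) * (\<l> x)\<^sup>2"
    using \<l> by (intro mult_left_mono power_mono mult_nonneg_nonneg) auto
  finally have le: "Y x ^ 3 * \<l> x powr (\<epsilon> - 1) \<le> Y x * \<l> x powr (1 + \<epsilon>)" by (simp add: p mult_ac)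
  have "0 \<le> Y x ^ 3 * \<l> x powr (\<epsilon> - 1)" "0 \<le> Y x * \<l> x powr (1 + \<epsilon>)" using \<l> by auto
  then have "0 \<le> Y x * \<l> x powr (1 + \<epsilon>) - 1/2 * (Y x ^ 3 * \<l> x powr (\<epsilon> - 1))" using le by linarith
  then have "0 \<le> B * (Y x * \<l> x powr (1 + \<epsilon>) - 1/2 * (Y x ^ 3 * \<l> x powr (\<epsilon> - 1)))" using A by simp
  then show "A * (Y x * ((x - xc) \<bullet> (x - xc))) \<le> edge_err A B \<epsilon> \<l> x" by (simp add: edge_err_def)
  have "B * (1/2 * (Y x ^ 3 * \<l> x powr (\<epsilon> - 1))) \<ge> 0"
    using A \<open>0 \<le> Y x ^ 3 * \<l> x powr (\<epsilon> - 1)\<close> by simp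
  then show "edge_err A B \<epsilon> \<l> x \<le> B * (Y x * \<l> x powr (1 + \<epsilon>)) + A * (Y x * ((x - xc) \<bullet> (x - xc)))"
    unfolding edge_err_def right_diff_distrib by linarith
qed

text \<open>
  The factor \<open>\<l>\<^bsup>1+\<epsilon>\<^esup>\<close> is convex and contributes a positive multiple of \<open>\<epsilon> \<bar>n\<bar>\<^sup>2\<close>; the cubic correction beats it with
  the constant 6 coming from the Laplacian of \<open>Y\<^sup>3\<close>, provided that \<open>\<epsilon>\<close> is small compared to the slope \<open>\<bar>n\<bar>\<close>.
\<close>

lemma edge_err_supersolution:
  fixes A B :: real
  assumes l_def: "\<And>x. \<l> x = n \<bullet> x + c" and n: "n \<bullet> e = 0"
    and \<epsilon>: "0 < \<epsilon>" "\<epsilon> \<le> 1/2" "2 * \<epsilon> * (n \<bullet> n) \<le> 3/2"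
    and \<l>: "0 < \<l> x" "0 \<le> Y x" "Y x \<le> \<l> x" "\<l> x \<le> 1" "K * (\<l> x)\<^sup>2 \<le> 1/2"
    and a: "(x - xc) \<bullet> (x - xc) \<le> a\<^sup>2" "K * a\<^sup>2 \<le> 1" "0 \<le> Y xc"
    and A: "0 \<le> A" "B = A * (2 * real DIM('a) + 5)"
  shows "\<exists>p l. has_grad_lap (edge_err A B \<epsilon> \<l>) p l x \<and> l \<le> - K * edge_err A B \<epsilon> \<l> x"
proof -
  have dl: "has_grad_lap \<l> n 0 x" using has_grad_lap_affine[of n c x] by (simp add: l_def[abs_def])
  define N where "N = n \<bullet> n"
  define P where "P = \<l> x powr (\<epsilon> - 1)"
  define Q where "Q = \<l> x powr (\<epsilon> - 3)"
  have ne: "e \<bullet> n = 0" using n by (simp add: inner_commute)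
  define l1 where "l1 = Y x * ((1 + \<epsilon>) * (\<epsilon> * P) * N)"
  define l2 where "l2 = Y x ^ 3 * ((\<epsilon> - 1) * ((\<epsilon> - 2) * Q) * N) + P * (6 * Y x)"
  define l3 where "l3 = Y x * (2 * real DIM('a)) + 4 * (Y x - Y xc)"
  have g1: "\<exists>p. has_grad_lap (\<lambda>x. Y x * \<l> x powr (1 + \<epsilon>)) p l1 x"
    by (rule exI, rule has_grad_lap_eq[OF has_grad_lap_mult[OF has_grad_lap_Y has_grad_lap_powr[OF dl \<l>(1)]] refl])
      (simp add: l1_def P_def N_def ne)
  have r: "\<epsilon> - 1 - 2 = \<epsilon> - 3" "\<epsilon> - 1 - 1 = \<epsilon> - 2" by auto
  have g2: "\<exists>p. has_grad_lap (\<lambda>x. Y x ^ 3 * \<l> x powr (\<epsilon> - 1)) p l2 x"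
    by (rule exI, rule has_grad_lap_eq[OF has_grad_lap_mult[OF has_grad_lap_cube[OF has_grad_lap_Y] has_grad_lap_powr[OF dl \<l>(1)]] refl])
      (simp add: l2_def P_def Q_def N_def ne ee r)
  have g3: "\<exists>p. has_grad_lap (\<lambda>x. Y x * ((x - xc) \<bullet> (x - xc))) p l3 x"
    by (rule exI, rule has_grad_lap_eq[OF has_grad_lap_mult[OF has_grad_lap_Y has_grad_lap_dist_square] refl])
      (simp add: l3_def Y_def inner_diff_right)
  obtain p1 p2 p3 where gs: "has_grad_lap (\<lambda>x. Y x * \<l> x powr (1 + \<epsilon>)) p1 l1 x"
    "has_grad_lap (\<lambda>x. Y x ^ 3 * \<l> x powr (\<epsilon> - 1)) p2 l2 x"
    "has_grad_lap (\<lambda>x. Y x * ((x - xc) \<bullet> (x - xc))) p3 l3 x"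
    using g1 g2 g3 by blast
  have g: "has_grad_lap (edge_err A B \<epsilon> \<l>) (B *\<^sub>R (p1 - (1/2) *\<^sub>R p2) + A *\<^sub>R p3) (B * (l1 - 1/2 * l2) + A * l3) x"
    unfolding edge_err_def[abs_def]
    by (intro has_grad_lap_add has_grad_lap_cmult has_grad_lap_diff gs)
  have P1: "1 \<le> P"
  proof -
    have "\<l> x powr 0 \<le> \<l> x powr (\<epsilon> - 1)" using \<l> \<epsilon> by (intro powr_mono') auto
    then show ?thesis using \<l>(1) by (simp add: P_def)
  qed
  have N0: "0 \<le> N" by (simp add: N_def)
  have B0: "0 \<le> B" using A by simp
  have YP: "0 \<le> Y x * P" using \<l> P1 by simp
  have l1: "l1 \<le> 3/2 * (Y x * P)"
  proof -
    have "(1 + \<epsilon>) * \<epsilon> * N \<le> 2 * \<epsilon> * N" using \<epsilon> N0 by (intro mult_right_mono) auto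
    then have "(1 + \<epsilon>) * \<epsilon> * N \<le> 3/2" using \<epsilon>(3) unfolding N_def by linarith
    then have "((1 + \<epsilon>) * \<epsilon> * N) * (Y x * P) \<le> 3/2 * (Y x * P)" using YP by (intro mult_right_mono)
    then show ?thesis by (simp add: l1_def mult_ac)
  qed
  have "0 \<le> (\<epsilon> - 1) * (\<epsilon> - 2)" using \<epsilon> by (intro mult_nonpos_nonpos) auto
  then have "0 \<le> Y x ^ 3 * (((\<epsilon> - 1) * (\<epsilon> - 2)) * (Q * N))"
    using \<l> N0 \<open>0 \<le> (\<epsilon> - 1) * (\<epsilon> - 2)\<close> by (intro mult_nonneg_nonneg[of "Y x ^ 3"] mult_nonneg_nonneg[of "(\<epsilon> - 1) * (\<epsilon> - 2)"]) (auto simp: Q_def)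
  then have l2: "l2 \<ge> 6 * (Y x * P)" by (simp add: l2_def mult_ac)
  have l12: "l1 - 1/2 * l2 \<le> - (3/2) * (Y x * P)" using l1 l2 by linarith
  have l3: "l3 \<le> (2 * real DIM('a) + 4) * Y x" using a(3) by (simp add: l3_def algebra_simps)
  have "B * (l1 - 1/2 * l2) \<le> B * (- (3/2) * (Y x * P))" using l12 B0 by (rule mult_left_mono)
  moreover have "A * l3 \<le> A * ((2 * real DIM('a) + 4) * Y x)" using l3 A(1) by (rule mult_left_mono)
  ultimately have L: "B * (l1 - 1/2 * l2) + A * l3 \<le> - (3/2) * (B * (Y x * P)) + (B - A) * Y x"
    using A(2) by (simp add: algebra_simps)
  have "B * Y x \<le> B * (Y x * P)" using P1 \<l> B0 by (intro mult_left_mono) (simp_all add: mult_le_cancel_left1)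
  then have L2: "B * (l1 - 1/2 * l2) + A * l3 \<le> - (1/2) * (B * (Y x * P)) - A * Y x"
    using L by (simp add: algebra_simps)
  have p: "\<l> x powr (1 + \<epsilon>) = P * (\<l> x)\<^sup>2"
    using \<l>(1) powr_add[of "\<l> x" "\<epsilon> - 1" 2] by (simp add: add.commute P_def)
  have "K * edge_err A B \<epsilon> \<l> x \<le> K * (B * (Y x * \<l> x powr (1 + \<epsilon>)) + A * (Y x * ((x - xc) \<bullet> (x - xc))))"
    using edge_err_bounds(2)[of \<l> x A B \<epsilon>] \<l> A B0 K by (intro mult_left_mono) auto
  also have "\<dots> = (K * (\<l> x)\<^sup>2) * (B * (Y x * P)) + (K * ((x - xc) \<bullet> (x - xc))) * (A * Y x)"
    unfolding p by (simp add: algebra_simps)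
  also have "\<dots> \<le> (1/2) * (B * (Y x * P)) + 1 * (A * Y x)"
  proof (intro add_mono mult_right_mono)
    have "K * ((x - xc) \<bullet> (x - xc)) \<le> K * a\<^sup>2" using a K by (intro mult_left_mono) auto
    then show "K * ((x - xc) \<bullet> (x - xc)) \<le> 1" using a by linarith
  qed (use \<l> B0 YP A in auto)
  finally have "K * edge_err A B \<epsilon> \<l> x \<le> (1/2) * (B * (Y x * P)) + A * Y x" by simp
  then show ?thesis using L2 g by (intro exI conjI) auto
qed

lemma continuous_on_edge_err:
  assumes l_def: "\<And>x. \<l> x = n \<bullet> x + c" and ne: "\<And>x. x \<in> S \<Longrightarrow> \<l> x \<noteq> 0"
  shows "continuous_on S (edge_err A B \<epsilon> \<l>)"
  using ne unfolding edge_err_def[abs_def] Y_def l_def by (intro continuous_intros) auto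

lemma w_mirror_nonneg:
  assumes "x \<in> closure \<Omega>" "dist xc x < r" "0 \<le> Y x" "t \<in> {0..b}"
  shows "0 \<le> w (mirror e \<mu> x) t"
  using w_nonneg[OF mirror_in_closure[OF assms(1-3)], of t] assms(4) b by auto

text \<open>
  The linear bound on the lateral part improves at the centre \<open>xc\<close>, where the last term of the barrier
  vanishes, to \<open>D \<ge> - B Y \<l>\<^bsup>1+\<epsilon>\<^esup>\<close>.  This is of higher order than \<open>Y \<l>\<close>, the order of the positive part.
\<close>

lemma reflection_edge_bound:
  fixes A B :: real
  assumes l_def: "\<And>x. \<l> x = n \<bullet> x + c" and n: "n \<bullet> e = 0"
    and \<epsilon>: "0 < \<epsilon>" "\<epsilon> \<le> 1/2" "2 * \<epsilon> * (n \<bullet> n) \<le> 3/2"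
    and a: "0 < a" "a < r" "K * a\<^sup>2 \<le> 1" and Yc: "0 \<le> Y xc"
    and \<l>: "\<And>x. x \<in> closure \<Omega> \<Longrightarrow> x \<in> cball xc a \<Longrightarrow> 0 \<le> Y x \<Longrightarrow> 0 < \<l> x \<and> \<l> x \<le> 1 \<and> K * (\<l> x)\<^sup>2 \<le> 1/2"
    and \<l>Y: "\<And>x. x \<in> closure \<Omega> \<Longrightarrow> x \<in> cball xc a \<Longrightarrow> Y x \<le> \<l> x"
    and lat: "\<And>x t. x \<in> \<Omega> \<Longrightarrow> x \<in> cball xc a \<Longrightarrow> 0 < Y x \<Longrightarrow> t \<in> {0..b} \<Longrightarrow> 0 \<le> D x t + A * a\<^sup>2 * Y x"
    and A: "0 \<le> A" "B = A * (2 * real DIM('a) + 5)"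
    and x: "x \<in> closure \<Omega>" "x \<in> cball xc a" "0 \<le> Y x" and t: "t \<in> {0..b}"
  shows "0 \<le> D x t + edge_err A B \<epsilon> \<l> x"
proof -
  have sub: "cball xc a \<subseteq> ball xc r" using a by auto
  have B0: "0 \<le> B" using A by simp
  have low: "A * (Y x * ((x - xc) \<bullet> (x - xc))) \<le> edge_err A B \<epsilon> \<l> x"
    if "x \<in> closure \<Omega>" "x \<in> cball xc a" "0 \<le> Y x" for x
    using edge_err_bounds(1)[of \<l> x A B \<epsilon>] \<l>[OF that] \<l>Y[OF that(1,2)] that A B0 by auto
  have E0: "0 \<le> edge_err A B \<epsilon> \<l> x" if "x \<in> closure \<Omega>" "x \<in> cball xc a" "0 \<le> Y x" for x
  proof -
    have "0 \<le> A * (Y x * ((x - xc) \<bullet> (x - xc)))" using A that by simp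
    then show ?thesis using low[OF that] by linarith
  qed
  have frc: "x \<in> frontier \<Omega> \<Longrightarrow> x \<in> closure \<Omega>" for x by (simp add: frontier_def)
  show ?thesis
  proof (rule reflection_comparison[where C="cball xc a" and V="ball xc a" and \<Lambda>="K + 1" and ta=0 and tb=b
        and E="\<lambda>x t. edge_err A B \<epsilon> \<l> x"])
    show "continuous_on ((closure \<Omega> \<inter> {x. 0 \<le> Y x} \<inter> cball xc a) \<times> {0..b}) (\<lambda>(x, t). edge_err A B \<epsilon> \<l> x)"
      unfolding case_prod_beta
    proof (rule continuous_on_compose2[OF continuous_on_edge_err[OF l_def]])
      show "\<l> x \<noteq> 0" if "x \<in> closure \<Omega> \<inter> {x. 0 \<le> Y x} \<inter> cball xc a" for x using \<l>[of x] that by force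
    qed (auto intro!: continuous_intros)
    show "0 \<le> w (mirror e \<mu> x) t + edge_err A B \<epsilon> \<l> x"
      if "x \<in> frontier \<Omega>" "x \<in> cball xc a" "0 \<le> Y x" "t \<in> {0..b}" for x t
      using E0[of x] w_mirror_nonneg[of x t] that sub frc[of x] by (auto simp: subset_iff)
    show "0 \<le> D x t + edge_err A B \<epsilon> \<l> x"
      if "x \<in> \<Omega>" "x \<in> cball xc a - ball xc a" "0 < Y x" "t \<in> {0..b}" for x t
    proof -
      have xc: "x \<in> closure \<Omega>" using that closure_subset by blast
      have "norm (x - xc) = a" using that(2) by (simp add: dist_norm norm_minus_commute)
      then have "(x - xc) \<bullet> (x - xc) = a\<^sup>2" by (simp add: power2_norm_eq_inner[symmetric])
      then show ?thesis using low[OF xc] lat[of x t] that by (simp add: mult_ac)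
    qed
    show "0 \<le> D x 0 + edge_err A B \<epsilon> \<l> x" if "x \<in> closure \<Omega>" "x \<in> cball xc a" "0 \<le> Y x" for x
      using E0[of x] that sub D_init[of x] by (auto simp: subset_iff)
    show "\<exists>et p l. ((\<lambda>t. edge_err A B \<epsilon> \<l> x) has_real_derivative et) (at t) \<and> has_grad_lap (\<lambda>y. edge_err A B \<epsilon> \<l> y) p l x \<and>
         (\<forall>d\<ge>-M. d + edge_err A B \<epsilon> \<l> x < 0 \<longrightarrow> (K + 1) * (d + edge_err A B \<epsilon> \<l> x) < K * min d 0 + et - l)"
      if "x \<in> \<Omega>" "x \<in> ball xc a" "0 < Y x" "0 < t" "t \<le> b" for x t
    proof -
      have xc: "x \<in> closure \<Omega>" "x \<in> cball xc a" "0 \<le> Y x" using that closure_subset by auto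
      have "norm (x - xc) \<le> a" using xc(2) by (simp add: dist_norm norm_minus_commute)
      then have sq: "(x - xc) \<bullet> (x - xc) \<le> a\<^sup>2" by (simp add: power2_norm_eq_inner[symmetric] power_mono)
      obtain p l where pl: "has_grad_lap (edge_err A B \<epsilon> \<l>) p l x" "l \<le> - K * edge_err A B \<epsilon> \<l> x"
        using edge_err_supersolution[OF l_def n \<epsilon>, of x a A B] \<l>[OF xc] \<l>Y[OF xc(1,2)] xc sq a Yc A by auto
      show ?thesis
      proof (intro exI conjI allI impI)
        show "((\<lambda>t. edge_err A B \<epsilon> \<l> x) has_real_derivative 0) (at t)" by simp
        show "has_grad_lap (\<lambda>y. edge_err A B \<epsilon> \<l> y) p l x" using pl by simp
        fix d assume d: "d + edge_err A B \<epsilon> \<l> x < 0"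
        have "d < 0" using d E0[OF xc] that by linarith
        then have "K * min d 0 + 0 - l \<ge> K * (d + edge_err A B \<epsilon> \<l> x)" using pl(2) by (simp add: algebra_simps)
        then show "(K + 1) * (d + edge_err A B \<epsilon> \<l> x) < K * min d 0 + 0 - l" using d by (simp add: algebra_simps)
      qed
    qed
  qed (use a b x t sub in \<open>auto simp: edge_err_def\<close>)
qed

end

section \<open>Propagation of positivity through a thin cylinder\<close>

lemma sinh_bounds:
  fixes s S :: real
  assumes "0 \<le> s" "s \<le> S" "0 < S"
  shows "s \<le> sinh s" "sinh s \<le> s / S * sinh S"
proof -
  have conv: "convex_on {0..} (sinh :: real \<Rightarrow> real)"
    by (rule f''_ge0_imp_convex[where f' = cosh and f'' = sinh]) (auto intro!: derivative_eq_intros)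
  have "sinh ((1 - s / S) * 0 + s / S * S) \<le> (1 - s / S) * sinh 0 + s / S * sinh S"
    using convex_onD[OF conv, of "s / S" 0 S] assms by simp
  then show "sinh s \<le> s / S * sinh S" using assms by simp
  have "sinh 0 - 0 \<le> sinh s - s"
    using assms(1)
    by (intro DERIV_nonneg_imp_nondecreasing[of 0 s "\<lambda>s. sinh s - s"])
      (auto intro!: exI derivative_eq_intros simp: cosh_real_ge_1)
  then show "s \<le> sinh s" by simp
qed

context reflected_cap
begin

text \<open>
  For \<open>z\<close> on the hyperplane this is \<open>R\<^sup>2 - \<bar>x'\<bar>\<^sup>2\<close>, where \<open>x'\<close> is the component of \<open>x - z\<close> orthogonal to \<open>e\<close>; its
  positivity set is a cylinder with axis direction \<open>e\<close>.
\<close>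

definition cyl :: "'a \<Rightarrow> real \<Rightarrow> 'a \<Rightarrow> real" where
  "cyl z R x = R\<^sup>2 - (x - z) \<bullet> (x - z) + Y x * Y x"

lemma e_diff: "Y z = 0 \<Longrightarrow> e \<bullet> (x - z) = - Y x"
  unfolding Y_def inner_diff_right by linarith

lemma cyl_le: assumes "Y z = 0" shows "cyl z R x \<le> R\<^sup>2"
proof -
  have "\<bar>e \<bullet> (x - z)\<bar> \<le> norm (x - z)" using Cauchy_Schwarz_ineq2[of e "x - z"] norm_e by simp
  then have "\<bar>Y x\<bar> \<le> norm (x - z)" using e_diff[OF assms] by simp
  then have "(Y x)\<^sup>2 \<le> (norm (x - z))\<^sup>2" by (metis abs_le_square_iff abs_norm_cancel)
  then show ?thesis unfolding cyl_def power2_norm_eq_inner power2_eq_square[of "Y x"] by linarith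
qed

lemma has_grad_lap_cyl: "has_grad_lap (cyl z R) ((2 * Y x) *\<^sub>R (- e) - 2 *\<^sub>R (x - z)) (2 - 2 * real DIM('a)) x"
proof -
  have "has_grad_lap (\<lambda>x. (0 \<bullet> x + R\<^sup>2) - (x - z) \<bullet> (x - z) + Y x * Y x)
    (0 - 2 *\<^sub>R (x - z) + (Y x *\<^sub>R (- e) + Y x *\<^sub>R (- e)))
    (0 - 2 * real DIM('a) + (Y x * 0 + Y x * 0 + 2 * ((- e) \<bullet> (- e)))) x"
    by (intro has_grad_lap_add has_grad_lap_diff has_grad_lap_mult has_grad_lap_Y has_grad_lap_dist_square has_grad_lap_affine)
  from has_grad_lap_eq[OF this, of "(2 * Y x) *\<^sub>R (- e) - 2 *\<^sub>R (x - z)" "2 - 2 * real DIM('a)"]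
  show ?thesis by (simp add: cyl_def[abs_def] ee algebra_simps flip: scaleR_left.add)
qed

text \<open>
  The square of \<open>R\<^sup>2 - \<bar>x'\<bar>\<^sup>2\<close> fails to be subharmonic only away from the lateral surface, and there the factor
  \<open>A\<^sup>2\<close> produced by \<open>sinh (A Y)\<close> compensates; \<open>A R = DIM + 1\<close> turns the sum into a sum of two squares.
\<close>

lemma cyl_subsolution:
  assumes z: "Y z = 0" and AR: "A * R = real DIM('a) + 1" and \<alpha>: "0 \<le> \<alpha>" "0 \<le> A" "0 \<le> Y x"
  shows "\<exists>p l. has_grad_lap (\<lambda>x. \<alpha> * (sinh (A * Y x) * (cyl z R x * cyl z R x))) p l x \<and> 0 \<le> l"
proof -
  define X where "X = cyl z R x"
  define G where "G = (2 * Y x) *\<^sub>R (- e) - 2 *\<^sub>R (x - z)"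
  have gX: "has_grad_lap (cyl z R) G (2 - 2 * real DIM('a)) x" unfolding G_def by (rule has_grad_lap_cyl)
  have gY: "has_grad_lap (\<lambda>x. sinh (A * Y x)) ((A * cosh (A * Y x)) *\<^sub>R (- e))
     (A * cosh (A * Y x) * 0 + (A * A * sinh (A * Y x)) * ((- e) \<bullet> (- e))) x"
    by (rule has_grad_lap_compose[OF has_grad_lap_Y, where \<phi>' = "\<lambda>s. A * cosh (A * s)"])
      (auto intro!: always_eventually derivative_eq_intros)
  have eG: "e \<bullet> G = 0" using e_diff[OF z] by (simp add: G_def inner_diff_right ee)
  have GG: "G \<bullet> G = 4 * (R\<^sup>2 - X)"
  proof -
    have "G \<bullet> G = 4 * (Y x * Y x) * (e \<bullet> e) + 8 * Y x * (e \<bullet> (x - z)) + 4 * ((x - z) \<bullet> (x - z))"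
      unfolding G_def by (simp add: inner_diff_left inner_diff_right inner_commute algebra_simps)
    then show ?thesis unfolding e_diff[OF z] ee X_def cyl_def by (simp add: algebra_simps)
  qed
  note g = has_grad_lap_cmult[OF has_grad_lap_mult[OF gY has_grad_lap_mult[OF gX gX]], of \<alpha>]
  have "0 \<le> \<alpha> * (sinh (A * Y x) * ((A * X - 2 * R)\<^sup>2 + 4 * R\<^sup>2))"
    using \<alpha> by (intro mult_nonneg_nonneg) auto
  also have "(A * X - 2 * R)\<^sup>2 + 4 * R\<^sup>2 = A * A * (X * X) - 4 * X * (A * R) + 8 * R\<^sup>2"
    by (simp add: power2_eq_square algebra_simps)
  also have "\<dots> = A * A * (X * X) + (2 * X * (2 - 2 * real DIM('a)) + 2 * (G \<bullet> G))"
    unfolding AR GG by (simp add: algebra_simps)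
  finally have *: "0 \<le> \<alpha> * (sinh (A * Y x) * (A * A * (X * X) + (2 * X * (2 - 2 * real DIM('a)) + 2 * (G \<bullet> G))))" .
  show ?thesis
    by (intro exI conjI, rule g) (use * in \<open>simp add: X_def[symmetric] ee eG algebra_simps\<close>)
qed

text \<open>
  Positive values of \<open>D\<close> at the bottom of a cylinder of height and radius comparable to \<open>h\<close> propagate to the
  hyperplane.  The barrier has three parts: the stationary subsolution of \<open>cyl_subsolution\<close>, which vanishes on the
  lateral surface; a transient that hides it at the initial time \<open>t2\<close> and decays at the rate \<open>1 / h\<^sup>2\<close> of a
  slab of width \<open>h\<close>; and the error \<open>Err\<close>, which is known to bound \<open>- D\<close> from above.
\<close>

lemma reflection_cylinder_bound:
  assumes Yc: "0 < Y xc" "Y xc \<le> h" and z: "z = xc + Y xc *\<^sub>R e" and xc: "xc \<in> \<Omega>"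
    and R: "0 < R" "R + 4 * h < a" "a \<le> r" and t2: "0 \<le> t2" "t2 \<le> b"
    and Err_cont: "continuous_on (closure \<Omega> \<inter> {x. 0 \<le> Y x} \<inter> cball xc a) Err"
    and Err0: "\<And>x. x \<in> closure \<Omega> \<Longrightarrow> x \<in> cball xc a \<Longrightarrow> 0 \<le> Y x \<Longrightarrow> 0 \<le> Err x"
    and DErr: "\<And>x t. x \<in> closure \<Omega> \<Longrightarrow> x \<in> cball xc a \<Longrightarrow> 0 \<le> Y x \<Longrightarrow> t \<in> {0..b} \<Longrightarrow> 0 \<le> D x t + Err x"
    and Err_super: "\<And>x. x \<in> \<Omega> \<Longrightarrow> x \<in> ball xc a \<Longrightarrow> 0 < Y x \<Longrightarrow> \<exists>p l. has_grad_lap Err p l x \<and> l \<le> - K * Err x"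
    and depth: "\<And>x. x \<in> closure \<Omega> \<Longrightarrow> 0 \<le> cyl z R x \<Longrightarrow> 0 \<le> Y x \<Longrightarrow> Y x \<le> 3 * h \<Longrightarrow> Y x \<le> 2 * h"
    and bottom: "\<And>x t. x \<in> frontier \<Omega> \<Longrightarrow> 0 \<le> cyl z R x \<Longrightarrow> 0 \<le> Y x \<Longrightarrow> Y x \<le> 2 * h \<Longrightarrow> t \<in> {t2..b} \<Longrightarrow>
       \<gamma> * h\<^sup>2 \<le> w (mirror e \<mu> x) t"
    and \<gamma>: "0 \<le> \<gamma>" and \<kappa>: "0 \<le> \<kappa> + K" "\<kappa> + K \<le> 3 / (8 * h\<^sup>2)"
    and A: "A = (real DIM('a) + 1) / R" and t: "t \<in> {t2..b}"
  shows "\<gamma> * h * Y xc * (A * h / sinh (2 * A * h) - exp (- \<kappa> * (t - t2))) - Err xc \<le> D xc t"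
proof -
  have h: "0 < h" using Yc by simp
  have A0: "0 < A" "A * R = real DIM('a) + 1" using A R by (simp_all add: add_pos_pos)
  have Yz: "Y z = 0" unfolding z Y_def by (simp add: inner_add_right ee)
  have sh: "0 < sinh (2 * A * h)" using A0 h by simp
  define \<alpha> where "\<alpha> = \<gamma> * h\<^sup>2 / (sinh (2 * A * h) * R^4)"
  have \<alpha>0: "0 \<le> \<alpha>" using \<gamma> sh by (simp add: \<alpha>_def)
  have \<alpha>': "\<alpha> * (sinh (2 * A * h) * R^4) = \<gamma> * h\<^sup>2" using sh R(1) unfolding \<alpha>_def by (subst nonzero_divide_eq_eq[symmetric]) auto
  define S where "S x = \<alpha> * (sinh (A * Y x) * (cyl z R x * cyl z R x))" for x
  define \<zeta> where "\<zeta> x = \<gamma> * h * (Y x - 1 / (16 * h\<^sup>2) * Y x ^ 3)" for x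
  define E where "E x t = Err x + exp (- \<kappa> * (t - t2)) * \<zeta> x - S x" for x t
  define C where "C = {x. 0 \<le> cyl z R x} \<inter> {x. \<bar>Y x\<bar> \<le> 3 * h}"
  define V where "V = {x. 0 < cyl z R x} \<inter> {x. \<bar>Y x\<bar> < 3 * h}"
  have cont_cyl: "continuous_on U (cyl z R)" for U
    unfolding cyl_def[abs_def] Y_def by (intro continuous_intros)
  have Ca: "x \<in> ball xc a" if "x \<in> C" for x
  proof -
    have "(x - z) \<bullet> (x - z) \<le> R\<^sup>2 + Y x * Y x" using that by (simp add: C_def cyl_def)
    moreover have "Y x * Y x \<le> (3 * h)\<^sup>2" using that power_mono[of "\<bar>Y x\<bar>" "3*h" 2] by (simp add: C_def power2_eq_square)
    moreover have "R\<^sup>2 + (3 * h)\<^sup>2 \<le> (R + 3 * h)\<^sup>2" using R h by (simp add: power2_sum)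
    ultimately have "(norm (x - z))\<^sup>2 \<le> (R + 3 * h)\<^sup>2" by (simp add: power2_norm_eq_inner)
    then have "norm (x - z) \<le> R + 3 * h" using R h by (meson abs_le_square_iff power2_le_imp_le add_nonneg_nonneg less_imp_le mult_nonneg_nonneg zero_le_numeral)
    moreover have "norm (z - xc) \<le> h" using Yc norm_e by (simp add: z)
    ultimately have "norm (x - xc) < a" using R norm_triangle_ineq[of "x - z" "z - xc"] by simp
    then show ?thesis by (simp add: dist_norm norm_minus_commute)
  qed
  have Cc: "x \<in> C \<Longrightarrow> x \<in> cball xc a" for x using Ca[of x] by simp
  have clC: "closed C"
    unfolding C_def by (intro closed_Int closed_Collect_le continuous_intros cont_cyl continuous_Y)
  have "bounded C" using Ca bounded_subset[OF bounded_ball, of C xc a] by blast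
  then have cC: "compact C" using clC by (simp add: compact_eq_bounded_closed)
  have oV: "open V"
    unfolding V_def by (intro open_Int open_Collect_less continuous_intros cont_cyl continuous_Y)
  have \<zeta>bd: "3/4 * (\<gamma> * h * Y x) \<le> \<zeta> x" "0 \<le> \<zeta> x" "\<zeta> x \<le> \<gamma> * h * Y x" if "0 \<le> Y x" "Y x \<le> 2 * h" for x
  proof -
    have "Y x ^ 3 = Y x * (Y x)\<^sup>2" by (simp add: power2_eq_square power3_eq_cube)
    also have "\<dots> \<le> Y x * (2 * h)\<^sup>2" using that by (intro mult_left_mono power_mono) auto
    finally have "1 / (16 * h\<^sup>2) * Y x ^ 3 \<le> 1 / 4 * Y x" using h by (simp add: field_simps power2_eq_square)
    then have "3/4 * Y x \<le> Y x - 1 / (16 * h\<^sup>2) * Y x ^ 3" by linarith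
    from mult_left_mono[OF this, of "\<gamma> * h"] show 1: "3/4 * (\<gamma> * h * Y x) \<le> \<zeta> x" using \<gamma> h by (simp add: \<zeta>_def)
    have "0 \<le> \<gamma> * h * Y x" using \<gamma> h that by simp
    then show "0 \<le> \<zeta> x" using 1 by linarith
    have "Y x - 1 / (16 * h\<^sup>2) * Y x ^ 3 \<le> Y x" using that by simp
    from mult_left_mono[OF this, of "\<gamma> * h"] show "\<zeta> x \<le> \<gamma> * h * Y x" using \<gamma> h by (simp add: \<zeta>_def)
  qed
  have S_le: "S x \<le> \<gamma> * h / 2 * Y x" if "0 \<le> cyl z R x" "0 \<le> Y x" "Y x \<le> 2 * h" for x
  proof -
    have "cyl z R x * cyl z R x \<le> R\<^sup>2 * R\<^sup>2" using cyl_le[OF Yz] that by (intro mult_mono) auto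
    then have c: "cyl z R x * cyl z R x \<le> R^4" by (simp add: power2_eq_square power4_eq_xxxx)
    have "sinh (A * Y x) \<le> (A * Y x) / (2 * A * h) * sinh (2 * A * h)"
      using that A0 h by (intro sinh_bounds) auto
    then have s: "sinh (A * Y x) \<le> Y x / (2 * h) * sinh (2 * A * h)" using A0 h by simp
    have "S x \<le> \<alpha> * ((Y x / (2 * h) * sinh (2 * A * h)) * R^4)"
      unfolding S_def using c s \<alpha>0 that h sh by (intro mult_left_mono mult_mono) auto
    also have "\<dots> = Y x / (2 * h) * (\<alpha> * (sinh (2 * A * h) * R^4))" by simp
    also have "\<dots> = \<gamma> * h / 2 * Y x" unfolding \<alpha>' using h by (simp add: power2_eq_square)
    finally show ?thesis .
  qed
  have frc: "x \<in> frontier \<Omega> \<Longrightarrow> x \<in> closure \<Omega>" for x by (simp add: frontier_def)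
  have Y2: "Y x \<le> 2 * h" if "x \<in> closure \<Omega>" "x \<in> C" "0 \<le> Y x" for x using depth[of x] that by (auto simp: C_def)
  have X0: "x \<in> C \<Longrightarrow> 0 \<le> cyl z R x" for x by (simp add: C_def)
  have "0 \<le> D xc t + E xc t"
  proof (rule reflection_comparison[where C=C and V=V and ta=t2 and tb=b and \<Lambda>="K + 1"])
    show "C \<subseteq> ball xc r" using Ca R by fastforce
    show "V \<subseteq> C" by (auto simp: V_def C_def)
    have "continuous_on ((closure \<Omega> \<inter> {x. 0 \<le> Y x} \<inter> C) \<times> {t2..b}) (\<lambda>z. Err (fst z))"
      by (rule continuous_on_compose2[OF Err_cont]) (use Cc in \<open>auto intro!: continuous_intros\<close>)
    then show "continuous_on ((closure \<Omega> \<inter> {x. 0 \<le> Y x} \<inter> C) \<times> {t2..b}) (\<lambda>(x, t). E x t)"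
      unfolding E_def \<zeta>_def S_def case_prod_beta Y_def cyl_def by (intro continuous_intros)
    show "0 \<le> w (mirror e \<mu> x) t + E x t" if "x \<in> frontier \<Omega>" "x \<in> C" "0 \<le> Y x" "t \<in> {t2..b}" for x t
    proof -
      note c = frc[OF that(1)]
      note y2 = Y2[OF c that(2,3)]
      have "S x \<le> \<gamma> * h / 2 * Y x" using S_le[OF X0[OF that(2)] that(3) y2] .
      also have "\<dots> \<le> \<gamma> * h / 2 * (2 * h)" using y2 \<gamma> h by (intro mult_left_mono) auto
      also have "\<dots> = \<gamma> * h\<^sup>2" by (simp add: power2_eq_square)
      also have "\<dots> \<le> w (mirror e \<mu> x) t" using bottom[OF that(1) X0[OF that(2)] that(3) y2 that(4)] .
      finally have "S x \<le> w (mirror e \<mu> x) t" .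
      moreover have "0 \<le> exp (- \<kappa> * (t - t2)) * \<zeta> x" using \<zeta>bd(2)[OF that(3) y2] by simp
      ultimately show ?thesis using Err0[OF c Cc[OF that(2)] that(3)] unfolding E_def by linarith
    qed
    show "0 \<le> E x t" if "x \<in> closure \<Omega>" "x \<in> C" "Y x = 0" for x t
      using Err0[of x] that Cc[of x] by (simp add: E_def S_def \<zeta>_def)
    show "0 \<le> D x t + E x t" if "x \<in> \<Omega>" "x \<in> C - V" "0 < Y x" "t \<in> {t2..b}" for x t
    proof -
      have c: "x \<in> closure \<Omega>" using that closure_subset by blast
      note y2 = Y2[OF c _ less_imp_le[OF that(3)]]
      have "cyl z R x = 0" using that y2 h by (auto simp: C_def V_def)
      then have "S x = 0" by (simp add: S_def)
      moreover have "0 \<le> exp (- \<kappa> * (t - t2)) * \<zeta> x" using \<zeta>bd(2)[of x] y2 that by simp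
      moreover have "0 \<le> D x t + Err x" using that DErr[OF c Cc, of t] t2 by simp
      ultimately show ?thesis unfolding E_def by linarith
    qed
    show "0 \<le> D x t2 + E x t2" if "x \<in> closure \<Omega>" "x \<in> C" "0 \<le> Y x" for x
    proof -
      have "S x \<le> \<zeta> x"
      proof -
        have "S x \<le> \<gamma> * h / 2 * Y x" using S_le[of x] X0 Y2 that by auto
        also have "\<dots> \<le> 3/4 * (\<gamma> * h * Y x)" using \<gamma> h that by simp
        also have "\<dots> \<le> \<zeta> x" using \<zeta>bd(1)[of x] Y2 that by auto
        finally show ?thesis .
      qed
      then show ?thesis using DErr[OF that(1) Cc[OF that(2)] that(3), of t2] t2 by (simp add: E_def)
    qed
    show "\<exists>et p l. (E x has_real_derivative et) (at t) \<and> has_grad_lap (\<lambda>y. E y t) p l x \<and>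
         (\<forall>d\<ge>-M. d + E x t < 0 \<longrightarrow> (K + 1) * (d + E x t) < K * min d 0 + et - l)"
      if "x \<in> \<Omega>" "x \<in> V" "0 < Y x" "t2 < t" "t \<le> b" for x t
    proof -
      have c: "x \<in> closure \<Omega>" "x \<in> C" "0 \<le> Y x" using that closure_subset by (auto simp: V_def C_def)
      have xO: "x \<in> \<Omega>" "0 < Y x" using that by auto
      note y2 = Y2[OF c]
      obtain p1 l1 where 1: "has_grad_lap Err p1 l1 x" "l1 \<le> - K * Err x"
        using Err_super[OF xO(1) Ca[OF c(2)] xO(2)] by blast
      have 2: "has_grad_lap \<zeta> ((\<gamma> * h) *\<^sub>R (- e - (1 / (16 * h\<^sup>2)) *\<^sub>R ((3 * (Y x)\<^sup>2) *\<^sub>R (- e))))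
          (\<gamma> * h * (0 - 1 / (16 * h\<^sup>2) * (6 * Y x * ((- e) \<bullet> (- e))))) x"
        unfolding \<zeta>_def[abs_def]
        by (intro has_grad_lap_cmult has_grad_lap_diff has_grad_lap_Y has_grad_lap_cube)
      define l2 where "l2 = \<gamma> * h * (0 - 1 / (16 * h\<^sup>2) * (6 * Y x * ((- e) \<bullet> (- e))))"
      have l2: "l2 \<le> - (\<kappa> + K) * \<zeta> x"
      proof -
        have "(\<kappa> + K) * \<zeta> x \<le> 3 / (8 * h\<^sup>2) * (\<gamma> * h * Y x)"
          using \<kappa> \<zeta>bd[OF c(3) y2] by (intro mult_mono) auto
        also have "\<dots> = - l2" using h by (simp add: l2_def ee field_simps)
        finally show ?thesis by (simp add: algebra_simps)
      qed
      obtain p3 l3 where 3: "has_grad_lap S p3 l3 x" "0 \<le> l3"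
        using cyl_subsolution[OF Yz A0(2) \<alpha>0 less_imp_le[OF A0(1)] c(3)] unfolding S_def[abs_def] by blast
      define g where "g = exp (- \<kappa> * (t - t2))"
      have g: "g > 0" by (simp add: g_def)
      note 4 = has_grad_lap_diff[OF has_grad_lap_add[OF 1(1) has_grad_lap_cmult[OF 2, of "exp (- \<kappa> * (t - t2))"]] 3(1)]
      have 5: "(E x has_real_derivative (- \<kappa> * g * \<zeta> x)) (at t)"
        unfolding E_def[abs_def] g_def by (auto intro!: derivative_eq_intros)
      have S0: "0 \<le> S x" unfolding S_def using \<alpha>0 A0 c X0[OF c(2)] by (intro mult_nonneg_nonneg) auto
      have et: "K * (Err x + g * \<zeta> x) \<le> - \<kappa> * g * \<zeta> x - (l1 + g * l2 - l3)"
        using 1(2) 3(2) mult_left_mono[OF l2, of g] g by (simp add: algebra_simps)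
      show ?thesis
      proof (intro exI conjI allI impI)
        show "(E x has_real_derivative (- \<kappa> * g * \<zeta> x)) (at t)" by (rule 5)
        show "has_grad_lap (\<lambda>y. E y t) (p1 + exp (- \<kappa> * (t - t2)) *\<^sub>R ((\<gamma> * h) *\<^sub>R (- e - (1 / (16 * h\<^sup>2)) *\<^sub>R ((3 * (Y x)\<^sup>2) *\<^sub>R (- e)))) - p3)
           (l1 + exp (- \<kappa> * (t - t2)) * l2 - l3) x"
          using 4 by (simp add: E_def l2_def)
        fix d assume d: "d + E x t < 0"
        have Ee: "E x t = Err x + g * \<zeta> x - S x" by (simp add: E_def g_def)
        have "K * (d + E x t) \<le> K * min d 0 + K * (Err x + g * \<zeta> x)"
        proof (cases "d < 0")
          case True
          have "K * (d + E x t) \<le> K * (d + (Err x + g * \<zeta> x))" using S0 K Ee by (intro mult_left_mono) auto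
          then show ?thesis using True by (simp add: algebra_simps)
        next
          case False
          have "K * (d + E x t) \<le> 0" using d K by (simp add: mult_nonneg_nonpos)
          moreover have "0 \<le> K * (Err x + g * \<zeta> x)"
            using K g \<zeta>bd(2)[OF c(3) y2] Err0[OF c(1) Cc[OF c(2)] c(3)] by simp
          ultimately show ?thesis using False by simp
        qed
        then show "(K + 1) * (d + E x t) < K * min d 0 + - \<kappa> * g * \<zeta> x - (l1 + exp (- \<kappa> * (t - t2)) * l2 - l3)"
          using et d unfolding g_def[symmetric] by (simp add: algebra_simps)
      qed
    qed
    have "(xc - z) \<bullet> (xc - z) = Y xc * Y xc" by (simp add: z ee)
    then show "xc \<in> C" using Yc by (simp add: C_def cyl_def)
  qed (use cC oV t2 t xc closure_subset Yc in auto)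
  moreover have "\<gamma> * h * Y xc * (A * h / sinh (2 * A * h)) \<le> S xc"
  proof -
    have c: "cyl z R xc = R\<^sup>2" by (simp add: z cyl_def ee)
    have "\<gamma> * h * Y xc * (A * h / sinh (2 * A * h)) = (\<alpha> * R^4) * (A * Y xc)"
      unfolding \<alpha>_def using R(1) sh by (simp add: power2_eq_square)
    also have "\<dots> \<le> (\<alpha> * R^4) * sinh (A * Y xc)"
      using sinh_bounds(1)[of "A * Y xc" "A * Y xc"] A0 Yc \<alpha>0 R(1) by (intro mult_left_mono) auto
    also have "\<dots> = S xc" unfolding S_def c by (simp add: power2_eq_square power4_eq_xxxx)
    finally show ?thesis .
  qed
  moreover have "exp (- \<kappa> * (t - t2)) * \<zeta> xc \<le> exp (- \<kappa> * (t - t2)) * (\<gamma> * h * Y xc)"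
    using \<zeta>bd(3)[of xc] Yc h by (intro mult_left_mono) auto
  ultimately have "\<gamma> * h * Y xc * (A * h / sinh (2 * A * h)) - exp (- \<kappa> * (t - t2)) * (\<gamma> * h * Y xc) - Err xc \<le> D xc t"
    unfolding E_def by linarith
  then show ?thesis by (simp only: right_diff_distrib mult.commute[of "exp _"])
qed

end

section \<open>Strict reflection inequality in thin caps\<close>

context reaction_heat
begin

text \<open>
  The lower bound from the bottom is of order \<open>h Y\<close>, where \<open>h\<close> is the height of the cap over the boundary point
  below \<open>xc\<close>; the error from far away is of order \<open>h\<^bsup>1+\<epsilon>\<^esup> Y\<close> and the transient is exponentially small
  in \<open>1 / h\<^sup>2\<close>.  So the sign is decided as soon as the cap is thin enough.  The wedge for the error estimate is spanned by the
  hyperplane and a supporting hyperplane of \<open>\<Omega>\<close> at the boundary point below \<open>xc\<close>; the cone condition bounds its slope.  The constants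
  \<open>\<theta>\<close> and \<open>c\<close> depend on neither the hyperplane nor the final time \<open>b\<close>.
\<close>

lemma thin_cap_reflection:
  assumes \<sigma>: "0 < \<sigma>" "\<sigma> \<le> 1" and s0: "0 < s\<^sub>0" and r: "0 < r" and t1: "0 < t\<^sub>1"
  shows "\<exists>\<theta>>0. \<exists>c>0. \<forall>e \<mu> xc b t d.
     norm e = 1 \<longrightarrow>
     (\<forall>x \<in> closure \<Omega>. \<forall>s \<omega>. dist xc x < r \<longrightarrow> 0 < s \<longrightarrow> s \<le> s\<^sub>0 \<longrightarrow> norm \<omega> \<le> \<sigma> \<longrightarrow> x + s *\<^sub>R (e + \<omega>) \<in> \<Omega>) \<longrightarrow>
     (\<forall>x \<in> \<Omega>. \<forall>t \<in> {0..b}. dist xc x < r \<longrightarrow> 0 < \<mu> - e \<bullet> x \<longrightarrow> w x t \<le> M) \<longrightarrow>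
     (\<forall>x \<in> closure \<Omega>. dist xc x < r \<longrightarrow> \<mu> - e \<bullet> x \<le> \<theta>) \<longrightarrow>
     b < T \<longrightarrow> t \<in> {t\<^sub>1..b} \<longrightarrow> xc \<in> \<Omega> \<longrightarrow> 0 < \<mu> - e \<bullet> xc \<longrightarrow>
     0 < d \<longrightarrow> ball (xc + (\<mu> - e \<bullet> xc) *\<^sub>R e) d \<subseteq> \<Omega> \<longrightarrow>
     c * d * (\<mu> - e \<bullet> xc) \<le> w (mirror e \<mu> xc) t - w xc t"
proof -
  obtain K where K: "0 \<le> K" "\<And>t x y. t \<in> {0<..<T} \<Longrightarrow> x \<in> \<Omega> \<Longrightarrow> y \<in> \<Omega> \<Longrightarrow> w y t \<le> w x t \<Longrightarrow> w x t \<le> M \<Longrightarrow>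
      q x t - q y t \<le> K * (w x t - w y t)"
    using q_lipschitz[of M] by blast
  obtain \<eta> where \<eta>: "0 < \<eta>" "\<And>x d t. 0 < d \<Longrightarrow> ball x d \<subseteq> \<Omega> \<Longrightarrow> t \<in> {0..<T} \<Longrightarrow> \<eta> * t * d\<^sup>2 \<le> w x t"
    using interior_lower_bound by blast
  define n where "n = real DIM('a)"
  define L where "L = 1 / \<sigma> + 1"
  have L: "1 \<le> L" using \<sigma> by (simp add: L_def)
  define \<epsilon> where "\<epsilon> = min (1/2) (3 / (4 * L\<^sup>2))"
  have \<epsilon>: "0 < \<epsilon>" "\<epsilon> \<le> 1/2" using L by (auto simp: \<epsilon>_def)
  have \<epsilon>L: "2 * \<epsilon> * L\<^sup>2 \<le> 3/2"
  proof -
    have "\<epsilon> \<le> 3 / (4 * L\<^sup>2)" by (simp add: \<epsilon>_def)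
    then have "\<epsilon> * (4 * L\<^sup>2) \<le> 3" using L by (simp add: pos_le_divide_eq)
    then show ?thesis by simp
  qed
  \<comment> \<open>On the ball of radius \<open>a\<close> the affine function \<open>\<l>\<close> below is at most \<open>(2 + L) a\<close>; this has to be small compared to \<open>1 / K\<close>.\<close>
  define a where "a = min (r / 3) (1 / ((2 + L) * (2 * K + 2)))"
  have a: "0 < a" "2 * a < r" using r L K(1) by (auto simp: a_def min_def)
  have aL: "(2 + L) * a \<le> 1 / (2 * K + 2)"
  proof -
    have "a \<le> 1 / ((2 + L) * (2 * K + 2))" by (simp add: a_def)
    then have "a * ((2 + L) * (2 * K + 2)) \<le> 1" using L K(1) by (simp add: pos_le_divide_eq)
    then have "((2 + L) * a) * (2 * K + 2) \<le> 1" by (simp only: mult_ac)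
    then show ?thesis using K(1) by (simp add: pos_le_divide_eq)
  qed
  have small: "x \<le> 1 \<and> K * x\<^sup>2 \<le> 1/2" if "0 \<le> x" "x \<le> (2 + L) * a" for x
  proof -
    have x1: "x \<le> 1 / (2 * K + 2)" using that aL by linarith
    have "1 / (2 * K + 2) \<le> 1" using K(1) by simp
    then have x: "x \<le> 1" using x1 by linarith
    have "K * x\<^sup>2 \<le> K * (1 / (2 * K + 2) * 1)"
      unfolding power2_eq_square using x1 x that K(1) by (intro mult_left_mono mult_mono) auto
    also have "\<dots> \<le> 1/2" using K(1) by (simp add: field_simps)
    finally show ?thesis using x by simp
  qed
  have "a \<le> (2 + L) * a" using a L by (simp add: mult_le_cancel_right1)
  then have Ka: "K * a\<^sup>2 \<le> 1" using small[of a] a by simp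
  define P where "P = (\<bar>K * M + 2 * n * M / a\<^sup>2\<bar> + 2) / 2"
  have P: "K * M + 2 * n * M / a\<^sup>2 < 2 * P" "0 < P"
  proof -
    have "2 * P = \<bar>K * M + 2 * n * M / a\<^sup>2\<bar> + 2" by (simp add: P_def)
    then show "K * M + 2 * n * M / a\<^sup>2 < 2 * P" "0 < P" by linarith+
  qed
  define A where "A = 2 * P / a\<^sup>2"
  have A: "0 < A" "A * a\<^sup>2 = 2 * P" using P a by (auto simp: A_def)
  define B where "B = A * (2 * n + 5)"
  have B: "0 < B" using A by (simp add: B_def n_def add_nonneg_pos)
  define t2 where "t2 = t\<^sub>1 / 2"
  have t2: "0 < t2" "t2 < t\<^sub>1" "t\<^sub>1 - t2 = t2" using t1 by (auto simp: t2_def)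
  define \<gamma> where "\<gamma> = \<eta> * t2 * \<sigma>\<^sup>2"
  have \<gamma>: "0 < \<gamma>" using \<eta> t2 \<sigma> by (simp add: \<gamma>_def)
  define \<rho> where "\<rho> = min (1 / L) (\<sigma> / 2)"
  have \<rho>: "0 < \<rho>" "\<rho> * L \<le> 1" "\<rho> \<le> \<sigma> / 2" "\<rho> \<le> 1" using \<sigma> L by (auto simp: \<rho>_def min_def field_simps)
  define N where "N = (n + 1) / \<rho>"
  have N: "0 < N" using \<rho> by (simp add: N_def n_def add_nonneg_pos)
  define c1 where "c1 = N / sinh (2 * N)"
  have c1: "0 < c1" using N by (simp add: c1_def)
  \<comment> \<open>The positive part contributes \<open>c1\<close> below; transient and error may use up a quarter of it each.\<close>
  define \<kappa>0 where "\<kappa>0 = max 0 (- ln (c1 / 4) / t2)"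
  have \<kappa>0: "0 \<le> \<kappa>0" "exp (- \<kappa>0 * t2) \<le> c1 / 4"
  proof -
    have "- ln (c1/4) / t2 \<le> \<kappa>0" by (simp add: \<kappa>0_def)
    then have "- \<kappa>0 * t2 \<le> ln (c1 / 4)" using t2 by (simp add: field_simps)
    then have "exp (- \<kappa>0 * t2) \<le> exp (ln (c1 / 4))" by simp
    then show "exp (- \<kappa>0 * t2) \<le> c1 / 4" using c1 by simp
  qed (simp add: \<kappa>0_def)
  define \<theta> where "\<theta> = Min {1, a / 7, s\<^sub>0 / 2, 3 / (8 * (\<kappa>0 + K + 1)), (\<gamma> * c1 / (8 * B)) powr (1 / \<epsilon>) / 2}"
  have \<theta>: "0 < \<theta>" "\<theta> \<le> 1" "\<theta> \<le> a / 7" "\<theta> \<le> s\<^sub>0 / 2" "\<theta> \<le> 3 / (8 * (\<kappa>0 + K + 1))"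
      "2 * \<theta> \<le> (\<gamma> * c1 / (8 * B)) powr (1 / \<epsilon>)"
    using a s0 \<kappa>0(1) K(1) \<gamma> c1 B by (auto simp: \<theta>_def)
  have main: "\<gamma> * c1 / 2 * d * (\<mu> - e \<bullet> xc) \<le> w (mirror e \<mu> xc) t - w xc t"
    if e: "norm e = 1"
      and cone: "\<And>x s \<omega>. x \<in> closure \<Omega> \<Longrightarrow> dist xc x < r \<Longrightarrow> 0 < s \<Longrightarrow> s \<le> s\<^sub>0 \<Longrightarrow> norm \<omega> \<le> \<sigma> \<Longrightarrow> x + s *\<^sub>R (e + \<omega>) \<in> \<Omega>"
      and bdd: "\<And>x t. x \<in> \<Omega> \<Longrightarrow> t \<in> {0..b} \<Longrightarrow> dist xc x < r \<Longrightarrow> 0 < \<mu> - e \<bullet> x \<Longrightarrow> w x t \<le> M"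
      and thin_cap: "\<And>x. x \<in> closure \<Omega> \<Longrightarrow> dist xc x < r \<Longrightarrow> \<mu> - e \<bullet> x \<le> \<theta>"
      and bT: "b < T" and t: "t \<in> {t\<^sub>1..b}" and xc: "xc \<in> \<Omega>" and Yc: "0 < \<mu> - e \<bullet> xc"
      and d: "0 < d" "ball (xc + (\<mu> - e \<bullet> xc) *\<^sub>R e) d \<subseteq> \<Omega>"
    for e \<mu> xc b t d
  proof -
    have b0: "0 \<le> b" using t t1 by auto
    interpret reflected_cap \<Omega> T m w q e \<mu> xc r b M K \<sigma> s\<^sub>0
    proof unfold_locales
      show "2 * (\<mu> - e \<bullet> x) \<le> s\<^sub>0" if "x \<in> closure \<Omega>" "dist xc x < r" for x
        using thin_cap[OF that] \<theta>(4) by simp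
      show "q x t - q y t \<le> K * (w x t - w y t)"
        if "t \<in> {0<..b}" "x \<in> \<Omega>" "y \<in> \<Omega>" "w y t \<le> w x t" "w x t \<le> M" for t x y
        using K(2)[of t x y] that bT by auto
    qed (use e cone bdd bT b0 \<sigma>(1) s0 K(1) in auto)
    have Yc': "0 < Y xc" using Yc by (simp add: Y_def)
    have xcc: "xc \<in> closure \<Omega>" using xc closure_subset by blast
    have thinY: "Y x \<le> \<theta>" if "x \<in> closure \<Omega>" "dist xc x < r" for x using thin_cap[OF that] by (simp add: Y_def)
    \<comment> \<open>The depth grows at unit speed along the ray in direction \<open>- e\<close>, so in a thin cap this ray soon leaves \<open>\<Omega>\<close>.\<close>
    have "e \<noteq> 0" using e by auto
    obtain d0 where d0: "0 < d0" "xc + d0 *\<^sub>R (- e) \<in> frontier \<Omega>"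
      "\<And>s. 0 \<le> s \<Longrightarrow> s < d0 \<Longrightarrow> xc + s *\<^sub>R (- e) \<in> interior \<Omega>"
      using ray_to_frontier[of \<Omega> xc "- e"] bounded_dom xc open_dom \<open>e \<noteq> 0\<close> by (auto simp: interior_open)
    have Yray: "Y (xc + s *\<^sub>R (- e)) = Y xc + s" for s by (simp add: Y_def inner_diff_right ee)
    have distray: "dist xc (xc + s *\<^sub>R (- e)) = \<bar>s\<bar>" for s using e by (simp add: dist_norm)
    have d0\<theta>: "d0 \<le> \<theta>"
    proof (rule ccontr)
      assume "\<not> d0 \<le> \<theta>"
      then have "xc + \<theta> *\<^sub>R (- e) \<in> interior \<Omega>" using d0(3)[of \<theta>] \<theta>(1) by linarith
      then have "xc + \<theta> *\<^sub>R (- e) \<in> closure \<Omega>" using interior_subset closure_subset by blast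
      from thinY[OF this] show False using distray[of \<theta>] Yray[of \<theta>] \<theta>(1-4) a Yc' by auto
    qed
    define b1 where "b1 = xc + d0 *\<^sub>R (- e)"
    have b1f: "b1 \<in> frontier \<Omega>" using d0 by (simp add: b1_def)
    have b1c: "b1 \<in> closure \<Omega>" "b1 \<notin> \<Omega>" using b1f open_dom by (auto simp: frontier_def interior_open)
    have b1d: "dist xc b1 = d0" "dist xc b1 < r" using distray[of d0] d0 d0\<theta> \<theta>(1-4) a by (auto simp: b1_def)
    define h where "h = Y b1"
    have h: "h = Y xc + d0" "0 < h" "Y xc \<le> h" using Yray[of d0] Yc' d0 by (auto simp: h_def b1_def)
    have h\<theta>: "h \<le> \<theta>" using thinY[OF b1c(1) b1d(2)] by (simp add: h_def)
    define z where "z = xc + Y xc *\<^sub>R e"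
    have Yz: "Y z = 0" by (simp add: z_def Y_def inner_add_right ee)
    have zb1: "b1 = z - h *\<^sub>R e" unfolding b1_def z_def h(1) by (simp add: algebra_simps)
    have dh: "d \<le> h"
    proof (rule ccontr)
      assume "\<not> d \<le> h"
      then have "b1 \<in> ball z d" using h e by (simp add: zb1 dist_norm)
      then show False using d b1c by (auto simp: z_def Y_def)
    qed
    \<comment> \<open>The cone condition at \<open>b1\<close> forces a supporting normal there to have a definite component along \<open>e\<close>.\<close>
    obtain v where v: "v \<noteq> 0" "\<And>y. y \<in> closure \<Omega> \<Longrightarrow> v \<bullet> b1 \<le> v \<bullet> y"
      using supporting_hyperplane_relative_frontier[OF convex_dom b1c(1)] b1c(2) rel_interior_open[OF open_dom] by metis
    have ve: "\<sigma> * norm v \<le> v \<bullet> e"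
    proof -
      define \<omega> where "\<omega> = - (\<sigma> / norm v) *\<^sub>R v"
      have "norm \<omega> \<le> \<sigma>" using v \<sigma> by (simp add: \<omega>_def)
      then have "b1 + s\<^sub>0 *\<^sub>R (e + \<omega>) \<in> closure \<Omega>" using cone[OF b1c(1) b1d(2) s0] closure_subset by blast
      from v(2)[OF this] have "0 \<le> v \<bullet> (e + \<omega>)" using s0 by (simp add: inner_add_right zero_le_mult_iff)
      moreover have "v \<bullet> \<omega> = - \<sigma> * norm v"
        using v(1) by (simp add: \<omega>_def power2_norm_eq_inner[symmetric] power2_eq_square)
      ultimately show ?thesis by (simp add: inner_add_right)
    qed
    then have ve0: "0 < v \<bullet> e" using \<sigma> v(1) by (meson less_le_trans mult_pos_pos zero_less_norm_iff)
    define nb where "nb = (1 / (v \<bullet> e)) *\<^sub>R v"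
    have nb: "nb \<bullet> e = 1" "norm nb \<le> 1 / \<sigma>" "\<And>y. y \<in> closure \<Omega> \<Longrightarrow> 0 \<le> nb \<bullet> (y - b1)"
    proof -
      show "nb \<bullet> e = 1" using ve0 by (simp add: nb_def)
      show "norm nb \<le> 1 / \<sigma>" using ve ve0 \<sigma> by (simp add: nb_def field_simps)
      show "0 \<le> nb \<bullet> (y - b1)" if "y \<in> closure \<Omega>" for y
        using v(2)[OF that] ve0 by (simp add: nb_def inner_diff_right divide_right_mono)
    qed
    define nn where "nn = nb - e"
    have nn: "nn \<bullet> e = 0" "norm nn \<le> L"
      using nb ee e norm_triangle_ineq4[of nb e] by (auto simp: nn_def L_def inner_diff_left)
    \<comment> \<open>The distance, measured along \<open>e\<close>, from the hyperplane to the supporting one, shifted by \<open>h\<close> to keep it positive on \<open>closure \<Omega>\<close>.\<close>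
    define c where "c = \<mu> - nb \<bullet> b1 + h"
    define \<l> where "\<l> x = nn \<bullet> x + c" for x
    have \<l>Y: "\<l> x = Y x + nb \<bullet> (x - b1) + h" for x
      by (simp add: \<l>_def nn_def c_def Y_def inner_diff_left inner_diff_right)
    have \<l>ge: "Y x + h \<le> \<l> x" if "x \<in> closure \<Omega>" for x using nb(3)[OF that] by (simp add: \<l>Y)
    have \<l>xc: "\<l> xc = 2 * h"
      unfolding \<l>Y b1_def using h nb(1) by simp
    have \<l>diff: "\<l> x = 2 * h + nn \<bullet> (x - xc)" for x using \<l>xc by (simp add: \<l>_def inner_diff_right)
    have \<l>small: "0 < \<l> x \<and> \<l> x \<le> 1 \<and> K * (\<l> x)\<^sup>2 \<le> 1/2"
      if "x \<in> closure \<Omega>" "x \<in> cball xc a" "0 \<le> Y x" for x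
    proof -
      have 1: "0 < \<l> x" using \<l>ge[OF that(1)] that h by linarith
      have "nn \<bullet> (x - xc) \<le> norm nn * norm (x - xc)" by (rule norm_cauchy_schwarz)
      also have "\<dots> \<le> L * a" using nn that L by (intro mult_mono) (auto simp: dist_norm norm_minus_commute)
      finally have "\<l> x \<le> (2 + L) * a" using \<l>diff[of x] h\<theta> \<theta>(1-4) a by (simp add: distrib_right)
      then show ?thesis using small[of "\<l> x"] 1 by simp
    qed
    have nnL: "2 * \<epsilon> * (nn \<bullet> nn) \<le> 3/2"
    proof -
      have "nn \<bullet> nn \<le> L\<^sup>2" using nn(2) by (simp add: power2_norm_eq_inner[symmetric] power_mono)
      then have "2 * \<epsilon> * (nn \<bullet> nn) \<le> 2 * \<epsilon> * L\<^sup>2" using \<epsilon> by (intro mult_left_mono) auto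
      then show ?thesis using \<epsilon>L by linarith
    qed
    have lat: "0 \<le> D x t + A * a\<^sup>2 * Y x" if "x \<in> \<Omega>" "x \<in> cball xc a" "0 < Y x" "t \<in> {0..b}" for x t
    proof -
      have "cball x a \<subseteq> ball xc r"
      proof
        fix y assume "y \<in> cball x a"
        then show "y \<in> ball xc r" using that(2) a dist_triangle[of xc y x] by simp
      qed
      moreover have "\<And>x. x \<in> closure \<Omega> \<Longrightarrow> dist xc x < r \<Longrightarrow> Y x \<le> 2" using thinY \<theta>(1-4) by fastforce
      ultimately have "0 \<le> D x t + P * (2 * Y x)"
        using reflection_lipschitz[of a x P t] a that P by (simp add: n_def)
      then show ?thesis unfolding A by (simp add: mult_ac)
    qed
    define Err where "Err = edge_err A B \<epsilon> \<l>"
    have DErr: "0 \<le> D x t + Err x" if "x \<in> closure \<Omega>" "x \<in> cball xc a" "0 \<le> Y x" "t \<in> {0..b}" for x t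
      unfolding Err_def
    proof (rule reflection_edge_bound[OF \<l>_def nn(1) \<epsilon> nnL a(1) _ Ka _ \<l>small _ lat])
      show "Y x \<le> \<l> x" if "x \<in> closure \<Omega>" for x using \<l>ge[OF that] h by linarith
    qed (use that a A Yc' B_def n_def in auto)
    have Err0: "0 \<le> Err x" if "x \<in> closure \<Omega>" "x \<in> cball xc a" "0 \<le> Y x" for x
    proof -
      have "0 \<le> A * (Y x * ((x - xc) \<bullet> (x - xc)))" using A that by simp
      also have "\<dots> \<le> Err x"
        unfolding Err_def using \<l>small[OF that] \<l>ge[OF that(1)] that A B h by (intro edge_err_bounds(1)) auto
      finally show ?thesis .
    qed
    have Err_xc: "Err xc \<le> \<gamma> * h * Y xc * (c1 / 4)"
    proof -
      have "Err xc \<le> B * (Y xc * \<l> xc powr (1 + \<epsilon>))"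
        unfolding Err_def using edge_err_bounds(2)[of \<l> xc A B \<epsilon>] \<l>xc Yc' h A B by simp
      also have "\<l> xc powr (1 + \<epsilon>) = 2 * h * (2 * h) powr \<epsilon>" unfolding \<l>xc using h by (simp add: powr_add)
      also have "B * (Y xc * (2 * h * (2 * h) powr \<epsilon>)) \<le> B * (Y xc * (2 * h * (\<gamma> * c1 / (8 * B))))"
      proof (intro mult_left_mono)
        have "(2 * h) powr \<epsilon> \<le> ((\<gamma> * c1 / (8 * B)) powr (1 / \<epsilon>)) powr \<epsilon>"
          using h h\<theta> \<theta>(6) \<epsilon> by (intro powr_mono2) auto
        also have "\<dots> = \<gamma> * c1 / (8 * B)" using \<epsilon> \<gamma> c1 B by (simp add: powr_powr)
        finally show "(2 * h) powr \<epsilon> \<le> \<gamma> * c1 / (8 * B)" .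
      qed (use h Yc' B in auto)
      also have "\<dots> = \<gamma> * h * Y xc * (c1 / 4)" using B by simp
      finally show ?thesis .
    qed
    define R where "R = \<rho> * h"
    have R: "0 < R" "R \<le> h" "L * R \<le> h"
    proof -
      show "0 < R" using \<rho> h by (simp add: R_def)
      have "\<rho> * h \<le> 1 * h" using \<rho>(4) h by (intro mult_right_mono) auto
      then show "R \<le> h" by (simp add: R_def)
      have "(\<rho> * L) * h \<le> 1 * h" using \<rho>(2) h by (intro mult_right_mono) auto
      then show "L * R \<le> h" by (simp add: R_def mult_ac)
    qed
    define \<kappa> where "\<kappa> = 3 / (8 * h\<^sup>2) - K"
    have cylv: "norm ((x - z) + Y x *\<^sub>R e) \<le> R" if "0 \<le> cyl z R x" for x
    proof -
      have "((x - z) + Y x *\<^sub>R e) \<bullet> ((x - z) + Y x *\<^sub>R e) = (x - z) \<bullet> (x - z) + 2 * Y x * (e \<bullet> (x - z)) + Y x * Y x"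
        by (simp add: inner_add_left inner_add_right inner_commute ee)
      also have "\<dots> = R\<^sup>2 - cyl z R x" unfolding e_diff[OF Yz] cyl_def by simp
      finally have "(norm ((x - z) + Y x *\<^sub>R e))\<^sup>2 \<le> R\<^sup>2" using that by (simp add: power2_norm_eq_inner)
      then show ?thesis using R power2_le_imp_le by fastforce
    qed
    have bound: "\<gamma> * h * Y xc * ((n + 1) / R * h / sinh (2 * ((n + 1) / R) * h) - exp (- \<kappa> * (t - t2))) - Err xc \<le> D xc t"
    proof (rule reflection_cylinder_bound[where a=a, OF Yc' h(3) z_def xc])
      show "R + 4 * h < a" using R h\<theta> \<theta>(1-4) h by linarith
      show "continuous_on (closure \<Omega> \<inter> {x. 0 \<le> Y x} \<inter> cball xc a) Err"
        unfolding Err_def by (rule continuous_on_edge_err[OF \<l>_def]) (use \<l>small in fastforce)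
      show "\<exists>p l. has_grad_lap Err p l x \<and> l \<le> - K * Err x" if x: "x \<in> \<Omega>" "x \<in> ball xc a" "0 < Y x" for x
      proof -
        have xx: "x \<in> closure \<Omega>" "x \<in> cball xc a" "0 \<le> Y x" using x closure_subset by auto
        have "norm (x - xc) \<le> a" using xx(2) by (simp add: dist_norm norm_minus_commute)
        then have sq: "(x - xc) \<bullet> (x - xc) \<le> a\<^sup>2" by (simp add: power2_norm_eq_inner[symmetric] power_mono)
        show ?thesis unfolding Err_def
          by (rule edge_err_supersolution[OF \<l>_def nn(1) \<epsilon> nnL])
            (use \<l>small[OF xx] \<l>ge[OF xx(1)] h xx sq Ka Yc' A in \<open>auto simp: B_def n_def\<close>)
      qed
      show "Y x \<le> 2 * h" if "x \<in> closure \<Omega>" "0 \<le> cyl z R x" "0 \<le> Y x" "Y x \<le> 3 * h" for x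
      proof -
        have "nn \<bullet> (x - xc) = nn \<bullet> ((x - z) + Y x *\<^sub>R e)"
          by (simp add: z_def inner_add_right inner_diff_right nn)
        also have "\<dots> \<le> norm nn * norm ((x - z) + Y x *\<^sub>R e)" by (rule norm_cauchy_schwarz)
        also have "\<dots> \<le> L * R" using nn cylv[OF that(2)] L by (intro mult_mono) auto
        finally have "\<l> x \<le> 3 * h" using \<l>diff[of x] R by simp
        then show ?thesis using \<l>ge[OF that(1)] by simp
      qed
      show "\<gamma> * h\<^sup>2 \<le> w (mirror e \<mu> x) t"
        if x: "x \<in> frontier \<Omega>" "0 \<le> cyl z R x" "0 \<le> Y x" "Y x \<le> 2 * h" and t: "t \<in> {t2..b}" for x t
      proof -
        have xcl: "x \<in> closure \<Omega>" "x \<notin> \<Omega>" using x open_dom by (auto simp: frontier_def interior_open)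
        note cv = cylv[OF x(2)]
        have "((x - z) + Y x *\<^sub>R e) + (Y xc - Y x) *\<^sub>R e = x - xc" by (simp add: z_def algebra_simps)
        then have "norm (x - xc) \<le> norm ((x - z) + Y x *\<^sub>R e) + norm ((Y xc - Y x) *\<^sub>R e)"
          by (metis norm_triangle_ineq)
        then have "norm (x - xc) \<le> R + \<bar>Y xc - Y x\<bar>" using cv e by simp
        also have "\<dots> < r" using R x h h\<theta> \<theta>(1-4) a Yc' by linarith
        finally have xr: "dist xc x < r" by (simp add: dist_norm norm_minus_commute)
        \<comment> \<open>A bottom point of smaller depth would lie in the open cone that starts at \<open>b1\<close>, hence in \<open>\<Omega>\<close>.\<close>
        have Yh: "h / 2 \<le> Y x"
        proof (rule ccontr)
          assume "\<not> h / 2 \<le> Y x"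
          define s where "s = h - Y x"
          have s: "h / 2 < s" "0 < s" "s \<le> s\<^sub>0" using \<open>\<not> h / 2 \<le> Y x\<close> h h\<theta> \<theta>(1-4) x by (auto simp: s_def)
          define \<omega> where "\<omega> = (1 / s) *\<^sub>R ((x - z) + Y x *\<^sub>R e)"
          have "R \<le> \<sigma> * s"
          proof -
            have "R \<le> \<sigma> / 2 * h" using \<rho> h by (simp add: R_def)
            also have "\<dots> = \<sigma> * (h / 2)" by simp
            also have "\<dots> \<le> \<sigma> * s" using s \<sigma> by (intro mult_left_mono) auto
            finally show ?thesis .
          qed
          moreover have "norm \<omega> = norm ((x - z) + Y x *\<^sub>R e) / s" unfolding \<omega>_def norm_scaleR using s by simp
          ultimately have "norm \<omega> \<le> \<sigma>" using cv s by (simp add: pos_divide_le_eq)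
          then have "b1 + s *\<^sub>R (e + \<omega>) \<in> \<Omega>" using cone[OF b1c(1) b1d(2) s(2,3)] by blast
          moreover have "b1 + s *\<^sub>R (e + \<omega>) = x"
          proof -
            have "s *\<^sub>R \<omega> = (x - z) + Y x *\<^sub>R e" unfolding \<omega>_def using s by simp
            then have "b1 + s *\<^sub>R (e + \<omega>) = b1 + s *\<^sub>R e + ((x - z) + Y x *\<^sub>R e)" by (simp add: scaleR_add_right)
            then show ?thesis by (simp add: zb1 s_def algebra_simps)
          qed
          ultimately show False using xcl by simp
        qed
        define Yx where "Yx = Y x"
        have Yx: "0 < Yx" "2 * Yx \<le> s\<^sub>0" "h \<le> 2 * Yx" using Yh h x h\<theta> \<theta>(4) thinY[OF xcl(1) xr] by (auto simp: Yx_def)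
        have "ball (mirror e \<mu> x) (2 * Yx * \<sigma>) \<subseteq> \<Omega>"
        proof
          fix p assume p: "p \<in> ball (mirror e \<mu> x) (2 * Yx * \<sigma>)"
          define \<omega> where "\<omega> = (1 / (2 * Yx)) *\<^sub>R (p - mirror e \<mu> x)"
          have "norm \<omega> = norm (p - mirror e \<mu> x) / (2 * Yx)" unfolding \<omega>_def norm_scaleR using Yx by simp
          moreover have "norm (p - mirror e \<mu> x) \<le> \<sigma> * (2 * Yx)"
            using p by (simp add: dist_norm norm_minus_commute mult_ac)
          ultimately have "norm \<omega> \<le> \<sigma>" using Yx by (simp add: pos_divide_le_eq)
          then have "x + (2 * Yx) *\<^sub>R (e + \<omega>) \<in> \<Omega>" using cone[OF xcl(1) xr, of "2 * Yx" \<omega>] Yx by auto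
          moreover have "x + (2 * Yx) *\<^sub>R (e + \<omega>) = p"
            using Yx by (simp add: \<omega>_def mirror_Y Yx_def[symmetric] scaleR_add_right)
          ultimately show "p \<in> \<Omega>" by simp
        qed
        then have "\<eta> * t * (2 * Yx * \<sigma>)\<^sup>2 \<le> w (mirror e \<mu> x) t"
          using \<eta>(2)[of "2 * Yx * \<sigma>" "mirror e \<mu> x" t] Yx \<sigma> t t2 bT by auto
        moreover have "\<gamma> * h\<^sup>2 \<le> \<eta> * t * (2 * Yx * \<sigma>)\<^sup>2"
        proof -
          have "\<gamma> * h\<^sup>2 = \<eta> * t2 * (h * \<sigma>)\<^sup>2" by (simp add: \<gamma>_def power_mult_distrib)
          also have "\<dots> \<le> \<eta> * t * (2 * Yx * \<sigma>)\<^sup>2"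
            using \<eta> t t2 Yx h \<sigma> by (intro mult_mono power_mono) auto
          finally show ?thesis .
        qed
        ultimately show ?thesis by linarith
      qed
      show "0 \<le> \<kappa> + K" "\<kappa> + K \<le> 3 / (8 * h\<^sup>2)" by (auto simp: \<kappa>_def)
    qed (use R a t t1 t2 DErr Err0 \<gamma> in \<open>auto simp: n_def\<close>)
    have "(n + 1) / R * h = N" using h by (simp add: N_def R_def)
    then have Nh: "(n + 1) / R * h / sinh (2 * ((n + 1) / R) * h) = c1"
      unfolding c1_def mult.assoc[of 2] by (simp only:)
    have "exp (- \<kappa> * (t - t2)) \<le> c1 / 4"
    proof -
      have "h\<^sup>2 \<le> h" using h h\<theta> \<theta>(1-4) by (simp add: power2_eq_square mult_le_cancel_left1)
      also have "h \<le> 3 / (8 * (\<kappa>0 + K + 1))" using h\<theta> \<theta>(5) by linarith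
      finally have "h\<^sup>2 * (8 * (\<kappa>0 + K + 1)) \<le> 3" using \<kappa>0 K by (simp add: pos_le_divide_eq)
      moreover have "0 < 8 * h\<^sup>2" using h(2) by simp
      ultimately have "\<kappa>0 + K + 1 \<le> 3 / (8 * h\<^sup>2)" by (simp add: pos_le_divide_eq algebra_simps)
      then have "\<kappa>0 \<le> \<kappa>" by (simp add: \<kappa>_def)
      then have "\<kappa>0 * t2 \<le> \<kappa> * (t - t2)" using t t2 \<kappa>0 by (intro mult_mono) auto
      then have "exp (- \<kappa> * (t - t2)) \<le> exp (- \<kappa>0 * t2)" by simp
      then show ?thesis using \<kappa>0 by linarith
    qed
    then have "\<gamma> * h * Y xc * (3/4 * c1) \<le> \<gamma> * h * Y xc * (c1 - exp (- \<kappa> * (t - t2)))"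
      using \<gamma> h Yc' by (intro mult_left_mono) auto
    then have "\<gamma> * h * Y xc * (3/4 * c1) - \<gamma> * h * Y xc * (c1 / 4) \<le> D xc t"
      using bound Err_xc unfolding Nh by linarith
    then have "\<gamma> * c1 / 2 * h * Y xc \<le> D xc t" by (simp add: algebra_simps)
    moreover have "\<gamma> * c1 / 2 * d * Y xc \<le> \<gamma> * c1 / 2 * h * Y xc"
      using dh \<gamma> c1 Yc' by (intro mult_right_mono mult_left_mono) auto
    ultimately have "\<gamma> * c1 / 2 * d * Y xc \<le> D xc t" by linarith
    then show ?thesis by (simp add: D_def Y_def)
  qed
  have "0 < \<gamma> * c1 / 2" using \<gamma> c1 by simp
  with \<theta>(1) main show ?thesis by (intro exI conjI allI impI) blast+
qed

end

section \<open>Reflections at an extreme singular boundary point\<close>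

lemma mirror_midpoint:
  assumes "v \<noteq> 0"
  shows "mirror (sgn v) ((v \<bullet> x) / norm v) (x - \<tau> *\<^sub>R v) = x + \<tau> *\<^sub>R v"
proof -
  have nv: "0 < norm v" using assms by simp
  have Y: "(v \<bullet> x) / norm v - sgn v \<bullet> (x - \<tau> *\<^sub>R v) = \<tau> * norm v"
    using nv by (simp add: sgn_div_norm inner_diff_right power2_norm_eq_inner[symmetric] field_simps power2_eq_square)
  have Yv: "(\<tau> * norm v) *\<^sub>R sgn v = \<tau> *\<^sub>R v" using nv by (simp add: sgn_div_norm)
  have "(2 * (\<tau> * norm v)) *\<^sub>R sgn v = \<tau> *\<^sub>R v + \<tau> *\<^sub>R v" by (metis Yv mult_2 scaleR_left.add)
  then show ?thesis unfolding mirror_def Y by simp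
qed

text \<open>
  If no point of the translate \<open>\<Omega> - x\<^sub>0\<close> lay in its dual cone, a hyperplane would separate the two; its normal
  vector would, up to sign, belong to the dual cone and be nonpositive against itself.
\<close>

lemma inward_normal_exists:
  fixes \<Omega> :: "'a::euclidean_space set"
  assumes "convex \<Omega>" "\<Omega> \<noteq> {}"
  shows "\<exists>\<nu>. x0 + \<nu> \<in> \<Omega> \<and> (\<forall>y\<in>closure \<Omega>. 0 \<le> \<nu> \<bullet> (y - x0)) \<or> x0 \<in> \<Omega>"
proof (rule ccontr)
  assume neg: "\<not> ?thesis"
  define S where "S = (\<lambda>x. x - x0) ` \<Omega>"
  define C where "C = {\<nu>. \<forall>y\<in>S. 0 \<le> \<nu> \<bullet> y}"
  have cl: "0 \<le> \<nu> \<bullet> (y - x0)" if "\<nu> \<in> C" "y \<in> closure \<Omega>" for \<nu> y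
  proof -
    have "closed {y. 0 \<le> \<nu> \<bullet> (y - x0)}" by (intro closed_Collect_le continuous_intros)
    moreover have "\<Omega> \<subseteq> {y. 0 \<le> \<nu> \<bullet> (y - x0)}" using that(1) by (auto simp: C_def S_def)
    ultimately show ?thesis using closure_minimal that(2) by blast
  qed
  have disj: "S \<inter> C = {}"
  proof (rule ccontr)
    assume "S \<inter> C \<noteq> {}"
    then obtain \<nu> where "\<nu> \<in> S" "\<nu> \<in> C" by blast
    then have "x0 + \<nu> \<in> \<Omega>" "\<forall>y\<in>closure \<Omega>. 0 \<le> \<nu> \<bullet> (y - x0)" using cl by (auto simp: S_def)
    then show False using neg by blast
  qed
  have "convex S" unfolding S_def using assms(1) by (rule convex_translation_subtract)
  moreover have "convex C"
    unfolding C_def convex_def by (auto simp: inner_add_left intro!: add_nonneg_nonneg)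
  moreover have "S \<noteq> {}" "0 \<in> C" using assms(2) by (auto simp: S_def C_def)
  ultimately obtain a b where ab: "a \<noteq> 0" "\<forall>x\<in>S. a \<bullet> x \<le> b" "\<forall>x\<in>C. b \<le> a \<bullet> x"
    using separating_hyperplane_sets[of S C] disj by blast
  have b0: "b \<le> 0" using ab(3) \<open>0 \<in> C\<close> by force
  then have "a \<bullet> y \<le> 0" if "y \<in> S" for y using ab(2) that by fastforce
  then have sC: "s *\<^sub>R (- a) \<in> C" if "0 \<le> s" for s using that by (simp add: C_def mult_nonneg_nonpos)
  have aa: "0 < a \<bullet> a" using ab(1) by simp
  have "((1 - b) / (a \<bullet> a)) *\<^sub>R (- a) \<in> C" using sC[of "(1 - b) / (a \<bullet> a)"] b0 aa by simp
  then have "b \<le> a \<bullet> (((1 - b) / (a \<bullet> a)) *\<^sub>R (- a))" using ab(3) by blast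
  then show False using aa by simp
qed

context reaction_heat
begin

definition bounded_near :: "'a \<Rightarrow> bool" where
  "bounded_near x \<longleftrightarrow> (\<exists>d>0. \<exists>M. \<forall>y\<in>\<Omega>. \<forall>t\<in>{0..<T}. dist x y < d \<longrightarrow> w y t \<le> M)"

definition singular_bdry :: "'a set" where
  "singular_bdry = {x \<in> frontier \<Omega>. \<not> bounded_near x}"

lemma open_bounded_near: "open {x. bounded_near x}"
  unfolding open_dist
proof (intro ballI)
  fix x assume "x \<in> {x. bounded_near x}"
  then have "bounded_near x" by simp
  then obtain d M where d: "0 < d" "\<And>y t. y \<in> \<Omega> \<Longrightarrow> t \<in> {0..<T} \<Longrightarrow> dist x y < d \<Longrightarrow> w y t \<le> M"
    unfolding bounded_near_def by blast
  have "bounded_near z" if "dist z x < d / 2" for z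
  proof -
    have "w y t \<le> M" if y: "y \<in> \<Omega>" "t \<in> {0..<T}" "dist z y < d / 2" for y t
    proof -
      have "dist x y < d" using y(3) \<open>dist z x < d / 2\<close> dist_triangle[of x y z] by (simp add: dist_commute)
      then show ?thesis using d(2) y by blast
    qed
    then show ?thesis unfolding bounded_near_def using half_gt_zero[OF d(1)] by blast
  qed
  then show "\<exists>e>0. \<forall>y. dist y x < e \<longrightarrow> y \<in> {x. bounded_near x}" using d(1) by (intro exI[of _ "d/2"]) auto
qed

lemma compact_singular_bdry: "compact singular_bdry"
proof -
  have "singular_bdry = frontier \<Omega> \<inter> - {x. bounded_near x}" by (auto simp: singular_bdry_def)
  moreover have "compact (frontier \<Omega>)" using bounded_dom by (rule compact_frontier_bounded)
  ultimately show ?thesis using open_bounded_near by (simp add: compact_Int_closed closed_Compl)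
qed

lemma uniformly_bounded_near_compact:
  assumes "compact S" "\<And>x. x \<in> S \<Longrightarrow> bounded_near x"
  shows "\<exists>d>0. \<exists>M. \<forall>x\<in>S. \<forall>y\<in>\<Omega>. \<forall>t\<in>{0..<T}. dist x y < d \<longrightarrow> w y t \<le> M"
proof (cases "S = {}")
  case True then show ?thesis by (intro exI[of _ 1]) auto
next
  case False
  obtain d M where dM: "\<And>x. x \<in> S \<Longrightarrow> 0 < d x" "\<And>x y t. x \<in> S \<Longrightarrow> y \<in> \<Omega> \<Longrightarrow> t \<in> {0..<T} \<Longrightarrow> dist x y < d x \<Longrightarrow> w y t \<le> M x"
    using assms(2) unfolding bounded_near_def by metis
  obtain F where F: "finite F" "F \<subseteq> S" "S \<subseteq> (\<Union>x\<in>F. ball x (d x / 2))"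
  proof (rule compactE_image[OF assms(1), of S "\<lambda>x. ball x (d x / 2)"])
    show "S \<subseteq> (\<Union>x\<in>S. ball x (d x / 2))" using dM(1) by fastforce
  qed auto
  have "F \<noteq> {}" using F(3) False by auto
  define d0 where "d0 = Min ((\<lambda>x. d x / 2) ` F)"
  define M0 where "M0 = Max (M ` F)"
  have "0 < d0" using F \<open>F \<noteq> {}\<close> dM(1) by (auto simp: d0_def)
  moreover have "w y t \<le> M0" if "x \<in> S" "y \<in> \<Omega>" "t \<in> {0..<T}" "dist x y < d0" for x y t
  proof -
    obtain p where p: "p \<in> F" "dist p x < d p / 2" using F(3) \<open>x \<in> S\<close> by auto
    have "d0 \<le> d p / 2" unfolding d0_def using F(1) p(1) by (intro Min_le) auto
    then have "dist p y < d p" using that(4) p(2) dist_triangle[of p y x] by simp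
    then have "w y t \<le> M p" using dM(2)[of p y t] p F(2) that by blast
    also have "M p \<le> M0" unfolding M0_def using F(1) p(1) by (intro Max_ge) auto
    finally show ?thesis .
  qed
  ultimately show ?thesis by blast
qed

lemma bounded_before:
  assumes "b < T"
  shows "\<exists>M. \<forall>x\<in>closure \<Omega>. \<forall>t\<in>{0..b}. w x t \<le> M"
proof -
  have "continuous_on (closure \<Omega> \<times> {0..b}) (\<lambda>(x, t). w x t)"
    by (rule continuous_on_subset[OF w_cont]) (use assms in auto)
  moreover have "compact (closure \<Omega> \<times> {0..b})" by (intro compact_Times compact_closure_dom) auto
  ultimately have "bounded ((\<lambda>(x, t). w x t) ` (closure \<Omega> \<times> {0..b}))"
    using compact_continuous_image compact_imp_bounded by blast
  then obtain M where "\<forall>z\<in>(\<lambda>(x, t). w x t) ` (closure \<Omega> \<times> {0..b}). norm z \<le> M" unfolding bounded_iff by blast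
  then show ?thesis by (intro exI[of _ M]) force
qed

text \<open>
  The directions \<open>v'\<close> range over a ball around \<open>v = \<nu> - \<beta> x\<^sub>0\<close>.  Because \<open>x\<^sub>0\<close> has the largest norm among the singular
  boundary points, every such point \<open>x\<close> satisfies \<open>- x\<^sub>0 \<bullet> (x - x\<^sub>0) \<ge> \<bar>x - x\<^sub>0\<bar>\<^sup>2 / 2\<close>, so the tilt by \<open>\<beta>\<close> removes from the cap those at
  a fixed distance from \<open>x\<^sub>0\<close>.  The ball radius \<open>r\<close>, the regular part \<open>S\<close> of the boundary and the
  constants of \<open>thin_cap_reflection\<close> are fixed before \<open>\<beta>\<close>, which is finally chosen to make the cap thin.  On the spherical side of
  the cap that lemma applies up to any time before \<open>T\<close>; at time \<open>t\<^sub>1\<close> it applies everywhere, as \<open>w\<close> is bounded until then.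
  The last statement records the strict inequality at \<open>t\<^sub>1\<close>.
\<close>

theorem reflections_at_singular_bdry:
  assumes ne: "singular_bdry \<noteq> {}"
  shows "\<exists>x0\<in>singular_bdry. \<exists>v \<omega>\<^sub>0 m\<^sub>1 r t\<^sub>1. 0 < \<omega>\<^sub>0 \<and> 0 < m\<^sub>1 \<and> 0 < r \<and> 0 < t\<^sub>1 \<and> t\<^sub>1 < T \<and>
     (\<forall>s. 0 < s \<and> s \<le> 1 \<longrightarrow> x0 + s *\<^sub>R v \<in> \<Omega>) \<and>
     (\<forall>v' c x t. norm (v' - v) \<le> \<omega>\<^sub>0 \<longrightarrow> c - v' \<bullet> x0 \<le> m\<^sub>1 \<longrightarrow> x \<in> \<Omega> \<longrightarrow> dist x0 x < r \<longrightarrow> v' \<bullet> x \<le> c \<longrightarrow>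
        t\<^sub>1 \<le> t \<longrightarrow> t < T \<longrightarrow> mirror (sgn v') (c / norm v') x \<in> \<Omega> \<and> w x t \<le> w (mirror (sgn v') (c / norm v') x) t) \<and>
     (\<forall>x\<in>\<Omega>. dist x0 x < r \<longrightarrow> v \<bullet> (x - x0) < m\<^sub>1 \<longrightarrow>
        (\<exists>k>0. \<exists>\<tau>\<^sub>0>0. \<forall>\<tau>. 0 < \<tau> \<longrightarrow> \<tau> < \<tau>\<^sub>0 \<longrightarrow> k * \<tau> \<le> w (x + \<tau> *\<^sub>R v) t\<^sub>1 - w (x - \<tau> *\<^sub>R v) t\<^sub>1))"
proof -
  obtain x0 where x0: "x0 \<in> singular_bdry" "\<And>x. x \<in> singular_bdry \<Longrightarrow> norm x \<le> norm x0"
    using continuous_attains_sup[OF compact_singular_bdry ne, of norm] by (auto intro: continuous_intros)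
  have x0f: "x0 \<in> frontier \<Omega>" using x0 by (simp add: singular_bdry_def)
  then have x0c: "x0 \<in> closure \<Omega>" "x0 \<notin> \<Omega>" using open_dom by (auto simp: frontier_def interior_open)
  define a where "a = - x0"
  have sing: "(norm (x - x0))\<^sup>2 / 2 \<le> a \<bullet> (x - x0)" if "x \<in> singular_bdry" for x
  proof -
    have "(norm x)\<^sup>2 \<le> (norm x0)\<^sup>2" using x0(2)[OF that] by (simp add: power_mono)
    then show ?thesis
      by (simp add: a_def power2_norm_eq_inner inner_diff_left inner_diff_right inner_commute)
  qed
  have "\<Omega> \<noteq> {}" using x0c by auto
  from inward_normal_exists[OF convex_dom this, of x0] x0c(2)
  obtain \<nu> where \<nu>: "x0 + \<nu> \<in> \<Omega>" "\<And>y. y \<in> closure \<Omega> \<Longrightarrow> 0 \<le> \<nu> \<bullet> (y - x0)" by blast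
  obtain R1 where R1: "0 < R1" "ball (x0 + \<nu>) R1 \<subseteq> \<Omega>" using \<nu>(1) open_dom open_contains_ball by blast
  define N where "N = norm \<nu>"
  have RN: "R1 \<le> N" using R1(2) x0c(2) by (force simp: N_def dist_norm)
  have N: "0 < N" using RN R1 by linarith
  have cone: "x + s *\<^sub>R (\<nu> + \<omega>) \<in> \<Omega>"
    if "x \<in> closure \<Omega>" "norm (x - x0) < R1 / 2" "norm \<omega> < R1 / 2" "0 < s" "s \<le> 1" for x s \<omega>
  proof -
    define p where "p = x + \<nu> + \<omega>"
    have "norm ((x - x0) + \<omega>) < R1" using norm_triangle_ineq[of "x - x0" \<omega>] that by linarith
    moreover have "p - (x0 + \<nu>) = (x - x0) + \<omega>" by (simp add: p_def)
    ultimately have "dist p (x0 + \<nu>) < R1" unfolding dist_norm by (simp only:)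
    then have p: "p \<in> \<Omega>" using R1(2) by (auto simp: dist_commute)
    have eq: "x + s *\<^sub>R (\<nu> + \<omega>) = (1 - s) *\<^sub>R x + s *\<^sub>R p" by (simp add: p_def algebra_simps)
    show ?thesis
    proof (cases "s = 1 \<or> x = p")
      case True then show ?thesis unfolding eq using p by (auto simp flip: scaleR_left.add)
    next
      case False
      then have "(1 - s) *\<^sub>R x + s *\<^sub>R p \<in> open_segment p x"
        unfolding in_segment open_segment_commute[of p x] using that by auto
      then show ?thesis
        unfolding eq using in_interior_closure_convex_segment[of \<Omega> p x] convex_dom p that(1) open_dom
        by (auto simp: interior_open)
    qed
  qed
  define r where "r = R1 / 5"
  have r: "0 < r" "2 * r < R1 / 2" using R1 by (auto simp: r_def)
  define h where "h = r\<^sup>2 / 16"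
  have h: "0 < h" using r by (simp add: h_def)
  \<comment> \<open>A singular point with \<open>a \<bullet> (x - x0) \<le> h\<close> has distance at most \<open>sqrt (2 h) < r / 2\<close> from \<open>x0\<close>, so \<open>S\<close> contains none.\<close>
  define S where "S = {x \<in> frontier \<Omega>. a \<bullet> (x - x0) \<le> h \<and> r / 2 \<le> norm (x - x0) \<and> norm (x - x0) \<le> 2 * r}"
  have "compact S"
  proof -
    have "S = frontier \<Omega> \<inter> ({x. a \<bullet> (x - x0) \<le> h} \<inter> {x. r / 2 \<le> norm (x - x0)} \<inter> {x. norm (x - x0) \<le> 2 * r})"
      by (auto simp: S_def)
    moreover have "closed ({x. a \<bullet> (x - x0) \<le> h} \<inter> {x. r / 2 \<le> norm (x - x0)} \<inter> {x. norm (x - x0) \<le> 2 * r})"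
      by (intro closed_Int closed_Collect_le continuous_intros)
    ultimately show ?thesis using compact_frontier_bounded[OF bounded_dom] by (simp add: compact_Int_closed)
  qed
  moreover have "bounded_near x" if "x \<in> S" for x
  proof (rule ccontr)
    assume "\<not> bounded_near x"
    then have "x \<in> singular_bdry" using that by (simp add: S_def singular_bdry_def)
    from sing[OF this] have "(norm (x - x0))\<^sup>2 / 2 \<le> h" using that by (simp add: S_def)
    moreover have "(r / 2)\<^sup>2 \<le> (norm (x - x0))\<^sup>2" using that r by (intro power_mono) (auto simp: S_def)
    moreover have "(r / 2)\<^sup>2 = r\<^sup>2 / 4" by (simp add: power_divide)
    ultimately show False using zero_less_power[OF r(1), of 2] unfolding h_def by linarith
  qed
  ultimately obtain dS MS where S: "0 < dS" "\<And>x y t. x \<in> S \<Longrightarrow> y \<in> \<Omega> \<Longrightarrow> t \<in> {0..<T} \<Longrightarrow> dist x y < dS \<Longrightarrow> w y t \<le> MS"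
    using uniformly_bounded_near_compact[of S] by blast
  define t1 where "t1 = T / 2"
  have t1: "0 < t1" "t1 < T" using T_pos by (auto simp: t1_def)
  obtain M2 where M2: "\<And>x t. x \<in> closure \<Omega> \<Longrightarrow> t \<in> {0..t1} \<Longrightarrow> w x t \<le> M2" using bounded_before[OF t1(2)] by blast
  define M where "M = max MS M2"
  define rG where "rG = r / 4"
  define \<sigma> where "\<sigma> = R1 / (16 * N)"
  have \<sigma>: "0 < \<sigma>" "\<sigma> \<le> 1" using R1 N RN by (auto simp: \<sigma>_def field_simps)
  define s0 where "s0 = N / 2"
  obtain \<theta> c where \<theta>: "0 < \<theta>" and c: "0 < c" and G: "\<And>e \<mu> xc b t d.
     norm e = 1 \<Longrightarrow>
     (\<forall>x \<in> closure \<Omega>. \<forall>s \<omega>. dist xc x < rG \<longrightarrow> 0 < s \<longrightarrow> s \<le> s0 \<longrightarrow> norm \<omega> \<le> \<sigma> \<longrightarrow> x + s *\<^sub>R (e + \<omega>) \<in> \<Omega>) \<Longrightarrow>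
     (\<forall>x \<in> \<Omega>. \<forall>t \<in> {0..b}. dist xc x < rG \<longrightarrow> 0 < \<mu> - e \<bullet> x \<longrightarrow> w x t \<le> M) \<Longrightarrow>
     (\<forall>x \<in> closure \<Omega>. dist xc x < rG \<longrightarrow> \<mu> - e \<bullet> x \<le> \<theta>) \<Longrightarrow>
     b < T \<Longrightarrow> t \<in> {t1..b} \<Longrightarrow> xc \<in> \<Omega> \<Longrightarrow> 0 < \<mu> - e \<bullet> xc \<Longrightarrow>
     0 < d \<Longrightarrow> ball (xc + (\<mu> - e \<bullet> xc) *\<^sub>R e) d \<subseteq> \<Omega> \<Longrightarrow>
     c * d * (\<mu> - e \<bullet> xc) \<le> w (mirror e \<mu> xc) t - w xc t"
    using thin_cap_reflection[of \<sigma> s0 rG t1 M] \<sigma> N r t1 unfolding s0_def rG_def by force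
  define \<theta>' where "\<theta>' = Min {\<theta>, r / 4, dS / 2, s0 / 2}"
  have \<theta>': "0 < \<theta>'" "\<theta>' \<le> \<theta>" "\<theta>' \<le> r / 4" "\<theta>' < dS" "2 * \<theta>' \<le> s0"
    using \<theta> r S(1) N by (auto simp: \<theta>'_def s0_def min_def)
  define \<omega>1 where "\<omega>1 = h / (8 * r)"
  have \<omega>1: "0 < \<omega>1" "\<omega>1 * (2 * r) = h / 4" using h r by (auto simp: \<omega>1_def)
  define A where "A = norm a + \<omega>1"
  have A: "0 < A" using \<omega>1 by (simp add: A_def add_nonneg_pos)
  define \<beta> where "\<beta> = min (R1 / (4 * A)) (\<theta>' * (N / 2) / (h / 2 + 2 * r * A))"
  have den: "0 < h / 2 + 2 * r * A" using h r A by (simp add: add_pos_pos)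
  have \<beta>: "0 < \<beta>" "\<beta> * A \<le> R1 / 4" "\<beta> * (h / 2 + 2 * r * A) \<le> \<theta>' * (N / 2)"
  proof -
    show "0 < \<beta>" using R1 A \<theta>' N den by (simp add: \<beta>_def)
    have "\<beta> \<le> R1 / (4 * A)" by (simp add: \<beta>_def)
    then show "\<beta> * A \<le> R1 / 4" using A by (simp add: field_simps)
    have "\<beta> \<le> \<theta>' * (N / 2) / (h / 2 + 2 * r * A)" by (simp add: \<beta>_def)
    then show "\<beta> * (h / 2 + 2 * r * A) \<le> \<theta>' * (N / 2)" using den by (simp only: pos_le_divide_eq)
  qed
  define v where "v = \<nu> + \<beta> *\<^sub>R a"
  define \<omega>0 where "\<omega>0 = \<beta> * \<omega>1"
  define m1 where "m1 = \<beta> * h / 2"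
  have m1: "0 < m1" "0 < \<omega>0" using \<beta> h \<omega>1 by (auto simp: m1_def \<omega>0_def)
  \<comment> \<open>All that is needed about the caps: unit normal, the cone condition, thinness, and that they avoid the singular part of the
     boundary away from \<open>x0\<close>.\<close>
  have caps: "norm (sgn v') = 1 \<and> 3/4 * N \<le> norm v' \<and>
      (\<forall>x \<in> closure \<Omega>. \<forall>s \<omega>. dist x0 x < 2 * r \<longrightarrow> 0 < s \<longrightarrow> s \<le> s0 \<longrightarrow> norm \<omega> \<le> \<sigma> \<longrightarrow> x + s *\<^sub>R (sgn v' + \<omega>) \<in> \<Omega>) \<and>
      (\<forall>x \<in> closure \<Omega>. dist x0 x \<le> 2 * r \<longrightarrow> k / norm v' - sgn v' \<bullet> x \<le> \<theta>') \<and>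
      (\<forall>x \<in> closure \<Omega>. dist x0 x \<le> 2 * r \<longrightarrow> 0 < k / norm v' - sgn v' \<bullet> x \<longrightarrow> a \<bullet> (x - x0) \<le> h)"
    if v': "norm (v' - v) \<le> \<omega>0" and k: "k - v' \<bullet> x0 \<le> m1" for v' k
  proof -
    define \<omega> where "\<omega> = (1 / \<beta>) *\<^sub>R (v' - v)"
    have v'eq: "v' = \<nu> + \<beta> *\<^sub>R (a + \<omega>)" using \<beta> by (simp add: \<omega>_def v_def scaleR_add_right)
    have "norm \<omega> = norm (v' - v) / \<beta>" unfolding \<omega>_def norm_scaleR using \<beta>(1) by simp
    then have \<omega>: "norm \<omega> \<le> \<omega>1" using v' \<beta>(1) by (simp add: \<omega>0_def pos_divide_le_eq mult.commute)
    have a\<omega>: "norm (a + \<omega>) \<le> A" using norm_triangle_ineq[of a \<omega>] \<omega> by (simp add: A_def)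
    have dev: "norm (v' - \<nu>) \<le> R1 / 4"
    proof -
      have "norm (v' - \<nu>) = \<beta> * norm (a + \<omega>)" using \<beta> by (simp add: v'eq)
      also have "\<dots> \<le> \<beta> * A" using a\<omega> \<beta> by (intro mult_left_mono) auto
      finally show ?thesis using \<beta> by linarith
    qed
    have nv: "3/4 * N \<le> norm v'" "norm v' \<le> 2 * N"
      using norm_triangle_ineq2[of \<nu> "\<nu> - v'"] norm_triangle_ineq[of \<nu> "v' - \<nu>"] dev RN N
      by (auto simp: N_def norm_minus_commute)
    have nv0: "0 < norm v'" using nv N by linarith
    have sg: "norm (sgn v') = 1" using nv0 by (simp add: norm_sgn)
    have Yeq: "k / norm v' - sgn v' \<bullet> x = (k - v' \<bullet> x) / norm v'" for x
      by (simp add: sgn_div_norm diff_divide_distrib inverse_eq_divide)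
    have cc: "x + s *\<^sub>R (sgn v' + \<omega>') \<in> \<Omega>"
      if "x \<in> closure \<Omega>" "dist x0 x < 2 * r" "0 < s" "s \<le> s0" "norm \<omega>' \<le> \<sigma>" for x s \<omega>'
    proof -
      have "norm ((v' - \<nu>) + norm v' *\<^sub>R \<omega>') \<le> R1 / 4 + norm v' * \<sigma>"
        using norm_triangle_ineq[of "v' - \<nu>" "norm v' *\<^sub>R \<omega>'"] dev that(5) mult_left_mono[OF that(5), of "norm v'"] by simp
      also have "norm v' * \<sigma> \<le> 2 * N * \<sigma>" using nv \<sigma> by (intro mult_right_mono) auto
      also have "2 * N * \<sigma> = R1 / 8" using N by (simp add: \<sigma>_def)
      finally have 1: "norm ((v' - \<nu>) + norm v' *\<^sub>R \<omega>') < R1 / 2" using R1 by linarith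
      have 2: "norm (x - x0) < R1 / 2" using that r by (simp add: dist_norm norm_minus_commute)
      have 3: "0 < s / norm v'" "s / norm v' \<le> 1" using that nv nv0 N by (auto simp: s0_def divide_le_eq)
      have "x + (s / norm v') *\<^sub>R (\<nu> + ((v' - \<nu>) + norm v' *\<^sub>R \<omega>')) \<in> \<Omega>"
        by (rule cone[OF that(1) 2 1 3])
      also have "x + (s / norm v') *\<^sub>R (\<nu> + ((v' - \<nu>) + norm v' *\<^sub>R \<omega>')) = x + s *\<^sub>R (sgn v' + \<omega>')"
        using nv0 by (simp add: sgn_div_norm scaleR_add_right divide_inverse)
      finally show ?thesis .
    qed
    have vy: "v' \<bullet> (x - x0) = \<nu> \<bullet> (x - x0) + \<beta> * ((a + \<omega>) \<bullet> (x - x0))" for x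
      by (simp add: v'eq inner_add_left)
    have th: "k / norm v' - sgn v' \<bullet> x \<le> \<theta>'" if "x \<in> closure \<Omega>" "dist x0 x \<le> 2 * r" for x
    proof -
      have "- ((a + \<omega>) \<bullet> (x - x0)) \<le> norm (a + \<omega>) * norm (x - x0)"
        using Cauchy_Schwarz_ineq2[of "a + \<omega>" "x - x0"] by linarith
      also have "\<dots> \<le> A * (2 * r)" using a\<omega> that A by (intro mult_mono) (auto simp: dist_norm norm_minus_commute)
      finally have "\<beta> * (- ((a + \<omega>) \<bullet> (x - x0))) \<le> \<beta> * (A * (2 * r))" using \<beta> by (intro mult_left_mono) auto
      then have "- (v' \<bullet> (x - x0)) \<le> \<beta> * (A * (2 * r))" using \<nu>(2)[OF that(1)] by (simp add: vy)
      then have "k - v' \<bullet> x \<le> \<beta> * (h / 2 + 2 * r * A)"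
        using k by (simp add: m1_def inner_diff_right algebra_simps)
      also have "\<dots> \<le> \<theta>' * (N / 2)" by (rule \<beta>)
      also have "\<dots> \<le> \<theta>' * norm v'" using nv \<theta>' N by (intro mult_left_mono) auto
      finally show ?thesis unfolding Yeq using nv0 by (simp add: pos_divide_le_eq)
    qed
    have am: "a \<bullet> (x - x0) \<le> h" if "x \<in> closure \<Omega>" "dist x0 x \<le> 2 * r" "0 < k / norm v' - sgn v' \<bullet> x" for x
    proof -
      have "v' \<bullet> x < k" using that(3) nv0 unfolding Yeq by (simp add: zero_less_divide_iff)
      then have "v' \<bullet> (x - x0) \<le> m1" using k by (simp add: inner_diff_right)
      then have "\<beta> * ((a + \<omega>) \<bullet> (x - x0)) \<le> \<beta> * (h / 2)" using \<nu>(2)[OF that(1)] by (simp add: vy m1_def)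
      then have 1: "(a + \<omega>) \<bullet> (x - x0) \<le> h / 2" using \<beta> by (simp only: mult_le_cancel_left_pos)
      have "- (\<omega> \<bullet> (x - x0)) \<le> norm \<omega> * norm (x - x0)"
        using Cauchy_Schwarz_ineq2[of \<omega> "x - x0"] by linarith
      also have "\<dots> \<le> \<omega>1 * (2 * r)" using \<omega> \<omega>1 that by (intro mult_mono) (auto simp: dist_norm norm_minus_commute)
      finally show ?thesis using 1 \<omega>1 h by (simp add: inner_add_left)
    qed
    show ?thesis using sg nv cc th am by blast
  qed
  have G': "k' * d * (k / norm v' - sgn v' \<bullet> xc) \<le> w (mirror (sgn v') (k / norm v') xc) t - w xc t"
    if "norm (v' - v) \<le> \<omega>0" and "k - v' \<bullet> x0 \<le> m1" and "xc \<in> \<Omega>" "dist x0 xc \<le> r" "0 < k / norm v' - sgn v' \<bullet> xc"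
      and "0 < d" "ball (xc + (k / norm v' - sgn v' \<bullet> xc) *\<^sub>R sgn v') d \<subseteq> \<Omega>" and "t1 \<le> t" "t < T"
      and good: "dist x0 xc = r \<or> t = t1" and k': "k' = c"
    for v' k xc t d k'
  proof -
    note cp = caps[OF that(1,2)]
    have near: "dist x0 x < 2 * r" if "dist xc x < rG" for x
      using that \<open>dist x0 xc \<le> r\<close> dist_triangle[of x0 x xc] r by (simp add: rG_def)
    show ?thesis unfolding k'
    proof (rule G[where b=t])
      show "\<forall>x \<in> \<Omega>. \<forall>s \<in> {0..t}. dist xc x < rG \<longrightarrow> 0 < k / norm v' - sgn v' \<bullet> x \<longrightarrow> w x s \<le> M"
      proof (intro ballI impI)
        fix x s assume x: "x \<in> \<Omega>" "s \<in> {0..t}" "dist xc x < rG" "0 < k / norm v' - sgn v' \<bullet> x"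
        have xcl: "x \<in> closure \<Omega>" using x closure_subset by blast
        show "w x s \<le> M"
        proof (cases "t = t1")
          case True then show ?thesis using M2[OF xcl, of s] x by (simp add: M_def)
        next
          case False
          then have dr: "dist x0 xc = r" using good by blast
          define e where "e = sgn v'"
          have e: "norm e = 1" "e \<bullet> e = 1" using cp by (auto simp: e_def norm_eq_1)
          then have "e \<noteq> 0" by auto
          obtain d0 where d0: "0 < d0" "x + d0 *\<^sub>R (- e) \<in> frontier \<Omega>"
            "\<And>s. 0 \<le> s \<Longrightarrow> s < d0 \<Longrightarrow> x + s *\<^sub>R (- e) \<in> interior \<Omega>"
            using ray_to_frontier[of \<Omega> x "- e"] bounded_dom x open_dom \<open>e \<noteq> 0\<close> by (auto simp: interior_open)
          have xd: "r - rG \<le> dist x0 x" "dist x0 x \<le> r + rG"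
            using dr x(3) dist_triangle[of x0 x xc] dist_triangle2[of x0 xc x] by (auto simp: dist_commute)
          have yd: "dist x0 (x + s *\<^sub>R (- e)) \<le> dist x0 x + \<bar>s\<bar>" "dist x0 x \<le> dist x0 (x + s *\<^sub>R (- e)) + \<bar>s\<bar>" for s
            using dist_triangle[of x0 "x + s *\<^sub>R (- e)" x] dist_triangle[of x0 x "x + s *\<^sub>R (- e)"] e by (auto simp: dist_norm)
          have ray: "k / norm v' - sgn v' \<bullet> (x + s *\<^sub>R (- e)) = k / norm v' - sgn v' \<bullet> x + s" for s
            using e by (simp add: e_def inner_diff_right)
          have d0\<theta>: "d0 \<le> \<theta>'"
          proof (rule ccontr)
            assume "\<not> d0 \<le> \<theta>'"
            then have "x + \<theta>' *\<^sub>R (- e) \<in> interior \<Omega>" using d0(3)[of \<theta>'] \<theta>'(1) by linarith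
            then have "x + \<theta>' *\<^sub>R (- e) \<in> closure \<Omega>" using interior_subset closure_subset by blast
            moreover have "dist x0 (x + \<theta>' *\<^sub>R (- e)) \<le> 2 * r" using yd(1)[of \<theta>'] xd \<theta>'(1,3) r by (simp add: rG_def)
            ultimately have "k / norm v' - sgn v' \<bullet> (x + \<theta>' *\<^sub>R (- e)) \<le> \<theta>'" using cp by blast
            then show False using ray[of \<theta>'] x(4) by linarith
          qed
          define y where "y = x + d0 *\<^sub>R (- e)"
          have ycl: "y \<in> closure \<Omega>" using d0(2) by (simp add: y_def frontier_def)
          have y1: "dist x0 y \<le> 2 * r" "r / 2 \<le> dist x0 y"
            using yd[of d0] xd d0(1) d0\<theta> \<theta>'(3) r(1) unfolding y_def rG_def by linarith+
          have "0 < k / norm v' - sgn v' \<bullet> y" using ray[of d0] x(4) d0(1) by (simp add: y_def)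
          then have "a \<bullet> (y - x0) \<le> h" using cp ycl y1 by blast
          then have "y \<in> S" using d0(2) y1 by (auto simp: S_def y_def dist_norm norm_minus_commute)
          moreover have "dist y x < dS" using e d0(1) d0\<theta> \<theta>' by (simp add: y_def dist_norm)
          ultimately show ?thesis using S(2)[of y x s] x \<open>t < T\<close> by (auto simp: M_def)
        qed
      qed
      show "\<forall>x \<in> closure \<Omega>. dist xc x < rG \<longrightarrow> k / norm v' - sgn v' \<bullet> x \<le> \<theta>"
        using cp near \<theta>'(2) by (meson less_imp_le order_trans)
      show "\<forall>x \<in> closure \<Omega>. \<forall>s \<omega>. dist xc x < rG \<longrightarrow> 0 < s \<longrightarrow> s \<le> s0 \<longrightarrow> norm \<omega> \<le> \<sigma> \<longrightarrow> x + s *\<^sub>R (sgn v' + \<omega>) \<in> \<Omega>"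
        using cp near by blast
    qed (use that cp in auto)
  qed
  have reflect: "mirror (sgn v') (k / norm v') x \<in> \<Omega> \<and> w x t \<le> w (mirror (sgn v') (k / norm v') x) t"
    if v': "norm (v' - v) \<le> \<omega>0" and k: "k - v' \<bullet> x0 \<le> m1" and x: "x \<in> \<Omega>" "dist x0 x < r" "v' \<bullet> x \<le> k"
      and t: "t1 \<le> t" "t < T" for v' k x t
  proof -
    note cp = caps[OF v' k]
    have nv0: "0 < norm v'" using cp N by linarith
    obtain Mb where Mb: "\<And>x s. x \<in> closure \<Omega> \<Longrightarrow> s \<in> {0..t} \<Longrightarrow> w x s \<le> Mb" using bounded_before[OF t(2)] by blast
    obtain K where K: "0 \<le> K" "\<And>t x y. t \<in> {0<..<T} \<Longrightarrow> x \<in> \<Omega> \<Longrightarrow> y \<in> \<Omega> \<Longrightarrow> w y t \<le> w x t \<Longrightarrow> w x t \<le> Mb \<Longrightarrow>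
      q x t - q y t \<le> K * (w x t - w y t)"
      using q_lipschitz[of Mb] by blast
    interpret cap: reflected_cap \<Omega> T m w q "sgn v'" "k / norm v'" x0 "2 * r" t Mb K \<sigma> s0
    proof unfold_locales
      show "2 * (k / norm v' - sgn v' \<bullet> x) \<le> s0" if "x \<in> closure \<Omega>" "dist x0 x < 2 * r" for x
      proof -
        have "k / norm v' - sgn v' \<bullet> x \<le> \<theta>'" using cp that by auto
        from mult_left_mono[OF this, of 2] \<theta>'(5) show ?thesis by (meson order_trans zero_le_numeral)
      qed
      show "w x s \<le> Mb" if "x \<in> \<Omega>" "s \<in> {0..t}" for x s using Mb[of x s] that closure_subset by blast
      show "x + s *\<^sub>R (sgn v' + \<omega>) \<in> \<Omega>" if "x \<in> closure \<Omega>" "dist x0 x < 2 * r" "0 < s" "s \<le> s0" "norm \<omega> \<le> \<sigma>" for x s \<omega>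
        using cp that by blast
      show "q x s - q y s \<le> K * (w x s - w y s)"
        if "s \<in> {0<..t}" "x \<in> \<Omega>" "y \<in> \<Omega>" "w y s \<le> w x s" "w x s \<le> Mb" for s x y
        using K(2)[of s x y] that t by auto
    qed (use cp \<sigma> N t t1 K(1) in \<open>auto simp: s0_def\<close>)
    have Yeq: "cap.Y x = (k - v' \<bullet> x) / norm v'" for x
      unfolding cap.Y_def by (simp add: sgn_div_norm diff_divide_distrib inverse_eq_divide)
    have Yx: "0 \<le> cap.Y x" unfolding Yeq using x nv0 by simp
    have xcl: "x \<in> closure \<Omega>" using x closure_subset by blast
    have pos: "0 \<le> cap.D y s" if "y \<in> \<Omega>" "dist x0 y \<le> r" "0 < cap.Y y" "t1 \<le> s" "s < T" "dist x0 y = r \<or> s = t1" for y s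
    proof -
      have Yp: "0 < k / norm v' - sgn v' \<bullet> y" "k / norm v' - sgn v' \<bullet> y \<le> s0"
      proof -
        show "0 < k / norm v' - sgn v' \<bullet> y" using that(3) by (simp add: cap.Y_def)
        have "y \<in> closure \<Omega>" using that closure_subset by blast
        then have "k / norm v' - sgn v' \<bullet> y \<le> \<theta>'" using cp that(2) r by auto
        then show "k / norm v' - sgn v' \<bullet> y \<le> s0" using \<theta>'(1,5) by linarith
      qed
      have "y + (k / norm v' - sgn v' \<bullet> y) *\<^sub>R (sgn v' + 0) \<in> \<Omega>"
        using cap.cone[OF subsetD[OF closure_subset that(1)] _ Yp, of 0] that(2) r(1) \<sigma>(1) by simp
      then obtain d where d: "0 < d" "ball (y + (k / norm v' - sgn v' \<bullet> y) *\<^sub>R sgn v') d \<subseteq> \<Omega>"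
        using open_dom open_contains_ball by (metis add.right_neutral)
      have "0 \<le> c * d * (k / norm v' - sgn v' \<bullet> y)" using c d Yp by simp
      then show ?thesis using G'[OF v' k that(1,2) Yp(1) d that(4,5,6) refl] by (simp add: cap.D_def)
    qed
    have "0 \<le> cap.D x t + 0"
    proof (rule cap.reflection_comparison[where C="cball x0 r" and V="ball x0 r" and E="\<lambda>x t. 0" and ta=t1 and tb=t and \<Lambda>="K + 1"])
      show "0 \<le> w (mirror (sgn v') (k / norm v') y) s + 0"
        if "y \<in> frontier \<Omega>" "y \<in> cball x0 r" "0 \<le> cap.Y y" "s \<in> {t1..t}" for y s
        using w_nonneg[OF cap.mirror_in_closure[of y], of s] that r t1 t by (auto simp: frontier_def)
      show "0 \<le> cap.D y s + 0" if "y \<in> \<Omega>" "y \<in> cball x0 r - ball x0 r" "0 < cap.Y y" "s \<in> {t1..t}" for y s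
        using pos[of y s] that t by auto
      show "0 \<le> cap.D y t1 + 0" if y: "y \<in> closure \<Omega>" "y \<in> cball x0 r" "0 \<le> cap.Y y" for y
      proof (cases "y \<in> \<Omega>")
        case True
        show ?thesis
        proof (cases "cap.Y y = 0")
          case True then show ?thesis by (simp add: cap.D_def cap.mirror_Y)
        next
          case False then show ?thesis using pos[of y t1] \<open>y \<in> \<Omega>\<close> y t1 by auto
        qed
      next
        case False
        then have "y \<in> frontier \<Omega>" using y open_dom by (simp add: frontier_def interior_open)
        then have "w y t1 = 0" using w_bdry t1 by auto
        then show ?thesis using w_nonneg[OF cap.mirror_in_closure[of y], of t1] y r t1 by (auto simp: cap.D_def)
      qed
      show "\<exists>et p l. ((\<lambda>t. 0) has_real_derivative et) (at s) \<and> has_grad_lap (\<lambda>y. 0) p l y \<and>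
         (\<forall>d\<ge>-Mb. d + 0 < 0 \<longrightarrow> (K + 1) * (d + 0) < K * min d 0 + et - l)" for y :: 'a and s :: real
        by (intro exI[of _ 0] conjI has_grad_lap_const) (auto simp: algebra_simps)
    qed (use r t t1 x xcl Yx in auto)
    moreover have "mirror (sgn v') (k / norm v') x \<in> \<Omega>"
    proof (cases "cap.Y x = 0")
      case True then show ?thesis using x by (simp add: cap.mirror_Y)
    next
      case False then show ?thesis using cap.mirror_in_dom[OF xcl] Yx x r by auto
    qed
    ultimately show ?thesis by (simp add: cap.D_def)
  qed
  have seg: "x0 + s *\<^sub>R v \<in> \<Omega>" if "0 < s" "s \<le> 1" for s
  proof -
    have "norm (\<beta> *\<^sub>R a) \<le> \<beta> * A" using \<beta> \<omega>1 by (simp add: A_def)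
    then have "norm (\<beta> *\<^sub>R a) < R1 / 2" using \<beta> R1 by linarith
    then show ?thesis using cone[of x0 "\<beta> *\<^sub>R a" s] x0c that R1 by (simp add: v_def)
  qed
  have strict: "\<exists>k>0. \<exists>\<tau>0>0. \<forall>\<tau>. 0 < \<tau> \<longrightarrow> \<tau> < \<tau>0 \<longrightarrow> k * \<tau> \<le> w (x + \<tau> *\<^sub>R v) t1 - w (x - \<tau> *\<^sub>R v) t1"
    if x: "x \<in> \<Omega>" "dist x0 x < r" "v \<bullet> (x - x0) < m1" for x
  proof -
    have vv: "norm (v - v) \<le> \<omega>0" using m1 by simp
    have kk: "v \<bullet> x - v \<bullet> x0 \<le> m1" using x by (simp add: inner_diff_right)
    have nv: "0 < norm v" using caps[OF vv kk] N by linarith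
    obtain d where d: "0 < d" "ball x d \<subseteq> \<Omega>" using x open_dom open_contains_ball by blast
    define \<tau>0 where "\<tau>0 = min d (r - dist x0 x) / norm v"
    have \<tau>0: "0 < \<tau>0" using d x nv by (simp add: \<tau>0_def)
    have "c * d * norm v * \<tau> \<le> w (x + \<tau> *\<^sub>R v) t1 - w (x - \<tau> *\<^sub>R v) t1" if \<tau>: "0 < \<tau>" "\<tau> < \<tau>0" for \<tau>
    proof -
      have \<tau>n: "\<tau> * norm v < d" "\<tau> * norm v < r - dist x0 x" using \<tau>(2) nv by (auto simp: \<tau>0_def pos_less_divide_eq)
      have 1: "x - \<tau> *\<^sub>R v \<in> \<Omega>" using \<tau>n \<tau> d(2) by (auto simp: subset_iff dist_norm)
      have 2: "dist x0 (x - \<tau> *\<^sub>R v) \<le> r"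
        using \<tau>n \<tau> dist_triangle[of x0 "x - \<tau> *\<^sub>R v" x] by (simp add: dist_norm)
      have Y: "(v \<bullet> x) / norm v - sgn v \<bullet> (x - \<tau> *\<^sub>R v) = \<tau> * norm v"
        using nv by (simp add: sgn_div_norm inner_diff_right power2_norm_eq_inner[symmetric] field_simps power2_eq_square)
      have Yv: "(\<tau> * norm v) *\<^sub>R sgn v = \<tau> *\<^sub>R v" using nv by (simp add: sgn_div_norm)
      have mir: "mirror (sgn v) ((v \<bullet> x) / norm v) (x - \<tau> *\<^sub>R v) = x + \<tau> *\<^sub>R v"
        using nv by (intro mirror_midpoint) auto
      have "c * d * (\<tau> * norm v) \<le> w (mirror (sgn v) ((v \<bullet> x) / norm v) (x - \<tau> *\<^sub>R v)) t1 - w (x - \<tau> *\<^sub>R v) t1"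
        using G'[OF vv kk 1 2, of d t1 c] unfolding Y Yv using \<tau> nv d t1 by simp
      then show ?thesis unfolding mir by (simp add: mult_ac)
    qed
    then show ?thesis using c d nv \<tau>0 by (intro exI[of _ "c * d * norm v"] exI[of _ \<tau>0] conjI) auto
  qed
  show ?thesis
  proof (rule bexI[OF _ x0(1)], rule exI[of _ v], rule exI[of _ \<omega>0], rule exI[of _ m1], rule exI[of _ r],
      rule exI[of _ t1], intro conjI)
    show "\<forall>s. 0 < s \<and> s \<le> 1 \<longrightarrow> x0 + s *\<^sub>R v \<in> \<Omega>" using seg by blast
    show "\<forall>v' c x t. norm (v' - v) \<le> \<omega>0 \<longrightarrow> c - v' \<bullet> x0 \<le> m1 \<longrightarrow> x \<in> \<Omega> \<longrightarrow> dist x0 x < r \<longrightarrow> v' \<bullet> x \<le> c \<longrightarrow>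
        t1 \<le> t \<longrightarrow> t < T \<longrightarrow> mirror (sgn v') (c / norm v') x \<in> \<Omega> \<and> w x t \<le> w (mirror (sgn v') (c / norm v') x) t"
      by (intro allI impI) (rule reflect)
    show "\<forall>x\<in>\<Omega>. dist x0 x < r \<longrightarrow> v \<bullet> (x - x0) < m1 \<longrightarrow>
        (\<exists>k>0. \<exists>\<tau>\<^sub>0>0. \<forall>\<tau>. 0 < \<tau> \<longrightarrow> \<tau> < \<tau>\<^sub>0 \<longrightarrow> k * \<tau> \<le> w (x + \<tau> *\<^sub>R v) t1 - w (x - \<tau> *\<^sub>R v) t1)"
      by (intro ballI impI) (rule strict)
  qed (fact m1 r(1) t1)+
qed

end

section \<open>From a cone of monotonicity to a bound away from one\<close>

lemma inverse_square_tangent: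
  fixes a b :: real
  assumes "0 < a" "a \<le> b"
  shows "2 * (b - a) / b ^ 3 \<le> 1 / a\<^sup>2 - 1 / b\<^sup>2"
proof -
  have b: "0 < b" using assms by simp
  have "0 \<le> (b - a)\<^sup>2 * (b + 2 * a)" using assms b by simp
  also have "\<dots> = b ^ 3 - a\<^sup>2 * (3 * b - 2 * a)" by (simp add: power2_eq_square power3_eq_cube algebra_simps)
  finally have "a\<^sup>2 * (3 * b - 2 * a) \<le> b ^ 3" by simp
  then have "(3 * b - 2 * a) / b ^ 3 \<le> 1 / a\<^sup>2" using assms b by (simp add: field_simps)
  moreover have "(3 * b - 2 * a) / b ^ 3 = 1 / b\<^sup>2 + 2 * (b - a) / b ^ 3"
    using b by (simp add: field_simps power2_eq_square power3_eq_cube)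
  ultimately show ?thesis by linarith
qed

lemma directional_mean_value:
  fixes p x v :: "'a::euclidean_space"
  assumes d: "\<And>y. y \<in> cball p r \<Longrightarrow> (g has_derivative (\<lambda>h. G y \<bullet> h)) (at y)"
    and x: "x \<in> cball p r" "x + h *\<^sub>R v \<in> cball p r" and h: "0 < h"
  shows "\<exists>\<xi>. 0 < \<xi> \<and> \<xi> < h \<and> x + \<xi> *\<^sub>R v \<in> cball p r \<and> g (x + h *\<^sub>R v) - g x = h * (v \<bullet> G (x + \<xi> *\<^sub>R v))"
proof -
  have seg: "x + s *\<^sub>R v \<in> cball p r" if "0 \<le> s" "s \<le> h" for s
  proof -
    have "x + s *\<^sub>R v = (1 - s / h) *\<^sub>R x + (s / h) *\<^sub>R (x + h *\<^sub>R v)"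
      using h by (simp add: algebra_simps flip: scaleR_left.add)
    moreover have "(1 - s / h) *\<^sub>R x + (s / h) *\<^sub>R (x + h *\<^sub>R v) \<in> cball p r"
      using convexD_alt[OF convex_cball x, of "s / h"] that h by simp
    ultimately show ?thesis by simp
  qed
  have der: "((\<lambda>s. g (x + s *\<^sub>R v)) has_real_derivative (v \<bullet> G (x + s *\<^sub>R v))) (at s)" if "0 \<le> s" "s \<le> h" for s
  proof -
    have "((\<lambda>s. x + s *\<^sub>R v) has_derivative (\<lambda>h. h *\<^sub>R v)) (at s)" by (auto intro!: derivative_eq_intros)
    from has_derivative_compose[OF this d[OF seg[OF that]]]
    show ?thesis unfolding has_field_derivative_def by (simp add: inner_commute mult.commute[of _ "v \<bullet> _"])
  qed
  obtain \<xi> where "0 < \<xi>" "\<xi> < h" "g (x + h *\<^sub>R v) - g (x + 0 *\<^sub>R v) = (h - 0) * (v \<bullet> G (x + \<xi> *\<^sub>R v))"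
    using MVT2[OF h, of "\<lambda>s. g (x + s *\<^sub>R v)" "\<lambda>s. v \<bullet> G (x + s *\<^sub>R v)"] der by auto
  then show ?thesis using seg[of \<xi>] by auto
qed

text \<open>
  The condition \<open>cone\<close> expresses that \<open>u\<close> is nondecreasing in all directions of a cone with axis \<open>v\<close>: it bounds the
  full gradient by the derivative in the direction \<open>v\<close>.
\<close>

locale monotone_cone =
  fixes u ut L :: "'a::euclidean_space \<Rightarrow> real \<Rightarrow> real" and Du :: "'a \<Rightarrow> real \<Rightarrow> 'a"
    and p v :: 'a and r r\<^sub>1 t\<^sub>1 T lam \<delta> C :: real
  assumes lam: "0 < lam" and \<delta>: "0 < \<delta>" and r: "0 < r" "r < r\<^sub>1" and t\<^sub>1: "t\<^sub>1 < T" and C: "0 \<le> C"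
    and cont_u: "continuous_on (cball p r\<^sub>1 \<times> {t\<^sub>1..<T}) (\<lambda>(x, t). u x t)"
    and cont_Du: "continuous_on (cball p r\<^sub>1 \<times> {t\<^sub>1..<T}) (\<lambda>(x, t). Du x t)"
    and space: "\<And>x t. x \<in> cball p r\<^sub>1 \<Longrightarrow> t \<in> {t\<^sub>1..<T} \<Longrightarrow> has_grad_lap (\<lambda>y. u y t) (Du x t) (L x t) x"
    and time: "\<And>x t. x \<in> cball p r\<^sub>1 \<Longrightarrow> t \<in> {t\<^sub>1..<T} \<Longrightarrow> (u x has_real_derivative ut x t) (at t)"
    and eq: "\<And>x t. x \<in> cball p r\<^sub>1 \<Longrightarrow> t \<in> {t\<^sub>1..<T} \<Longrightarrow>
       ut x t - L x t = lam * ((1 + \<delta> * (norm (Du x t))\<^sup>2) / (1 - u x t)\<^sup>2)"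
    and u01: "\<And>x t. x \<in> cball p r\<^sub>1 \<Longrightarrow> t \<in> {t\<^sub>1..<T} \<Longrightarrow> 0 \<le> u x t \<and> u x t < 1"
    and cone: "\<And>x t. x \<in> cball p r\<^sub>1 \<Longrightarrow> t \<in> {t\<^sub>1..<T} \<Longrightarrow> norm (Du x t) \<le> C * (v \<bullet> Du x t) \<and> 0 \<le> v \<bullet> Du x t"
    and start: "\<And>x. x \<in> cball p r \<Longrightarrow> 0 < v \<bullet> Du x t\<^sub>1"
begin

lemma v_nonzero: "v \<noteq> 0"
  using start[of p] r by auto

definition bump :: "'a \<Rightarrow> real" where "bump x = (r\<^sup>2 - (x - p) \<bullet> (x - p)) * (r\<^sup>2 - (x - p) \<bullet> (x - p))"

text \<open>
  With this rate the expression \<open>rate X\<^sup>2 - 4 (DIM + 2) X + 8 r\<^sup>2\<close> is a square plus \<open>4 r\<^sup>2\<close>; for \<open>X = r\<^sup>2 - \<bar>x - p\<bar>\<^sup>2\<close>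
  it is \<open>rate * bump + \<Delta> bump\<close>.
\<close>

definition rate :: real where "rate = (real DIM('a) + 2)\<^sup>2 / r\<^sup>2"

lemma bump_lap:
  "\<exists>l. has_grad_lap bump ((- 4 * (r\<^sup>2 - (x - p) \<bullet> (x - p))) *\<^sub>R (x - p)) l x \<and> 4 * r\<^sup>2 \<le> rate * bump x + l"
proof -
  define X where "X = r\<^sup>2 - (x - p) \<bullet> (x - p)"
  define n where "n = real DIM('a)"
  have gX: "has_grad_lap (\<lambda>x. (0 \<bullet> x + r\<^sup>2) - (x - p) \<bullet> (x - p)) (0 - 2 *\<^sub>R (x - p)) (0 - 2 * n) x"
    unfolding n_def by (intro has_grad_lap_diff has_grad_lap_affine has_grad_lap_dist_square)
  have "has_grad_lap bump ((- 4 * X) *\<^sub>R (x - p)) (8 * (r\<^sup>2 - X) - 4 * n * X) x"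
  proof -
    have "(x - p) \<bullet> (x - p) = r\<^sup>2 - X" by (simp add: X_def)
    then have l: "X * (0 - 2 * n) + X * (0 - 2 * n) + 2 * ((0 - 2 *\<^sub>R (x - p)) \<bullet> (0 - 2 *\<^sub>R (x - p))) = 8 * (r\<^sup>2 - X) - 4 * n * X"
      by simp
    have G: "X *\<^sub>R (0 - 2 *\<^sub>R (x - p)) + X *\<^sub>R (0 - 2 *\<^sub>R (x - p)) = (- 4 * X) *\<^sub>R (x - p)"
    proof -
      have "X *\<^sub>R (0 - 2 *\<^sub>R (x - p)) = (- 2 * X) *\<^sub>R (x - p)" by simp
      then show ?thesis using scaleR_left.add[of "- 2 * X" "- 2 * X" "x - p"] by (simp add: mult.commute[of X 2])
    qed
    have X0: "0 \<bullet> x + r\<^sup>2 - (x - p) \<bullet> (x - p) = X" by (simp add: X_def)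
    show ?thesis using has_grad_lap_mult[OF gX gX] unfolding X0 l G by (simp add: bump_def[abs_def])
  qed
  moreover have "4 * r\<^sup>2 \<le> rate * bump x + (8 * (r\<^sup>2 - X) - 4 * n * X)"
  proof -
    have "rate * bump x + (8 * (r\<^sup>2 - X) - 4 * n * X) = ((n + 2) * X / r - 2 * r)\<^sup>2 + 4 * r\<^sup>2"
    proof -
      have b: "bump x = X * X" by (simp add: bump_def X_def)
      show ?thesis unfolding b rate_def n_def[symmetric] using r by (simp add: power2_eq_square field_simps)
    qed
    then show ?thesis by simp
  qed
  ultimately show ?thesis by (auto simp: X_def)
qed

lemma bump_bounds:
  assumes "x \<in> cball p r"
  shows "0 \<le> bump x" "bump x \<le> r ^ 4" "norm ((- 4 * (r\<^sup>2 - (x - p) \<bullet> (x - p))) *\<^sub>R (x - p)) \<le> 4 * r ^ 3"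
proof -
  have n: "norm (x - p) \<le> r" using assms by (simp add: dist_norm norm_minus_commute)
  have X: "0 \<le> r\<^sup>2 - (x - p) \<bullet> (x - p)" "r\<^sup>2 - (x - p) \<bullet> (x - p) \<le> r\<^sup>2"
    using power_mono[OF n, of 2] by (auto simp: power2_norm_eq_inner)
  show "0 \<le> bump x" using X by (simp add: bump_def)
  have "bump x \<le> r\<^sup>2 * r\<^sup>2" unfolding bump_def using X by (intro mult_mono) auto
  then show "bump x \<le> r ^ 4" by (simp add: power2_eq_square power4_eq_xxxx)
  have "norm ((- 4 * (r\<^sup>2 - (x - p) \<bullet> (x - p))) *\<^sub>R (x - p)) = 4 * (r\<^sup>2 - (x - p) \<bullet> (x - p)) * norm (x - p)"
    using X by (simp add: abs_mult)
  also have "\<dots> \<le> 4 * r\<^sup>2 * r" using X n r by (intro mult_mono) auto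
  finally show "norm ((- 4 * (r\<^sup>2 - (x - p) \<bullet> (x - p))) *\<^sub>R (x - p)) \<le> 4 * r ^ 3"
    by (simp add: power2_eq_square power3_eq_cube)
qed

text \<open>
  The difference of the right-hand sides of the equation at \<open>x + h v\<close> and \<open>x\<close>, divided by \<open>h\<close>, at a point where the
  gradient of the difference quotient equals \<open>\<epsilon> c\<close>.  The term with \<open>1 / (1 - u)\<^sup>2\<close> contributes at least
  \<open>2 g / (1 - u)\<^sup>3\<close>.  This absorbs the gradient term, which by the cone condition is at most a small multiple of \<open>g / (1 - u)\<^sup>2\<close>,
  up to an error that vanishes with \<open>h\<close>.
\<close>

lemma quotient_source:
  fixes u0 u1 h \<epsilon> \<kappa> \<Theta> :: real and p0 p1 c :: 'a
  defines "g \<equiv> (u1 - u0) / h"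
  assumes u: "0 \<le> u0" "u0 \<le> u1" "u1 < 1" and h: "0 < h" and \<epsilon>: "0 \<le> \<epsilon>" "8 * \<delta> * C * \<epsilon> * r ^ 3 \<le> 1"
    and pp: "p1 - p0 = (h * \<epsilon>) *\<^sub>R c" and c: "norm c \<le> 4 * r ^ 3"
    and p0: "norm p0 \<le> C * (g + \<kappa>)" and \<kappa>: "0 \<le> \<kappa>"
    and ratio: "(1 - u0) \<le> 7/5 * (1 - u1)" and \<Theta>: "1 / (1 - u1) \<le> \<Theta>"
  shows "- (lam * \<delta> * \<Theta>\<^sup>2 * \<epsilon> * (4 * r ^ 3) * (2 * C * \<kappa> + h * \<epsilon> * (4 * r ^ 3)))
     \<le> (lam * ((1 + \<delta> * (norm p1)\<^sup>2) / (1 - u1)\<^sup>2) - lam * ((1 + \<delta> * (norm p0)\<^sup>2) / (1 - u0)\<^sup>2)) / h"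
proof -
  define a b where "a = 1 - u1" and "b = 1 - u0"
  have ab: "0 < a" "a \<le> b" "b \<le> 1" "b \<le> 7/5 * a" using u ratio by (auto simp: a_def b_def)
  have g: "0 \<le> g" "h * g = b - a" using u h by (auto simp: g_def a_def b_def)
  define R where "R = 4 * r ^ 3"
  have R: "0 \<le> R" using r by (simp add: R_def)
  have split: "lam * ((1 + \<delta> * (norm p1)\<^sup>2) / a\<^sup>2) - lam * ((1 + \<delta> * (norm p0)\<^sup>2) / b\<^sup>2)
     = lam * (1 + \<delta> * (norm p0)\<^sup>2) * (1 / a\<^sup>2 - 1 / b\<^sup>2) + lam * \<delta> / a\<^sup>2 * ((p1 - p0) \<bullet> (p1 + p0))"
  proof -
    have ip: "(p1 - p0) \<bullet> (p1 + p0) = (norm p1)\<^sup>2 - (norm p0)\<^sup>2"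
      unfolding power2_norm_eq_inner inner_add_right inner_diff_left inner_commute[of p0 p1] by simp
    show ?thesis unfolding ip by (simp add: algebra_simps add_divide_distrib diff_divide_distrib)
  qed
  have first: "lam * (2 * (h * g) / b ^ 3) \<le> lam * (1 + \<delta> * (norm p0)\<^sup>2) * (1 / a\<^sup>2 - 1 / b\<^sup>2)"
  proof -
    have t: "2 * (h * g) / b ^ 3 \<le> 1 / a\<^sup>2 - 1 / b\<^sup>2" using inverse_square_tangent[OF ab(1,2)] g by simp
    have t0: "0 \<le> 2 * (h * g) / b ^ 3" using g h ab by simp
    have "1 * (2 * (h * g) / b ^ 3) \<le> (1 + \<delta> * (norm p0)\<^sup>2) * (1 / a\<^sup>2 - 1 / b\<^sup>2)"
      using t t0 \<delta> by (intro mult_mono) auto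
    from mult_left_mono[OF this, of lam] lam show ?thesis by (simp add: mult.assoc)
  qed
  have n1: "norm (p1 + p0) \<le> 2 * C * (g + \<kappa>) + h * \<epsilon> * R"
  proof -
    have "p1 + p0 = 2 *\<^sub>R p0 + (h * \<epsilon>) *\<^sub>R c" using pp by (simp add: algebra_simps scaleR_2)
    then have "norm (p1 + p0) \<le> 2 * norm p0 + (h * \<epsilon>) * norm c"
      using norm_triangle_ineq[of "2 *\<^sub>R p0" "(h * \<epsilon>) *\<^sub>R c"] h \<epsilon>(1) by simp
    moreover have "(h * \<epsilon>) * norm c \<le> (h * \<epsilon>) * R" using c h \<epsilon>(1) by (intro mult_left_mono) (auto simp: R_def)
    ultimately show ?thesis using p0 by simp
  qed
  have "- ((p1 - p0) \<bullet> (p1 + p0)) \<le> norm (p1 - p0) * norm (p1 + p0)"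
    using Cauchy_Schwarz_ineq2[of "p1 - p0" "p1 + p0"] by linarith
  also have "norm (p1 - p0) = h * \<epsilon> * norm c" using pp h \<epsilon>(1) by simp
  also have "h * \<epsilon> * norm c * norm (p1 + p0) \<le> h * \<epsilon> * R * (2 * C * (g + \<kappa>) + h * \<epsilon> * R)"
    using n1 c h \<epsilon>(1) R by (intro mult_mono) (auto simp: R_def)
  finally have ip: "- (h * \<epsilon> * R * (2 * C * (g + \<kappa>) + h * \<epsilon> * R)) \<le> (p1 - p0) \<bullet> (p1 + p0)" by linarith
  have second: "- (lam * \<delta> / a\<^sup>2 * (h * \<epsilon> * R * (2 * C * (g + \<kappa>) + h * \<epsilon> * R))) \<le> lam * \<delta> / a\<^sup>2 * ((p1 - p0) \<bullet> (p1 + p0))"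
    using mult_left_mono[OF ip, of "lam * \<delta> / a\<^sup>2"] lam \<delta> by simp
  have ia: "1 / a\<^sup>2 \<le> 2 / b\<^sup>2"
  proof -
    have "b\<^sup>2 \<le> (7/5 * a)\<^sup>2" using ab by (intro power_mono) auto
    also have "\<dots> \<le> 2 * a\<^sup>2" by (simp add: power_mult_distrib power_divide)
    finally show ?thesis using ab by (simp add: field_simps)
  qed
  have good: "lam * \<delta> / a\<^sup>2 * (h * \<epsilon> * R * (2 * C * g)) \<le> lam * (2 * (h * g) / b ^ 3)"
  proof -
    have "lam * \<delta> / a\<^sup>2 * (h * \<epsilon> * R * (2 * C * g)) = (lam * h * g) * (8 * \<delta> * C * \<epsilon> * r ^ 3) * (1 / a\<^sup>2)"
      by (simp add: R_def)
    also have "\<dots> \<le> (lam * h * g) * 1 * (2 / b\<^sup>2)"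
      using \<epsilon> ia lam h g C \<delta> r ab by (intro mult_mono mult_left_mono) auto
    also have "\<dots> \<le> (lam * h * g) * 1 * (2 / b ^ 3)"
    proof (intro mult_left_mono divide_left_mono)
      show "b ^ 3 \<le> b\<^sup>2" using ab by (intro power_decreasing) auto
    qed (use lam h g ab in auto)
    finally show ?thesis by (simp add: mult_ac)
  qed
  have rest: "lam * \<delta> / a\<^sup>2 * (h * \<epsilon> * R * (2 * C * \<kappa> + h * \<epsilon> * R)) \<le> h * (lam * \<delta> * \<Theta>\<^sup>2 * \<epsilon> * R * (2 * C * \<kappa> + h * \<epsilon> * R))"
  proof -
    have "(1 / a)\<^sup>2 \<le> \<Theta>\<^sup>2" using \<Theta> ab by (intro power_mono) (auto simp: a_def)
    then have t: "1 / a\<^sup>2 \<le> \<Theta>\<^sup>2" by (simp add: power_divide)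
    have "0 \<le> lam * \<delta> * (h * \<epsilon> * R * (2 * C * \<kappa> + h * \<epsilon> * R))" using lam \<delta> h \<epsilon>(1) R C \<kappa> by simp
    from mult_left_mono[OF t this] show ?thesis by (simp add: mult_ac)
  qed
  have "- (h * (lam * \<delta> * \<Theta>\<^sup>2 * \<epsilon> * R * (2 * C * \<kappa> + h * \<epsilon> * R)))
     \<le> lam * ((1 + \<delta> * (norm p1)\<^sup>2) / a\<^sup>2) - lam * ((1 + \<delta> * (norm p0)\<^sup>2) / b\<^sup>2)"
  proof -
    have "lam * \<delta> / a\<^sup>2 * (h * \<epsilon> * R * (2 * C * (g + \<kappa>) + h * \<epsilon> * R))
       = lam * \<delta> / a\<^sup>2 * (h * \<epsilon> * R * (2 * C * g)) + lam * \<delta> / a\<^sup>2 * (h * \<epsilon> * R * (2 * C * \<kappa> + h * \<epsilon> * R))"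
      by (simp only: distrib_left distrib_right mult.assoc add.assoc)
    moreover have "- g' \<le> T1 + T2" if "e = e1 + e2" "f \<le> T1" "- e \<le> T2" "e1 \<le> f" "e2 \<le> g'" for e e1 e2 f g' T1 T2 :: real
      using that by linarith
    ultimately show ?thesis unfolding split using first second good rest by blast
  qed
  then show ?thesis unfolding a_def b_def R_def using h by (simp add: pos_le_divide_eq mult_ac)
qed

text \<open>
  The derivative \<open>v \<bullet> \<nabla>u\<close> solves a linear equation, but \<open>u\<close> has only two space derivatives.  Hence the minimum principle
  is applied to the difference quotient \<open>g\<close> with small step \<open>h\<close>, which is uniformly close to the derivative on compact
  time intervals.  The strict gain \<open>4 r\<^sup>2\<close> in \<open>bump_lap\<close> pays for the errors of the quotient.
\<close>

lemma gradient_lower_bound: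
  "\<exists>\<epsilon>>0. \<forall>x\<in>cball p r. \<forall>t\<in>{t\<^sub>1..<T}. \<epsilon> * exp (- rate * (t - t\<^sub>1)) * bump x \<le> v \<bullet> Du x t"
proof -
  have sub: "cball p r \<subseteq> cball p r\<^sub>1" using r by auto
  have "continuous_on (cball p r) (\<lambda>x. (\<lambda>(x, t). Du x t) (x, t\<^sub>1))"
    by (rule continuous_on_compose2[OF cont_Du]) (use sub t\<^sub>1 in \<open>auto intro!: continuous_on_Pair continuous_on_const continuous_on_id\<close>)
  then have c0: "continuous_on (cball p r) (\<lambda>x. Du x t\<^sub>1)" by simp
  have c1: "continuous_on (cball p r) (\<lambda>x. v \<bullet> Du x t\<^sub>1)" by (intro continuous_intros c0)
  have "cball p r \<noteq> {}" using r by simp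
  from continuous_attains_inf[OF compact_cball this c1] obtain x1 where x1: "x1 \<in> cball p r" "\<And>x. x \<in> cball p r \<Longrightarrow> v \<bullet> Du x1 t\<^sub>1 \<le> v \<bullet> Du x t\<^sub>1"
    by blast
  define \<epsilon>0 where "\<epsilon>0 = v \<bullet> Du x1 t\<^sub>1"
  have \<epsilon>0: "0 < \<epsilon>0" using start[OF x1(1)] by (simp add: \<epsilon>0_def)
  define \<epsilon> where "\<epsilon> = min (\<epsilon>0 / r ^ 4) (1 / (8 * \<delta> * C * r ^ 3 + 1))"
  have pos: "0 < 8 * \<delta> * C * r ^ 3 + 1" using \<delta> C r by (simp add: add_nonneg_pos)
  have \<epsilon>: "0 < \<epsilon>" "\<epsilon> * r ^ 4 \<le> \<epsilon>0" "8 * \<delta> * C * \<epsilon> * r ^ 3 \<le> 1"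
  proof -
    show "0 < \<epsilon>" using \<epsilon>0 r pos by (simp add: \<epsilon>_def)
    have "\<epsilon> \<le> \<epsilon>0 / r ^ 4" by (simp add: \<epsilon>_def)
    then show "\<epsilon> * r ^ 4 \<le> \<epsilon>0" using r by (simp add: pos_le_divide_eq)
    have "\<epsilon> \<le> 1 / (8 * \<delta> * C * r ^ 3 + 1)" by (simp add: \<epsilon>_def)
    then have "\<epsilon> * (8 * \<delta> * C * r ^ 3 + 1) \<le> 1" using pos by (simp only: pos_le_divide_eq)
    then show "8 * \<delta> * C * \<epsilon> * r ^ 3 \<le> 1" using \<open>0 < \<epsilon>\<close> by (simp add: algebra_simps)
  qed
  have rate0: "0 \<le> rate" by (simp add: rate_def)
  define \<epsilon>' where "\<epsilon>' t = \<epsilon> * exp (- rate * (t - t\<^sub>1))" for t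
  have \<epsilon>'_bd: "0 < \<epsilon>' t" "t\<^sub>1 \<le> t \<Longrightarrow> \<epsilon>' t \<le> \<epsilon>" for t using \<epsilon>(1) rate0 by (auto simp: \<epsilon>'_def mult_le_cancel_left1)
  have "\<epsilon>' b * bump xs \<le> v \<bullet> Du xs b" if xs: "xs \<in> cball p r" and b: "b \<in> {t\<^sub>1..<T}" for xs b
  proof (rule ccontr)
    assume "\<not> \<epsilon>' b * bump xs \<le> v \<bullet> Du xs b"
    \<comment> \<open>One third of the assumed gap: adding \<open>\<eta>\<close> compensates the error \<open>\<kappa> \<le> \<eta>\<close> of the difference quotient on the parabolic boundary and
       leaves the value at \<open>(xs, b)\<close> negative.\<close>
    define \<eta> where "\<eta> = (\<epsilon>' b * bump xs - v \<bullet> Du xs b) / 3"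
    have \<eta>: "0 < \<eta>" using \<open>\<not> \<epsilon>' b * bump xs \<le> v \<bullet> Du xs b\<close> by (simp add: \<eta>_def)
    let ?Q = "cball p r\<^sub>1 \<times> {t\<^sub>1..b}"
    have QT: "?Q \<subseteq> cball p r\<^sub>1 \<times> {t\<^sub>1..<T}" using b by auto
    have cQ: "compact ?Q" by (intro compact_Times) auto
    have Qne: "(p, t\<^sub>1) \<in> ?Q" using r b by auto
    note cu = continuous_on_subset[OF cont_u QT] and cDu = continuous_on_subset[OF cont_Du QT]
    obtain zm where zm: "zm \<in> ?Q" "\<And>z. z \<in> ?Q \<Longrightarrow> (\<lambda>(x, t). u x t) z \<le> (\<lambda>(x, t). u x t) zm"
      using continuous_attains_sup[OF cQ _ cu] Qne by blast
    define \<Theta> where "\<Theta> = 1 / (1 - (\<lambda>(x, t). u x t) zm)"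
    have um: "(\<lambda>(x, t). u x t) zm < 1" using zm(1) u01 b by (auto simp: case_prod_beta)
    have \<Theta>: "0 < \<Theta>" "1 / (1 - u x t) \<le> \<Theta>" if "x \<in> cball p r\<^sub>1" "t \<in> {t\<^sub>1..b}" for x t
    proof -
      show "0 < \<Theta>" using um by (simp add: \<Theta>_def)
      have "u x t \<le> (\<lambda>(x, t). u x t) zm" using zm(2)[of "(x, t)"] that by auto
      then show "1 / (1 - u x t) \<le> \<Theta>" unfolding \<Theta>_def using um by (intro divide_left_mono mult_pos_pos) auto
    qed
    have \<Theta>0: "0 < \<Theta>" using um by (simp add: \<Theta>_def)
    have "bounded ((\<lambda>(x, t). Du x t) ` ?Q)" using cDu cQ compact_continuous_image compact_imp_bounded by blast
    then obtain G where G0: "0 < G" "\<forall>y\<in>(\<lambda>(x, t). Du x t) ` ?Q. norm y \<le> G" unfolding bounded_pos by blast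
    have G: "0 < G" "\<And>x t. x \<in> cball p r\<^sub>1 \<Longrightarrow> t \<in> {t\<^sub>1..b} \<Longrightarrow> norm (Du x t) \<le> G"
      using G0 by (blast, force)
    define W where "W = lam * \<delta> * \<Theta>\<^sup>2 * r"
    have W: "0 < W" using lam \<delta> \<Theta>0 r by (simp add: W_def)
    define \<kappa> where "\<kappa> = min \<eta> (1 / (4 * (W * C + 1)))"
    have WC: "0 < W * C + 1" using W C by (simp add: add_nonneg_pos)
    have \<kappa>: "0 < \<kappa>" "\<kappa> \<le> \<eta>" using \<eta> WC by (auto simp: \<kappa>_def)
    have W\<kappa>: "2 * W * C * \<kappa> \<le> 1/2"
    proof -
      have "\<kappa> \<le> 1 / (4 * (W * C + 1))" by (simp add: \<kappa>_def)
      then have "\<kappa> * (4 * (W * C + 1)) \<le> 1" using WC by (simp add: pos_le_divide_eq)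
      then show ?thesis using \<kappa>(1) by (simp add: algebra_simps)
    qed
    have "uniformly_continuous_on ?Q (\<lambda>(x, t). Du x t)" using cDu cQ by (rule compact_uniformly_continuous)
    moreover have nv: "0 < norm v" using v_nonzero by simp
    ultimately obtain d where d: "0 < d" "\<And>z z'. z \<in> ?Q \<Longrightarrow> z' \<in> ?Q \<Longrightarrow> dist z' z < d \<Longrightarrow>
        dist ((\<lambda>(x, t). Du x t) z') ((\<lambda>(x, t). Du x t) z) < \<kappa> / norm v"
      unfolding uniformly_continuous_on_def using divide_pos_pos[OF \<kappa>(1) nv] by meson
    define h where "h = Min {d / (2 * norm v), (r\<^sub>1 - r) / norm v, 2 / (5 * (G * norm v * \<Theta>)), 1 / (16 * W * \<epsilon> * r ^ 3)}"
    have h: "0 < h" "h \<le> d / (2 * norm v)" "h \<le> (r\<^sub>1 - r) / norm v" "h \<le> 2 / (5 * (G * norm v * \<Theta>))" "h \<le> 1 / (16 * W * \<epsilon> * r ^ 3)"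
      using d(1) nv r G(1) \<Theta>0 W \<epsilon>(1) by (auto simp: h_def)
    have h1: "h * norm v < d" "h * norm v \<le> r\<^sub>1 - r" "h * (G * norm v * \<Theta>) \<le> 2/5" "W * h * \<epsilon> * (4 * r ^ 3) \<le> 1/4"
    proof -
      have "h * (2 * norm v) \<le> d" using h(2) nv by (simp add: pos_le_divide_eq)
      then show "h * norm v < d" using d(1) by simp
      show "h * norm v \<le> r\<^sub>1 - r" using h(3) nv by (simp add: pos_le_divide_eq)
      have "0 < 5 * (G * norm v * \<Theta>)" using G nv \<Theta>0 by simp
      then have "h * (5 * (G * norm v * \<Theta>)) \<le> 2" using h(4) by (simp only: pos_le_divide_eq)
      then show "h * (G * norm v * \<Theta>) \<le> 2/5" by simp
      have "0 < 16 * W * \<epsilon> * r ^ 3" using W \<epsilon>(1) r by simp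
      then have "h * (16 * W * \<epsilon> * r ^ 3) \<le> 1" using h(5) by (simp only: pos_le_divide_eq)
      then show "W * h * \<epsilon> * (4 * r ^ 3) \<le> 1/4" by (simp add: mult_ac)
    qed
    have shift: "x + h *\<^sub>R v \<in> cball p r\<^sub>1" if "x \<in> cball p r" for x
      using that h1(2) h(1) norm_triangle_ineq[of "x - p" "h *\<^sub>R v"] by (auto simp: dist_norm norm_minus_commute algebra_simps)
    define g where "g x t = (u (x + h *\<^sub>R v) t - u x t) / h" for x t
    have gm: "\<exists>y. y \<in> cball p r\<^sub>1 \<and> dist y x < d \<and> g x t = v \<bullet> Du y t" if xt: "x \<in> cball p r" "t \<in> {t\<^sub>1..b}" for x t
    proof -
      have tT: "t \<in> {t\<^sub>1..<T}" using xt b by auto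
      obtain \<xi> where \<xi>: "0 < \<xi>" "\<xi> < h" "x + \<xi> *\<^sub>R v \<in> cball p r\<^sub>1"
        "u (x + h *\<^sub>R v) t - u x t = h * (v \<bullet> Du (x + \<xi> *\<^sub>R v) t)"
        using directional_mean_value[where g="\<lambda>y. u y t" and G="\<lambda>y. Du y t", OF has_grad_lap_derivative[OF space[OF _ tT]] _ shift[OF xt(1)] h(1)]
          xt(1) sub by blast
      have "dist (x + \<xi> *\<^sub>R v) x = \<xi> * norm v" using \<xi> by (simp add: dist_norm)
      also have "\<dots> \<le> h * norm v" using \<xi> by (intro mult_right_mono) auto
      finally have "dist (x + \<xi> *\<^sub>R v) x < d" using h1(1) by linarith
      then show ?thesis using \<xi> h(1) by (intro exI[of _ "x + \<xi> *\<^sub>R v"]) (auto simp: g_def)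
    qed
    have g0: "0 \<le> g x t" if xt: "x \<in> cball p r" "t \<in> {t\<^sub>1..b}" for x t
      using gm[OF xt] cone xt b by fastforce
    have gG: "g x t \<le> norm v * G" if xt: "x \<in> cball p r" "t \<in> {t\<^sub>1..b}" for x t
    proof -
      obtain y where y: "y \<in> cball p r\<^sub>1" "g x t = v \<bullet> Du y t" using gm[OF xt] by blast
      have "v \<bullet> Du y t \<le> norm v * norm (Du y t)" by (rule norm_cauchy_schwarz)
      also have "\<dots> \<le> norm v * G" using G(2)[OF y(1) xt(2)] by (intro mult_left_mono) auto
      finally show ?thesis using y by simp
    qed
    have gclose: "\<bar>g x t - v \<bullet> Du x t\<bar> \<le> \<kappa>" if xt: "x \<in> cball p r" "t \<in> {t\<^sub>1..b}" for x t
    proof -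
      obtain y where y: "y \<in> cball p r\<^sub>1" "dist y x < d" "g x t = v \<bullet> Du y t" using gm[OF xt] by blast
      have "dist (y, t) (x, t) < d" using y(2) by (simp add: dist_Pair_Pair)
      then have "norm (Du y t - Du x t) < \<kappa> / norm v" using d(2)[of "(x, t)" "(y, t)"] y xt sub by (auto simp: dist_norm)
      then have "norm v * norm (Du y t - Du x t) \<le> \<kappa>" using nv by (simp add: pos_less_divide_eq mult.commute)
      moreover have "\<bar>v \<bullet> (Du y t - Du x t)\<bar> \<le> norm v * norm (Du y t - Du x t)" by (rule Cauchy_Schwarz_ineq2)
      ultimately show ?thesis using y(3) by (simp add: inner_diff_right)
    qed
    define Z where "Z x t = g x t + (\<eta> - \<epsilon>' t * bump x)" for x t
    have "0 \<le> Z xs b"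
    proof (rule parabolic_minimum_principle[where K="cball p r" and U="ball p r" and a=t\<^sub>1 and b=b and \<Lambda>=0 and Z=Z])
      have "continuous_on (cball p r \<times> {t\<^sub>1..b}) (\<lambda>z. (\<lambda>(x, t). u x t) (fst z + h *\<^sub>R v, snd z))"
        by (rule continuous_on_compose2[OF cu]) (use shift in \<open>auto intro!: continuous_intros\<close>)
      moreover have "continuous_on (cball p r \<times> {t\<^sub>1..b}) (\<lambda>(x, t). u x t)"
        by (rule continuous_on_subset[OF cu]) (use sub in auto)
      ultimately show "continuous_on (cball p r \<times> {t\<^sub>1..b}) (\<lambda>(x, t). Z x t)"
        unfolding Z_def g_def \<epsilon>'_def bump_def using h(1) by (auto intro!: continuous_intros simp: case_prod_beta)
      show "0 \<le> Z x t\<^sub>1" if "x \<in> cball p r" for x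
      proof -
        have "\<epsilon>' t\<^sub>1 * bump x \<le> \<epsilon> * r ^ 4" using bump_bounds[OF that] \<epsilon> by (simp add: \<epsilon>'_def)
        also have "\<dots> \<le> v \<bullet> Du x t\<^sub>1" using \<epsilon>(2) x1(2)[OF that] by (simp add: \<epsilon>0_def)
        finally show ?thesis using gclose[OF that, of t\<^sub>1] \<kappa> b by (auto simp: Z_def)
      qed
      show "0 \<le> Z x t" if "x \<in> cball p r - ball p r" "t \<in> {t\<^sub>1..b}" for x t
      proof -
        have "norm (x - p) = r" using that by (simp add: dist_norm norm_minus_commute)
        then have "bump x = 0" by (simp add: bump_def power2_norm_eq_inner[symmetric])
        then show ?thesis using g0[of x t] that \<eta> by (simp add: Z_def)
      qed
      show "\<exists>zt q l. (Z x has_real_derivative zt) (at t) \<and> has_grad_lap (\<lambda>y. Z y t) q l x \<and> (q = 0 \<longrightarrow> 0 * Z x t < zt - l)"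
        if xt: "x \<in> ball p r" "t\<^sub>1 < t" "t \<le> b" for x t
      proof -
        have x: "x \<in> cball p r" "x \<in> cball p r\<^sub>1" and t: "t \<in> {t\<^sub>1..b}" "t \<in> {t\<^sub>1..<T}" using xt r b by auto
        define y where "y = x + h *\<^sub>R v"
        have y: "y \<in> cball p r\<^sub>1" using shift[OF x(1)] by (simp add: y_def)
        define c where "c = (- 4 * (r\<^sup>2 - (x - p) \<bullet> (x - p))) *\<^sub>R (x - p)"
        obtain l where l: "has_grad_lap bump c l x" "4 * r\<^sup>2 \<le> rate * bump x + l" using bump_lap[of x] unfolding c_def by blast
        have c: "norm c \<le> 4 * r ^ 3" unfolding c_def by (rule bump_bounds(3)[OF x(1)])
        have d1: "(Z x has_real_derivative ((ut y t - ut x t) / h + (0 - (- rate * \<epsilon>' t) * bump x))) (at t)"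
          unfolding Z_def[abs_def] g_def \<epsilon>'_def y_def[symmetric] using time[OF x(2) t(2)] time[OF y t(2)] h(1)
          by (auto intro!: derivative_eq_intros)
        have "has_grad_lap (\<lambda>x. u (x + h *\<^sub>R v) t) (Du y t) (L y t) x"
          unfolding y_def by (rule has_grad_lap_translate) (use space[OF y t(2)] in \<open>simp add: y_def\<close>)
        then have d2: "has_grad_lap (\<lambda>y. Z y t) ((1 / h) *\<^sub>R (Du y t - Du x t) + (0 - \<epsilon>' t *\<^sub>R c)) ((1 / h) * (L y t - L x t) + (0 - \<epsilon>' t * l)) x"
          using has_grad_lap_add[OF has_grad_lap_cmult[OF has_grad_lap_diff[OF _ space[OF x(2) t(2)]], of _ _ _ "1/h"]
              has_grad_lap_diff[OF has_grad_lap_const[of \<eta>] has_grad_lap_cmult[OF l(1), of "\<epsilon>' t"]]]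
          by (simp add: Z_def g_def)
        have "0 < (ut y t - ut x t) / h + (0 - (- rate * \<epsilon>' t) * bump x) - ((1 / h) * (L y t - L x t) + (0 - \<epsilon>' t * l))"
          if "(1 / h) *\<^sub>R (Du y t - Du x t) + (0 - \<epsilon>' t *\<^sub>R c) = 0"
        proof -
          have "Du y t - Du x t = h *\<^sub>R ((1 / h) *\<^sub>R (Du y t - Du x t))" using h(1) by simp
          also have "(1 / h) *\<^sub>R (Du y t - Du x t) = \<epsilon>' t *\<^sub>R c" using that by simp
          finally have pp: "Du y t - Du x t = (h * \<epsilon>' t) *\<^sub>R c" by simp
          have gg: "u y t - u x t = h * g x t" using h(1) by (simp add: g_def y_def)
          have e: "0 < \<epsilon>' t" "\<epsilon>' t \<le> \<epsilon>" using \<epsilon>'_bd[of t] xt by auto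
          have src: "- (lam * \<delta> * \<Theta>\<^sup>2 * \<epsilon>' t * (4 * r ^ 3) * (2 * C * \<kappa> + h * \<epsilon>' t * (4 * r ^ 3)))
             \<le> (lam * ((1 + \<delta> * (norm (Du y t))\<^sup>2) / (1 - u y t)\<^sup>2) - lam * ((1 + \<delta> * (norm (Du x t))\<^sup>2) / (1 - u x t)\<^sup>2)) / h"
          proof (rule quotient_source[OF _ _ _ h(1) _ _ pp c _ less_imp_le[OF \<kappa>(1)]])
            show "0 \<le> u x t" "u y t < 1" using u01 x y t by auto
            show "u x t \<le> u y t" using gg h(1) g0[OF x(1) t(1)] by (metis diff_ge_0_iff_ge less_imp_le mult_nonneg_nonneg)
            show "0 \<le> \<epsilon>' t" using e by simp
            have "8 * \<delta> * C * \<epsilon>' t * r ^ 3 \<le> 8 * \<delta> * C * \<epsilon> * r ^ 3"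
              using e \<delta> C r by (intro mult_right_mono mult_left_mono) auto
            then show "8 * \<delta> * C * \<epsilon>' t * r ^ 3 \<le> 1" using \<epsilon>(3) by linarith
            have "norm (Du x t) \<le> C * (v \<bullet> Du x t)" using cone x t by blast
            also have "\<dots> \<le> C * (g x t + \<kappa>)" using gclose[OF x(1) t(1)] C by (intro mult_left_mono) auto
            finally show "norm (Du x t) \<le> C * ((u y t - u x t) / h + \<kappa>)" using gg h(1) by simp
            show "1 / (1 - u y t) \<le> \<Theta>" using \<Theta> y t by blast
            show "1 - u x t \<le> 7/5 * (1 - u y t)"
            proof -
              have a: "0 < 1 - u y t" using u01[OF y t(2)] by simp
              have "1 \<le> \<Theta> * (1 - u y t)" using \<Theta>(2)[OF y t(1)] a by (simp add: pos_divide_le_eq)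
              then have "(h * g x t) * 1 \<le> (h * g x t) * (\<Theta> * (1 - u y t))"
                using g0[OF x(1) t(1)] h(1) by (intro mult_left_mono) auto
              also have "\<dots> \<le> (h * (norm v * G)) * (\<Theta> * (1 - u y t))"
                using gG[OF x(1) t(1)] h(1) a \<Theta>0 by (intro mult_right_mono mult_left_mono) auto
              also have "\<dots> = (h * (G * norm v * \<Theta>)) * (1 - u y t)" by (simp add: mult_ac)
              also have "\<dots> \<le> 2/5 * (1 - u y t)" using h1(3) a by (intro mult_right_mono) auto
              finally show ?thesis using gg by simp
            qed
          qed
          have "lam * \<delta> * \<Theta>\<^sup>2 * \<epsilon>' t * (4 * r ^ 3) * (2 * C * \<kappa> + h * \<epsilon>' t * (4 * r ^ 3))
             = (\<epsilon>' t * (4 * r\<^sup>2)) * (2 * W * C * \<kappa> + W * h * \<epsilon>' t * (4 * r ^ 3))"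
            by (simp add: W_def power2_eq_square power3_eq_cube algebra_simps)
          also have "\<dots> \<le> (\<epsilon>' t * (4 * r\<^sup>2)) * (1/2 + 1/4)"
          proof (intro mult_left_mono add_mono W\<kappa>)
            have "W * h * \<epsilon>' t * (4 * r ^ 3) \<le> W * h * \<epsilon> * (4 * r ^ 3)"
              using e W h(1) r by (intro mult_right_mono mult_left_mono) auto
            then show "W * h * \<epsilon>' t * (4 * r ^ 3) \<le> 1/4" using h1(4) by linarith
          qed (use e in auto)
          also have "\<dots> < \<epsilon>' t * (4 * r\<^sup>2)" using e r by simp
          also have "\<dots> \<le> \<epsilon>' t * (rate * bump x + l)" using l(2) e by (intro mult_left_mono) auto
          finally have "0 < (lam * ((1 + \<delta> * (norm (Du y t))\<^sup>2) / (1 - u y t)\<^sup>2) - lam * ((1 + \<delta> * (norm (Du x t))\<^sup>2) / (1 - u x t)\<^sup>2)) / h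
             + \<epsilon>' t * (rate * bump x + l)" using src by linarith
          then show ?thesis unfolding eq[OF x(2) t(2), symmetric] eq[OF y t(2), symmetric]
            by (simp add: diff_divide_distrib add_divide_distrib algebra_simps)
        qed
        then show ?thesis using d1 d2 by (intro exI conjI) auto
      qed
    qed (use xs b in auto)
    moreover have "Z xs b < 0"
    proof -
      have "3 * \<eta> = \<epsilon>' b * bump xs - v \<bullet> Du xs b" by (simp add: \<eta>_def)
      moreover have "\<bar>g xs b - v \<bullet> Du xs b\<bar> \<le> \<kappa>" using gclose[OF xs, of b] b by simp
      ultimately show ?thesis unfolding Z_def using \<kappa> \<eta> by linarith
    qed
    ultimately show False by simp
  qed
  then show ?thesis using \<epsilon>(1) unfolding \<epsilon>'_def by blast
qed

theorem bounded_away_from_one: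
  "\<exists>\<kappa>>0. \<forall>x. dist p x < r / 4 \<longrightarrow> (\<forall>t\<in>{t\<^sub>1..<T}. u x t \<le> 1 - \<kappa>)"
proof -
  obtain \<epsilon> where \<epsilon>: "0 < \<epsilon>" "\<And>x t. x \<in> cball p r \<Longrightarrow> t \<in> {t\<^sub>1..<T} \<Longrightarrow> \<epsilon> * exp (- rate * (t - t\<^sub>1)) * bump x \<le> v \<bullet> Du x t"
    using gradient_lower_bound by blast
  have nv: "0 < norm v" using v_nonzero by simp
  define S where "S = r / (4 * norm v)"
  have S: "0 < S" "S * norm v = r / 4" using r nv by (auto simp: S_def)
  define \<epsilon>2 where "\<epsilon>2 = \<epsilon> * exp (- rate * (T - t\<^sub>1)) * (9 / 16 * r ^ 4)"
  have \<epsilon>2: "0 < \<epsilon>2" using \<epsilon>(1) r by (simp add: \<epsilon>2_def)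
  have rate0: "0 \<le> rate" by (simp add: rate_def)
  have "u x t \<le> 1 - S * \<epsilon>2" if x: "dist p x < r / 4" and t: "t \<in> {t\<^sub>1..<T}" for x t
  proof -
    have mem: "x \<in> cball p (r / 2)" "x + S *\<^sub>R v \<in> cball p (r / 2)"
      using x S r norm_triangle_ineq[of "x - p" "S *\<^sub>R v"] by (auto simp: dist_norm norm_minus_commute algebra_simps)
    have sub: "cball p (r / 2) \<subseteq> cball p r\<^sub>1" using r by auto
    have der: "((\<lambda>y. u y t) has_derivative (\<lambda>h. Du y t \<bullet> h)) (at y)" if "y \<in> cball p (r / 2)" for y
      using has_grad_lap_derivative[OF space[of y t]] that sub t by blast
    obtain \<xi> where \<xi>: "x + \<xi> *\<^sub>R v \<in> cball p (r / 2)" "u (x + S *\<^sub>R v) t - u x t = S * (v \<bullet> Du (x + \<xi> *\<^sub>R v) t)"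
      using directional_mean_value[where g="\<lambda>y. u y t" and G="\<lambda>y. Du y t", OF der mem S(1)] by blast
    define y where "y = x + \<xi> *\<^sub>R v"
    have n: "norm (y - p) \<le> r / 2" using \<xi>(1) by (simp add: y_def dist_norm norm_minus_commute)
    have "(norm (y - p))\<^sup>2 \<le> (r / 2)\<^sup>2" using n by (intro power_mono) auto
    moreover have "(r / 2)\<^sup>2 = r\<^sup>2 / 4" by (simp add: power_divide)
    ultimately have X: "3 / 4 * r\<^sup>2 \<le> r\<^sup>2 - (y - p) \<bullet> (y - p)" unfolding power2_norm_eq_inner by linarith
    have "3 / 4 * r\<^sup>2 * (3 / 4 * r\<^sup>2) \<le> bump y" 
      unfolding bump_def using X order_trans[OF _ X, of 0] by (intro mult_mono) auto
    then have bp: "9 / 16 * r ^ 4 \<le> bump y" by (simp add: power2_eq_square power4_eq_xxxx)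
    have "rate * (t - t\<^sub>1) \<le> rate * (T - t\<^sub>1)" using rate0 t by (intro mult_left_mono) auto
    then have "exp (- rate * (T - t\<^sub>1)) \<le> exp (- rate * (t - t\<^sub>1))" by simp
    then have "\<epsilon>2 \<le> \<epsilon> * exp (- rate * (t - t\<^sub>1)) * bump y"
      unfolding \<epsilon>2_def using bp \<epsilon>(1) r by (intro mult_mono mult_left_mono) auto
    also have "\<dots> \<le> v \<bullet> Du y t" using \<epsilon>(2)[of y t] n r t by (auto simp: dist_norm norm_minus_commute)
    finally have "S * \<epsilon>2 \<le> S * (v \<bullet> Du y t)" using S by (intro mult_left_mono) auto
    moreover have "u (x + S *\<^sub>R v) t < 1" using u01[of "x + S *\<^sub>R v" t] mem sub t by auto
    ultimately show ?thesis using \<xi>(2) by (simp add: y_def)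
  qed
  then show ?thesis using S(1) \<epsilon>2 by (intro exI[of _ "S * \<epsilon>2"]) auto
qed

end

section \<open>Quenching points\<close>

text \<open>
  A diagonal argument: the quenching set is an intersection of closures.
\<close>

lemma closed_quenching_set:
  fixes \<Omega> :: "'a::metric_space set"
  shows "closed (quenching_set \<Omega> T u)"
proof -
  define A where "A n = {x\<in>\<Omega>. \<exists>t\<in>{0..<T}. \<bar>t - T\<bar> < 1 / real (Suc n) \<and> \<bar>u x t - 1\<bar> < 1 / real (Suc n)}" for n
  have null: "(\<lambda>n. 1 / real (Suc n)) \<longlonglongrightarrow> 0" using LIMSEQ_inverse_real_of_nat by (simp add: inverse_eq_divide)
  have "quenching_set \<Omega> T u = closure \<Omega> \<inter> (\<Inter>n. closure (A n))"
  proof (intro equalityI subsetI)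
    fix x assume "x \<in> quenching_set \<Omega> T u"
    then obtain xs ts where xs: "x \<in> closure \<Omega>" "\<And>k. xs k \<in> \<Omega>" "\<And>k. ts k \<in> {0..<T}" "xs \<longlonglongrightarrow> x" "ts \<longlonglongrightarrow> T"
      "(\<lambda>k. u (xs k) (ts k)) \<longlonglongrightarrow> 1" unfolding quenching_set_def by blast
    have "x \<in> closure (A n)" for n
    proof -
      have p: "0 < 1 / real (Suc n)" by simp
      have "eventually (\<lambda>k. dist (ts k) T < 1 / real (Suc n)) sequentially"
        "eventually (\<lambda>k. dist (u (xs k) (ts k)) 1 < 1 / real (Suc n)) sequentially"
        using tendstoD[OF xs(5) p] tendstoD[OF xs(6) p] by auto
      then have "eventually (\<lambda>k. xs k \<in> closure (A n)) sequentially"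
      proof eventually_elim
        case (elim k)
        then have "xs k \<in> A n" using xs(2,3)[of k] unfolding A_def dist_real_def by blast
        then show ?case using closure_subset by blast
      qed
      then show ?thesis using Lim_in_closed_set[OF closed_closure _ _ xs(4)] by auto
    qed
    then show "x \<in> closure \<Omega> \<inter> (\<Inter>n. closure (A n))" using xs(1) by blast
  next
    fix x assume x: "x \<in> closure \<Omega> \<inter> (\<Inter>n. closure (A n))"
    have "\<exists>y t. y \<in> \<Omega> \<and> t \<in> {0..<T} \<and> dist y x < 1 / real (Suc n) \<and> \<bar>t - T\<bar> < 1 / real (Suc n) \<and> \<bar>u y t - 1\<bar> < 1 / real (Suc n)" for n
    proof -
      have "x \<in> closure (A n)" using x by blast
      then obtain y where "y \<in> A n" "dist y x < 1 / real (Suc n)"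
        unfolding closure_approachable by (meson of_nat_0_less_iff zero_less_Suc zero_less_divide_1_iff)
      then show ?thesis unfolding A_def by blast
    qed
    then obtain xs ts where xs: "\<And>n. xs n \<in> \<Omega>" "\<And>n. ts n \<in> {0..<T}" "\<And>n. dist (xs n) x < 1 / real (Suc n)"
      "\<And>n. \<bar>ts n - T\<bar> < 1 / real (Suc n)" "\<And>n. \<bar>u (xs n) (ts n) - 1\<bar> < 1 / real (Suc n)" by metis
    have "xs \<longlonglongrightarrow> x"
      unfolding tendsto_dist_iff[of xs] by (rule real_tendsto_sandwich[OF _ _ tendsto_const null])
        (use xs(3) in \<open>auto intro!: always_eventually less_imp_le\<close>)
    moreover have "ts \<longlonglongrightarrow> T"
      unfolding tendsto_dist_iff[of ts] dist_real_def by (rule real_tendsto_sandwich[OF _ _ tendsto_const null])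
        (use xs(4) in \<open>auto intro!: always_eventually less_imp_le\<close>)
    moreover have "(\<lambda>n. u (xs n) (ts n)) \<longlonglongrightarrow> 1"
      unfolding tendsto_dist_iff[of "\<lambda>n. u (xs n) (ts n)"] dist_real_def
      by (rule real_tendsto_sandwich[OF _ _ tendsto_const null])
        (use xs(5) in \<open>auto intro!: always_eventually less_imp_le\<close>)
    ultimately show "x \<in> quenching_set \<Omega> T u" unfolding quenching_set_def using x xs(1,2) by blast
  qed
  then show ?thesis by (simp add: closed_INT closed_Int)
qed

text \<open>
  As \<open>\<Phi>'' / \<Phi>' = k / (1 - s)\<^sup>2\<close> is the coefficient of the squared gradient in the equation, composing a
  solution with \<open>\<Phi>\<close> removes the gradient term.
\<close>

lemma Cole_Hopf_primitive_exists:
  fixes k :: real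
  assumes k: "0 < k"
  obtains \<Phi> :: "real \<Rightarrow> real" where "\<And>s. s \<in> {-1<..<1} \<Longrightarrow> (\<Phi> has_real_derivative exp (k / (1 - s))) (at s)" "\<Phi> 0 = 0"
proof -
  define E where "E s = exp (k / (1 - s))" for s
  define \<Phi> where "\<Phi> s = integral {-1..s} E - integral {-1..0} E" for s
  have "(\<Phi> has_real_derivative E s) (at s)" if s: "s \<in> {-1<..<1}" for s
  proof -
    define b where "b = (1 + s) / 2"
    have b: "s < b" "b < 1" using s by (auto simp: b_def)
    have "continuous_on {-1..b} E" unfolding E_def using b by (intro continuous_intros) auto
    then have "((\<lambda>x. integral {-1..x} E) has_real_derivative E s) (at s within {-1..b})"
      by (rule integral_has_real_derivative) (use s b in auto)
    moreover have "at s within {-1..b} = at s" by (rule at_within_interior) (use s b in auto)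
    ultimately show ?thesis unfolding \<Phi>_def[abs_def] by (auto intro!: derivative_eq_intros)
  qed
  moreover have "\<Phi> 0 = 0" by (simp add: \<Phi>_def)
  ultimately show ?thesis using that unfolding E_def by blast
qed

lemma derivative_nonneg_if_increasing_right:
  fixes f :: "real \<Rightarrow> real"
  assumes d: "(f has_real_derivative D) (at 0)" and t: "0 < \<tau>\<^sub>0" and le: "\<And>\<tau>. 0 < \<tau> \<Longrightarrow> \<tau> < \<tau>\<^sub>0 \<Longrightarrow> f 0 \<le> f \<tau>"
  shows "0 \<le> D"
proof (rule ccontr)
  assume "\<not> 0 \<le> D"
  then obtain d where d: "0 < d" "\<And>h. 0 < h \<Longrightarrow> h < d \<Longrightarrow> f (0 + h) < f 0"
    using DERIV_neg_dec_right[OF d] by auto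
  define h where "h = min d \<tau>\<^sub>0 / 2"
  have "0 < h" "h < d" "h < \<tau>\<^sub>0" using d(1) t by (auto simp: h_def min_def)
  then show False using d(2)[of h] le[of h] by simp
qed

lemma symmetric_difference_derivative:
  assumes "has_grad_lap g p l x"
  shows "((\<lambda>\<tau>. g (x + \<tau> *\<^sub>R v) - g (x - \<tau> *\<^sub>R v)) has_real_derivative 2 * (v \<bullet> p)) (at 0)"
proof -
  have d: "(g has_derivative (\<lambda>h. p \<bullet> h)) (at (x + 0 *\<^sub>R v))" "(g has_derivative (\<lambda>h. p \<bullet> h)) (at (x - 0 *\<^sub>R v))"
    using has_grad_lap_derivative[OF assms] by auto
  have 1: "((\<lambda>\<tau>. x + \<tau> *\<^sub>R v) has_derivative (\<lambda>h. h *\<^sub>R v)) (at 0)" "((\<lambda>\<tau>. x - \<tau> *\<^sub>R v) has_derivative (\<lambda>h. - (h *\<^sub>R v))) (at 0)"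
    by (auto intro!: derivative_eq_intros)
  have "((\<lambda>\<tau>. g (x + \<tau> *\<^sub>R v) - g (x - \<tau> *\<^sub>R v)) has_derivative (\<lambda>h. p \<bullet> (h *\<^sub>R v) - p \<bullet> (- (h *\<^sub>R v)))) (at 0)"
    by (intro has_derivative_diff has_derivative_compose[OF 1(1) d(1)] has_derivative_compose[OF 1(2) d(2)])
  moreover have "(\<lambda>h. p \<bullet> (h *\<^sub>R v) - p \<bullet> (- (h *\<^sub>R v))) = (\<lambda>h. 2 * (v \<bullet> p) * h)"
    by (auto simp: inner_commute)
  ultimately show ?thesis unfolding has_field_derivative_def by simp
qed

lemma has_grad_lap_matrix:
  fixes D2 :: "real^'n^'n"
  assumes "open S" "x \<in> S" and g: "\<And>y. y \<in> S \<Longrightarrow> GDERIV g y :> Dg y" and D2: "(Dg has_derivative (\<lambda>h. D2 *v h)) (at x)"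
  shows "has_grad_lap g (Dg x) (\<Sum>i\<in>UNIV. D2 $ i $ i) x"
proof (rule has_grad_lapI[OF _ D2 refl])
  have "\<forall>\<^sub>F y in nhds x. y \<in> S" using assms(1,2) by (rule eventually_nhds_in_open)
  then show "\<forall>\<^sub>F y in nhds x. (g has_derivative (\<lambda>h. Dg y \<bullet> h)) (at y)"
    by eventually_elim (use g in \<open>simp add: gderiv_def inner_commute\<close>)
  have B: "(Basis :: (real^'n) set) = range (\<lambda>i. axis i 1)" by (auto simp: Basis_vec_def)
  have inj: "inj (\<lambda>i. axis i 1 :: real^'n)" by (auto simp: inj_on_def axis_eq_axis)
  show "(\<Sum>b\<in>Basis. (D2 *v b) \<bullet> b) = (\<Sum>i\<in>UNIV. D2 $ i $ i)"
    unfolding B sum.reindex[OF inj] by (simp add: inner_axis matrix_vector_mult_basis column_def)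
qed

locale quenching_problem =
  fixes \<Omega> :: "'a::euclidean_space set" and lam \<delta> T :: real and u ut L :: "'a \<Rightarrow> real \<Rightarrow> real" and Du :: "'a \<Rightarrow> real \<Rightarrow> 'a"
  assumes lam: "0 < lam" and \<delta>: "0 < \<delta>" and T: "0 < T"
    and dom: "open \<Omega>" "bounded \<Omega>" "convex \<Omega>"
    and u_cont: "continuous_on (closure \<Omega> \<times> {0..<T}) (\<lambda>(x, t). u x t)"
    and Du_cont: "continuous_on (\<Omega> \<times> {0..<T}) (\<lambda>(x, t). Du x t)"
    and space: "\<And>x t. x \<in> \<Omega> \<Longrightarrow> t \<in> {0..<T} \<Longrightarrow> has_grad_lap (\<lambda>y. u y t) (Du x t) (L x t) x"
    and time: "\<And>x t. x \<in> \<Omega> \<Longrightarrow> t \<in> {0<..<T} \<Longrightarrow> (u x has_real_derivative ut x t) (at t)"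
    and eq: "\<And>x t. x \<in> \<Omega> \<Longrightarrow> t \<in> {0<..<T} \<Longrightarrow> ut x t - L x t = lam * ((1 + \<delta> * (norm (Du x t))\<^sup>2) / (1 - u x t)\<^sup>2)"
    and u_less: "\<And>x t. x \<in> \<Omega> \<Longrightarrow> t \<in> {0..<T} \<Longrightarrow> u x t < 1"
    and u_bdry: "\<And>x t. x \<in> frontier \<Omega> \<Longrightarrow> t \<in> {0..<T} \<Longrightarrow> u x t = 0"
    and u_init: "\<And>x. x \<in> \<Omega> \<Longrightarrow> u x 0 = 0"
begin

lemma closure_cases: "x \<in> closure \<Omega> \<Longrightarrow> x \<in> \<Omega> \<or> x \<in> frontier \<Omega>"
  using dom by (auto simp: frontier_def interior_open)

lemma u_init_closure: "x \<in> closure \<Omega> \<Longrightarrow> u x 0 = 0"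
  using closure_cases u_init u_bdry T by fastforce

lemma u_nonneg:
  assumes "x \<in> closure \<Omega>" "t \<in> {0..<T}" shows "0 \<le> u x t"
proof (rule parabolic_minimum_principle[where K="closure \<Omega>" and U=\<Omega> and a=0 and b=t and \<Lambda>=0 and Z=u])
  show "compact (closure \<Omega>)" using dom by (simp add: compact_closure)
  show "continuous_on (closure \<Omega> \<times> {0..t}) (\<lambda>(x, t). u x t)"
    by (rule continuous_on_subset[OF u_cont]) (use assms in auto)
  show "0 \<le> u x 0" if "x \<in> closure \<Omega>" for x using u_init_closure[OF that] by simp
  show "0 \<le> u x s" if "x \<in> closure \<Omega> - \<Omega>" "s \<in> {0..t}" for x s
    using closure_cases[of x] u_bdry[of x s] that assms by auto
  show "\<exists>zt p l. (u x has_real_derivative zt) (at s) \<and> has_grad_lap (\<lambda>y. u y s) p l x \<and> (p = 0 \<longrightarrow> 0 * u x s < zt - l)"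
    if x: "x \<in> \<Omega>" and s: "0 < s" "s \<le> t" for x s
  proof -
    have s': "s \<in> {0..<T}" "s \<in> {0<..<T}" using s assms by auto
    have "0 < 1 + \<delta> * (norm (Du x s))\<^sup>2" using \<delta> by (simp add: add_pos_nonneg)
    then have "0 < lam * ((1 + \<delta> * (norm (Du x s))\<^sup>2) / (1 - u x s)\<^sup>2)"
      using lam u_less[OF x s'(1)] by (intro mult_pos_pos divide_pos_pos) auto
    then show ?thesis using space[OF x s'(1)] time[OF x s'(2)] eq[OF x s'(2)] by (intro exI conjI) auto
  qed
qed (use assms dom closure_subset in auto)

lemma u_range: "x \<in> closure \<Omega> \<Longrightarrow> t \<in> {0..<T} \<Longrightarrow> u x t \<in> {0..<1}"
  using closure_cases u_less u_nonneg u_bdry by fastforce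

text \<open>
  The primitive \<open>\<Phi>\<close> dominates \<open>- k ln (1 - s)\<close> and is therefore unbounded, so that bounds on \<open>w\<close> and bounds of \<open>u\<close>
  away from 1 are equivalent.
\<close>

theorem quenching_set_avoids_frontier: "quenching_set \<Omega> T u \<inter> frontier \<Omega> = {}"
proof (rule ccontr)
  assume "quenching_set \<Omega> T u \<inter> frontier \<Omega> \<noteq> {}"
  then obtain xq xs ts where q: "xq \<in> frontier \<Omega>" "\<And>k::nat. xs k \<in> \<Omega>" "\<And>k. ts k \<in> {0..<T}" "xs \<longlonglongrightarrow> xq"
      "(\<lambda>k. u (xs k) (ts k)) \<longlonglongrightarrow> 1" unfolding quenching_set_def by blast
  define k where "k = lam * \<delta>"
  have k: "0 < k" using lam \<delta> by (simp add: k_def)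
  obtain \<Phi> where \<Phi>: "\<And>s. s \<in> {-1<..<1} \<Longrightarrow> (\<Phi> has_real_derivative exp (k / (1 - s))) (at s)" "\<Phi> 0 = 0"
    using Cole_Hopf_primitive_exists[OF k] by blast
  define h where "h s = lam * exp (k / (1 - s)) / (1 - s)\<^sup>2" for s
  have \<Phi>_less: "\<Phi> a < \<Phi> b" if "0 \<le> a" "a < b" "b < 1" for a b
  proof (rule DERIV_pos_imp_increasing[OF that(2)])
    show "\<exists>y. (\<Phi> has_real_derivative y) (at x) \<and> 0 < y" if "a \<le> x" "x \<le> b" for x
      using \<Phi>(1)[of x] that \<open>0 \<le> a\<close> \<open>b < 1\<close> by (intro exI[of _ "exp (k / (1 - x))"]) auto
  qed
  have \<Phi>_le: "\<Phi> a \<le> \<Phi> b \<longleftrightarrow> a \<le> b" if "a \<in> {0..<1}" "b \<in> {0..<1}" for a b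
    using \<Phi>_less[of a b] \<Phi>_less[of b a] that by (cases a b rule: linorder_cases) auto
  have \<Phi>_log: "- k * ln (1 - s) \<le> \<Phi> s" if s: "s \<in> {0..<1}" for s
  proof -
    have "\<Phi> 0 + k * ln (1 - 0) \<le> \<Phi> s + k * ln (1 - s)"
    proof (rule DERIV_nonneg_imp_nondecreasing[of 0 s "\<lambda>s. \<Phi> s + k * ln (1 - s)"])
      show "\<exists>y. ((\<lambda>s. \<Phi> s + k * ln (1 - s)) has_real_derivative y) (at x) \<and> 0 \<le> y" if "0 \<le> x" "x \<le> s" for x
      proof (intro exI conjI)
        show "((\<lambda>s. \<Phi> s + k * ln (1 - s)) has_real_derivative (exp (k / (1 - x)) - k / (1 - x))) (at x)"
          using \<Phi>(1)[of x] that s by (auto intro!: derivative_eq_intros)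
        show "0 \<le> exp (k / (1 - x)) - k / (1 - x)" using exp_ge_add_one_self[of "k / (1 - x)"] by linarith
      qed
    qed (use s in auto)
    then show ?thesis using \<Phi>(2) by simp
  qed
  define w where "w x t = \<Phi> (u x t)" for x t
  have below: "u x t \<le> 1 - exp (- M / k)" if "x \<in> closure \<Omega>" "t \<in> {0..<T}" "w x t \<le> M" for x t M
  proof -
    have u: "u x t \<in> {0..<1}" by (rule u_range[OF that(1,2)])
    have "- k * ln (1 - u x t) \<le> M" using \<Phi>_log[OF u] that(3) by (simp add: w_def)
    then have "- M / k \<le> ln (1 - u x t)" using k by (simp add: field_simps)
    then have "exp (- M / k) \<le> exp (ln (1 - u x t))" by (simp only: exp_le_cancel_iff)
    moreover have "exp (ln (1 - u x t)) = 1 - u x t" using u by simp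
    ultimately show ?thesis by linarith
  qed
  have wgl: "has_grad_lap (\<lambda>y. w y t) (exp (k / (1 - u x t)) *\<^sub>R Du x t)
      (exp (k / (1 - u x t)) * L x t + exp (k / (1 - u x t)) * (k / (1 - u x t)\<^sup>2) * (Du x t \<bullet> Du x t)) x"
    if x: "x \<in> \<Omega>" "t \<in> {0..<T}" for x t
    unfolding w_def
  proof (rule has_grad_lap_compose[OF space[OF x]])
    have u: "u x t \<in> {-1<..<1}" using u_range[OF _ x(2), of x] x(1) closure_subset by fastforce
    then have "\<forall>\<^sub>F s in nhds (u x t). s \<in> {-1<..<1}" by (intro eventually_nhds_in_open) auto
    then show "\<forall>\<^sub>F s in nhds (u x t). (\<Phi> has_real_derivative exp (k / (1 - s))) (at s)"
      by eventually_elim (rule \<Phi>(1))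
    show "((\<lambda>s. exp (k / (1 - s))) has_real_derivative exp (k / (1 - u x t)) * (k / (1 - u x t)\<^sup>2)) (at (u x t))"
      using u by (auto intro!: derivative_eq_intros simp: power2_eq_square)
  qed
  have h_mono: "h a \<le> h b" if "0 \<le> a" "a \<le> b" "b < 1" for a b
  proof -
    have 1: "exp (k / (1 - a)) \<le> exp (k / (1 - b))" using that k by (simp add: frac_le)
    have 2: "1 / (1 - a)\<^sup>2 \<le> 1 / (1 - b)\<^sup>2" using that by (intro divide_left_mono power_mono mult_pos_pos) auto
    have "lam * (exp (k / (1 - a)) * (1 / (1 - a)\<^sup>2)) \<le> lam * (exp (k / (1 - b)) * (1 / (1 - b)\<^sup>2))"
      using 1 2 lam by (intro mult_left_mono mult_mono) auto
    then show ?thesis by (simp add: h_def)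
  qed
  have rh: "reaction_heat \<Omega> T lam w (\<lambda>x t. h (u x t))"
  proof unfold_locales
    show "continuous_on (closure \<Omega> \<times> {0..<T}) (\<lambda>(x, t). w x t)"
    proof -
      have "continuous_on {0..<1} \<Phi>"
      proof (rule DERIV_continuous_on)
        show "(\<Phi> has_real_derivative exp (k / (1 - s))) (at s within {0..<1})" if "s \<in> {0..<1}" for s
          by (rule has_field_derivative_at_within, rule \<Phi>(1)) (use that in auto)
      qed
      then have "continuous_on (closure \<Omega> \<times> {0..<T}) (\<lambda>z. \<Phi> ((\<lambda>(x, t). u x t) z))"
        by (rule continuous_on_compose2[OF _ u_cont]) (use u_range in fastforce)
      then show ?thesis by (simp add: w_def case_prod_beta)
    qed
    show "0 \<le> w x t" if "x \<in> closure \<Omega>" "t \<in> {0..<T}" for x t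
      using \<Phi>_le[of 0 "u x t"] u_range[OF that] \<Phi>(2) by (simp add: w_def)
    show "w x 0 = 0" if "x \<in> closure \<Omega>" for x using u_init_closure[OF that] \<Phi>(2) by (simp add: w_def)
    show "w x t = 0" if "x \<in> frontier \<Omega>" "t \<in> {0..<T}" for x t using u_bdry[OF that] \<Phi>(2) by (simp add: w_def)
    show "\<exists>wt p l. (w x has_real_derivative wt) (at t) \<and> has_grad_lap (\<lambda>y. w y t) p l x \<and> wt - l = h (u x t)"
      if x: "x \<in> \<Omega>" "t \<in> {0<..<T}" for x t
    proof (intro exI conjI)
      have t: "t \<in> {0..<T}" using x by auto
      have u: "u x t \<in> {0..<1}" using u_range[OF _ t, of x] x(1) closure_subset by blast
      show "(w x has_real_derivative exp (k / (1 - u x t)) * ut x t) (at t)"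
        unfolding w_def[abs_def] using DERIV_chain2[OF \<Phi>(1) time[OF x]] u by auto
      show "has_grad_lap (\<lambda>y. w y t) (exp (k / (1 - u x t)) *\<^sub>R Du x t)
        (exp (k / (1 - u x t)) * L x t + exp (k / (1 - u x t)) * (k / (1 - u x t)\<^sup>2) * (Du x t \<bullet> Du x t)) x"
        by (rule wgl[OF x(1) t])
      have "ut x t = L x t + lam * ((1 + \<delta> * (norm (Du x t))\<^sup>2) / (1 - u x t)\<^sup>2)" using eq[OF x] by simp
      then show "exp (k / (1 - u x t)) * ut x t -
        (exp (k / (1 - u x t)) * L x t + exp (k / (1 - u x t)) * (k / (1 - u x t)\<^sup>2) * (Du x t \<bullet> Du x t)) = h (u x t)"
        by (simp add: h_def k_def power2_norm_eq_inner algebra_simps add_divide_distrib)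
    qed
    show "lam \<le> h (u x t)" if "x \<in> \<Omega>" "t \<in> {0<..<T}" for x t
    proof -
      have u: "u x t \<in> {0..<1}" using u_range[of x t] that closure_subset[of \<Omega>] by auto
      have "h 0 \<le> h (u x t)" using u by (intro h_mono) auto
      moreover have "lam \<le> h 0" using lam k by (simp add: h_def)
      ultimately show ?thesis by linarith
    qed
    show "h (u x t) \<le> h (u y t)" if "x \<in> \<Omega>" "y \<in> \<Omega>" "t \<in> {0<..<T}" "w x t \<le> w y t" for x y t
      using u_range[of x t] u_range[of y t] that closure_subset[of \<Omega>] \<Phi>_le by (intro h_mono) (auto simp: w_def)
    show "\<exists>K\<ge>0. \<forall>t\<in>{0<..<T}. \<forall>x\<in>\<Omega>. \<forall>y\<in>\<Omega>. w y t \<le> w x t \<longrightarrow> w x t \<le> M \<longrightarrow> h (u x t) - h (u y t) \<le> K * (w x t - w y t)" for M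
    proof -
      define \<theta> where "\<theta> = exp (M / k)"
      define K where "K = lam * (k * \<theta> ^ 4 + 2 * \<theta> ^ 3)"
      have K: "0 \<le> K" using lam k by (simp add: K_def \<theta>_def)
      have "h (u x t) - h (u y t) \<le> K * (w x t - w y t)"
        if "t \<in> {0<..<T}" "x \<in> \<Omega>" "y \<in> \<Omega>" "w y t \<le> w x t" "w x t \<le> M" for x y t
      proof -
        have xc: "x \<in> closure \<Omega>" "y \<in> closure \<Omega>" "t \<in> {0..<T}" using that closure_subset by auto
        have uy: "u y t \<in> {0..<1}" "u x t \<in> {0..<1}" using u_range xc by auto
        then have le: "u y t \<le> u x t" using \<Phi>_le that(4) by (simp add: w_def)
        have ux: "u x t \<le> 1 - exp (- M / k)" by (rule below[OF xc(1,3) that(5)])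
        have "K * \<Phi> (u y t) - h (u y t) \<le> K * \<Phi> (u x t) - h (u x t)"
        proof (rule DERIV_nonneg_imp_nondecreasing[OF le, of "\<lambda>s. K * \<Phi> s - h s"])
          fix s assume s: "u y t \<le> s" "s \<le> u x t"
          then have s1: "s \<in> {-1<..<1}" "0 \<le> s" "s < 1" "exp (- M / k) \<le> 1 - s" using uy ux by auto
          define z where "z = 1 / (1 - s)"
          have "z \<le> 1 / exp (- M / k)" unfolding z_def using s1 by (intro divide_left_mono mult_pos_pos) auto
          then have z: "0 \<le> z" "z \<le> \<theta>" using s1 by (auto simp: z_def \<theta>_def exp_minus field_simps)
          define dh where "dh = exp (k / (1 - s)) * (lam * (k * z ^ 4 + 2 * z ^ 3))"
          have dz: "((\<lambda>s. 1 / (1 - s)) has_real_derivative z\<^sup>2) (at s)"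
            using s1(3) by (auto intro!: derivative_eq_intros simp: z_def power2_eq_square)
          have dx: "((\<lambda>x. lam * exp (k * x) * x\<^sup>2) has_real_derivative lam * exp (k * z) * (k * z\<^sup>2 + 2 * z)) (at z)"
            by (auto intro!: derivative_eq_intros simp: algebra_simps)
          have hz: "h s = lam * exp (k * (1 / (1 - s))) * (1 / (1 - s))\<^sup>2" for s by (simp add: h_def power_divide)
          have "(h has_real_derivative (lam * exp (k * z) * (k * z\<^sup>2 + 2 * z) * z\<^sup>2)) (at s)"
            unfolding hz[abs_def] by (rule DERIV_chain2[OF _ dz]) (use dx in \<open>simp add: z_def\<close>)
          moreover have "lam * exp (k * z) * (k * z\<^sup>2 + 2 * z) * z\<^sup>2 = dh"
            unfolding dh_def by (simp add: z_def power2_eq_square power3_eq_cube power4_eq_xxxx algebra_simps)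
          ultimately have "(h has_real_derivative dh) (at s)" by simp
          then have d: "((\<lambda>s. K * \<Phi> s - h s) has_real_derivative (K * exp (k / (1 - s)) - dh)) (at s)"
            using \<Phi>(1)[OF s1(1)] by (auto intro!: derivative_eq_intros)
          have "lam * (k * z ^ 4 + 2 * z ^ 3) \<le> K"
            unfolding K_def using z lam k by (intro mult_left_mono add_mono power_mono) auto
          then have "dh \<le> exp (k / (1 - s)) * K" unfolding dh_def by (intro mult_left_mono) auto
          then show "\<exists>y. ((\<lambda>s. K * \<Phi> s - h s) has_real_derivative y) (at s) \<and> 0 \<le> y"
            using d by (intro exI[of _ "K * exp (k / (1 - s)) - dh"]) (simp add: mult.commute)
        qed
        then show ?thesis by (simp add: w_def algebra_simps)
      qed
      then show ?thesis using K by blast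
    qed
  qed (use dom T lam in auto)
  interpret rh: reaction_heat \<Omega> T lam w "\<lambda>x t. h (u x t)" by (rule rh)
  have "\<not> rh.bounded_near xq"
  proof
    assume "rh.bounded_near xq"
    then obtain d M where d: "0 < d" "\<And>y t. y \<in> \<Omega> \<Longrightarrow> t \<in> {0..<T} \<Longrightarrow> dist xq y < d \<Longrightarrow> w y t \<le> M"
      unfolding rh.bounded_near_def by blast
    have "\<forall>\<^sub>F k in sequentially. dist (xs k) xq < d" using tendstoD[OF q(4) d(1)] .
    then have "\<forall>\<^sub>F n in sequentially. u (xs n) (ts n) \<le> 1 - exp (- M / k)"
    proof eventually_elim
      case (elim n)
      then have "w (xs n) (ts n) \<le> M" using d(2)[OF q(2,3)] by (simp add: dist_commute)
      then show ?case using below[OF _ q(3)] q(2) closure_subset by blast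
    qed
    then have "1 \<le> 1 - exp (- M / k)" by (rule tendsto_upperbound[OF q(5)]) simp
    then show False using exp_gt_zero[of "- M / k"] by linarith
  qed
  then have "rh.singular_bdry \<noteq> {}" using q(1) unfolding rh.singular_bdry_def by blast
  from rh.reflections_at_singular_bdry[OF this]
  obtain x0 v \<omega>0 m1 r t1 where x0: "x0 \<in> rh.singular_bdry" and pos: "0 < \<omega>0" "0 < m1" "0 < r" "0 < t1" "t1 < T"
    and seg0: "\<forall>s. 0 < s \<and> s \<le> 1 \<longrightarrow> x0 + s *\<^sub>R v \<in> \<Omega>"
    and reflect0: "\<forall>v' c x t. norm (v' - v) \<le> \<omega>0 \<longrightarrow> c - v' \<bullet> x0 \<le> m1 \<longrightarrow> x \<in> \<Omega> \<longrightarrow> dist x0 x < r \<longrightarrow> v' \<bullet> x \<le> c \<longrightarrow>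
        t1 \<le> t \<longrightarrow> t < T \<longrightarrow> mirror (sgn v') (c / norm v') x \<in> \<Omega> \<and> w x t \<le> w (mirror (sgn v') (c / norm v') x) t"
    and strict0: "\<forall>x\<in>\<Omega>. dist x0 x < r \<longrightarrow> v \<bullet> (x - x0) < m1 \<longrightarrow>
        (\<exists>k>0. \<exists>\<tau>\<^sub>0>0. \<forall>\<tau>. 0 < \<tau> \<longrightarrow> \<tau> < \<tau>\<^sub>0 \<longrightarrow> k * \<tau> \<le> w (x + \<tau> *\<^sub>R v) t1 - w (x - \<tau> *\<^sub>R v) t1)"
    by (elim bexE exE conjE) (rule that)
  note seg = seg0[rule_format, OF conjI] and reflect = reflect0[rule_format] and strict = strict0[rule_format]
  have x0f: "x0 \<in> frontier \<Omega>" "\<not> rh.bounded_near x0" using x0 by (auto simp: rh.singular_bdry_def)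
  have "x0 \<notin> \<Omega>" using x0f dom by (auto simp: frontier_def interior_open)
  then have "v \<noteq> 0" using seg[of 1] by auto
  then have nv: "0 < norm v" by simp
  define V where "V = norm v + \<omega>0"
  have V: "0 < V" "norm v \<le> V" using nv pos(1) unfolding V_def by linarith+
  \<comment> \<open>Small enough for all planes through a neighbourhood of \<open>p\<close> to have admissible levels.\<close>
  define s where "s = min 1 (min (r / (4 * V)) (m1 / (4 * V\<^sup>2)))"
  have s: "0 < s" "s \<le> 1" "s \<le> r / (4 * V)" "s \<le> m1 / (4 * V\<^sup>2)"
    using V(1) pos(2,3) by (auto simp: s_def)
  have sV: "4 * (s * V) \<le> r" "4 * (s * V\<^sup>2) \<le> m1"
  proof -
    have "0 < 4 * V" "0 < 4 * V\<^sup>2" using V(1) by auto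
    then have "s * (4 * V) \<le> r" "s * (4 * V\<^sup>2) \<le> m1" using s(3,4) by (simp_all only: pos_le_divide_eq)
    then show "4 * (s * V) \<le> r" "4 * (s * V\<^sup>2) \<le> m1" by linarith+
  qed
  define p where "p = x0 + s *\<^sub>R v"
  have pO: "p \<in> \<Omega>" using seg[OF s(1,2)] by (simp add: p_def)
  obtain \<rho>0 where \<rho>0: "0 < \<rho>0" "ball p \<rho>0 \<subseteq> \<Omega>" using pO dom(1) open_contains_ball by blast
  define \<rho> where "\<rho> = min \<rho>0 (s * V)"
  have \<rho>: "0 < \<rho>" "\<rho> \<le> s * V" "ball p \<rho> \<subseteq> \<Omega>" using \<rho>0 s V by (auto simp: \<rho>_def)
  have near: "dist x0 x < r \<and> v' \<bullet> (x - x0) < m1" if "x \<in> ball p \<rho>" "norm (v' - v) \<le> \<omega>0" for x v'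
  proof -
    have "norm (x - x0) \<le> norm (x - p) + norm (p - x0)" using norm_triangle_ineq[of "x - p" "p - x0"] by simp
    also have "norm (p - x0) = s * norm v" using s by (simp add: p_def)
    finally have "norm (x - x0) < s * V + s * norm v" using that \<rho>(2) by (simp add: dist_norm norm_minus_commute)
    moreover have "s * norm v \<le> s * V" using V s by (intro mult_left_mono) auto
    ultimately have n: "norm (x - x0) < 2 * (s * V)" by linarith
    have "0 < s * V" using s V by simp
    then have 1: "norm (x - x0) < r" using n sV(1) by linarith
    have "norm v' \<le> V" using norm_triangle_ineq2[of v' v] that(2) by (simp add: V_def)
    have "v' \<bullet> (x - x0) \<le> norm v' * norm (x - x0)" by (rule norm_cauchy_schwarz)
    also have "\<dots> \<le> V * (2 * (s * V))" using n \<open>norm v' \<le> V\<close> V by (intro mult_mono) auto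
    also have "\<dots> = 2 * (s * V\<^sup>2)" by (simp add: power2_eq_square)
    also have "\<dots> < m1" using sV(2) pos(2) by linarith
    finally show ?thesis using 1 by (simp add: dist_norm norm_minus_commute)
  qed
  have u_le_iff: "w x t \<le> w y t \<longleftrightarrow> u x t \<le> u y t" if "x \<in> \<Omega>" "y \<in> \<Omega>" "t \<in> {0..<T}" for x y t
    unfolding w_def using \<Phi>_le u_range[OF _ that(3)] that(1,2) closure_subset by blast
  have dirs: "0 \<le> v' \<bullet> Du x t" if x: "x \<in> ball p \<rho>" and v': "norm (v' - v) \<le> \<omega>0" and t: "t1 \<le> t" "t < T" for x v' t
  proof (cases "v' = 0")
    case False
    have xO: "x \<in> \<Omega>" and tT: "t \<in> {0..<T}" using x \<rho>(3) t pos by auto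
    define \<tau>0 where "\<tau>0 = (\<rho> - dist p x) / norm v'"
    have \<tau>0: "0 < \<tau>0" using x False by (simp add: \<tau>0_def)
    have "0 \<le> u (x + \<tau> *\<^sub>R v') t - u (x - \<tau> *\<^sub>R v') t" if \<tau>: "0 < \<tau>" "\<tau> < \<tau>0" for \<tau>
    proof -
      have "\<tau> * norm v' < \<rho> - dist p x" using \<tau>(2) False by (simp add: \<tau>0_def pos_less_divide_eq)
      moreover have "dist p (x - \<tau> *\<^sub>R v') \<le> dist p x + \<tau> * norm v'"
        using dist_triangle[of p "x - \<tau> *\<^sub>R v'" x] \<tau> by (simp add: dist_norm)
      ultimately have b: "x - \<tau> *\<^sub>R v' \<in> ball p \<rho>" by simp
      have le: "v' \<bullet> (x - \<tau> *\<^sub>R v') \<le> v' \<bullet> x" using \<tau> by (simp add: inner_diff_right)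
      have c: "v' \<bullet> x - v' \<bullet> x0 \<le> m1" using near[OF x v'] by (simp add: inner_diff_right)
      have "x + \<tau> *\<^sub>R v' \<in> \<Omega> \<and> w (x - \<tau> *\<^sub>R v') t \<le> w (x + \<tau> *\<^sub>R v') t"
        using reflect[OF v' c _ _ le t] near[OF b v'] b \<rho>(3) unfolding mirror_midpoint[OF False] by blast
      then show ?thesis using u_le_iff[OF _ _ tT] b \<rho>(3) by (auto simp: subset_iff)
    qed
    then have "0 \<le> 2 * (v' \<bullet> Du x t)"
      using derivative_nonneg_if_increasing_right[OF symmetric_difference_derivative[OF space[OF xO tT]] \<tau>0] by simp
    then show ?thesis by simp
  qed simp
  define r1 where "r1 = \<rho> / 2"
  define r0 where "r0 = \<rho> / 4"
  have rr: "0 < r0" "r0 < r1" "r1 < \<rho>" using \<rho>(1) by (auto simp: r0_def r1_def)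
  have cb: "x \<in> ball p \<rho>" "x \<in> \<Omega>" "x \<in> closure \<Omega>" if "x \<in> cball p r1" for x
    using that rr \<rho>(3) closure_subset[of \<Omega>] by (auto simp: subset_iff)
  have tt: "t \<in> {0..<T}" "t \<in> {0<..<T}" if "t \<in> {t1..<T}" for t using that pos by auto
  interpret mc: monotone_cone u ut L Du p v r0 r1 t1 T lam \<delta> "1 / \<omega>0"
  proof
    show "continuous_on (cball p r1 \<times> {t1..<T}) (\<lambda>(x, t). u x t)"
      by (rule continuous_on_subset[OF u_cont]) (use cb tt in auto)
    show "continuous_on (cball p r1 \<times> {t1..<T}) (\<lambda>(x, t). Du x t)"
      by (rule continuous_on_subset[OF Du_cont]) (use cb tt in auto)
    show "norm (Du x t) \<le> 1 / \<omega>0 * (v \<bullet> Du x t) \<and> 0 \<le> v \<bullet> Du x t" if x: "x \<in> cball p r1" and t: "t \<in> {t1..<T}" for x t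
    proof
      \<comment> \<open>The admissible direction that is least favourable for the gradient.\<close>
      define v' where "v' = v - \<omega>0 *\<^sub>R sgn (Du x t)"
      have "norm (v' - v) \<le> \<omega>0" using pos by (simp add: v'_def norm_sgn)
      then have "0 \<le> v' \<bullet> Du x t" using dirs cb x t by auto
      moreover have "sgn (Du x t) \<bullet> Du x t = norm (Du x t)"
        by (cases "Du x t = 0") (simp_all add: sgn_div_norm power2_norm_eq_inner[symmetric] power2_eq_square)
      ultimately have "\<omega>0 * norm (Du x t) \<le> v \<bullet> Du x t" by (simp add: v'_def inner_diff_left)
      then show "norm (Du x t) \<le> 1 / \<omega>0 * (v \<bullet> Du x t)" using pos(1) by (simp add: pos_le_divide_eq mult.commute)
      show "0 \<le> v \<bullet> Du x t" using dirs[of x v t] cb x t pos by auto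
    qed
    show "0 < v \<bullet> Du x t1" if "x \<in> cball p r0" for x
    proof -
      have x: "x \<in> cball p r1" using that rr by auto
      have t1T: "t1 \<in> {0..<T}" using pos by auto
      have nx: "dist x0 x < r" "v \<bullet> (x - x0) < m1" using near[OF cb(1)[OF x], of v] pos(1) by simp_all
      obtain c \<tau>0 where c: "0 < c" "0 < \<tau>0"
        and "\<forall>\<tau>. 0 < \<tau> \<longrightarrow> \<tau> < \<tau>0 \<longrightarrow> c * \<tau> \<le> w (x + \<tau> *\<^sub>R v) t1 - w (x - \<tau> *\<^sub>R v) t1"
        using strict[OF cb(2)[OF x] nx] by blast
      then have c3: "c * \<tau> \<le> w (x + \<tau> *\<^sub>R v) t1 - w (x - \<tau> *\<^sub>R v) t1" if "0 < \<tau>" "\<tau> < \<tau>0" for \<tau>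
        using that by blast
      define e where "e = exp (k / (1 - u x t1))"
      have "((\<lambda>\<tau>. w (x + \<tau> *\<^sub>R v) t1 - w (x - \<tau> *\<^sub>R v) t1 - c * \<tau>) has_real_derivative 2 * (v \<bullet> (e *\<^sub>R Du x t1)) - c) (at 0)"
        unfolding e_def
        by (rule DERIV_diff[OF symmetric_difference_derivative[OF wgl[OF cb(2)[OF x] t1T]] DERIV_cmult_Id])
      from derivative_nonneg_if_increasing_right[OF this c(2)]
      have "0 \<le> 2 * (v \<bullet> (e *\<^sub>R Du x t1)) - c" using c3 by simp
      then have "0 < e * (v \<bullet> Du x t1)" using c(1) by simp
      then show ?thesis by (simp add: e_def zero_less_mult_iff)
    qed
    show "0 \<le> u x t \<and> u x t < 1" if "x \<in> cball p r1" "t \<in> {t1..<T}" for x t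
      using u_range[OF cb(3)[OF that(1)] tt(1)[OF that(2)]] by auto
    show "has_grad_lap (\<lambda>y. u y t) (Du x t) (L x t) x" "(u x has_real_derivative ut x t) (at t)"
      "ut x t - L x t = lam * ((1 + \<delta> * (norm (Du x t))\<^sup>2) / (1 - u x t)\<^sup>2)"
      if "x \<in> cball p r1" "t \<in> {t1..<T}" for x t
      using space[OF cb(2)[OF that(1)] tt(1)[OF that(2)]] time[OF cb(2)[OF that(1)] tt(2)[OF that(2)]]
        eq[OF cb(2)[OF that(1)] tt(2)[OF that(2)]] by (simp_all only:)
  qed (use lam \<delta> rr pos(1,5) in simp_all)
  obtain \<kappa> where \<kappa>: "0 < \<kappa>" "\<And>x t. dist p x < r0 / 4 \<Longrightarrow> t \<in> {t1..<T} \<Longrightarrow> u x t \<le> 1 - \<kappa>"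
    using mc.bounded_away_from_one by blast
  obtain M1 where M1: "\<And>x t. x \<in> closure \<Omega> \<Longrightarrow> t \<in> {0..t1} \<Longrightarrow> w x t \<le> M1" using rh.bounded_before[OF pos(5)] by blast
  \<comment> \<open>The level for which \<open>p\<close> is the mirror image of \<open>x0\<close>.\<close>
  define c where "c = v \<bullet> x0 + s * (norm v)\<^sup>2 / 2"
  have cx: "c - v \<bullet> x0 \<le> m1"
  proof -
    have "s * (norm v)\<^sup>2 \<le> s * V\<^sup>2" using V s by (intro mult_left_mono power_mono) auto
    then show ?thesis using sV(2) pos(2) by (simp add: c_def)
  qed
  have mx0: "mirror (sgn v) (c / norm v) x0 = p"
  proof -
    have h1: "c / norm v - sgn v \<bullet> x0 = s * norm v / 2"
      using nv by (simp add: c_def sgn_div_norm add_divide_distrib power2_eq_square inverse_eq_divide)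
    have h2: "(s * norm v) *\<^sub>R sgn v = s *\<^sub>R v" using nv by (simp add: sgn_div_norm)
    show ?thesis unfolding mirror_def p_def h1 using h2 by simp
  qed
  have "isCont (mirror (sgn v) (c / norm v)) x0" unfolding mirror_def by (intro continuous_intros)
  then have "\<exists>d>0. \<forall>x. dist x x0 < d \<longrightarrow> dist (mirror (sgn v) (c / norm v) x) p < r0 / 4"
    unfolding continuous_at_eps_delta mx0 by (elim allE[of _ "r0 / 4"]) (use rr(1) in simp)
  then obtain d where d: "0 < d" "\<And>x. dist x x0 < d \<Longrightarrow> dist (mirror (sgn v) (c / norm v) x) p < r0 / 4"
    by blast
  define d' where "d' = Min {d, r, s * norm v / 2}"
  have d': "0 < d'" "d' \<le> d" "d' \<le> r" "d' \<le> s * norm v / 2" using d(1) pos(3) s(1) nv by (simp_all add: d'_def)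
  have "w x t \<le> max M1 (\<Phi> (1 - \<kappa>))" if x: "x \<in> \<Omega>" "dist x0 x < d'" and t: "t \<in> {0..<T}" for x t
  proof (cases "t \<le> t1")
    case True
    then show ?thesis using M1[of x t] x t closure_subset[of \<Omega>] by auto
  next
    case False
    define y where "y = mirror (sgn v) (c / norm v) x"
    have "v \<bullet> (x - x0) \<le> norm v * norm (x - x0)" by (rule norm_cauchy_schwarz)
    also have "\<dots> \<le> norm v * (s * norm v / 2)" using x d' by (intro mult_left_mono) (auto simp: dist_norm norm_minus_commute)
    finally have "v \<bullet> x \<le> c" by (simp add: c_def inner_diff_right power2_eq_square mult_ac)
    then have y: "y \<in> \<Omega>" "w x t \<le> w y t"
      using reflect[OF _ cx x(1), of t] x(2) d'(3) t False pos(1) unfolding y_def by simp_all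
    have yu: "u y t \<in> {0..<1}" using u_range[OF _ t, of y] y(1) closure_subset by blast
    have "dist p y < r0 / 4" using d(2)[of x] x(2) d'(2) unfolding y_def by (simp add: dist_commute)
    then have "u y t \<le> 1 - \<kappa>" using \<kappa>(2)[of y t] t False by simp
    then have "w y t \<le> \<Phi> (1 - \<kappa>)" unfolding w_def using \<Phi>_le[of "u y t" "1 - \<kappa>"] yu \<kappa>(1) by auto
    then show ?thesis using y by simp
  qed
  then have "rh.bounded_near x0" unfolding rh.bounded_near_def using d'(1) by blast
  then show False using x0f by simp
qed

end

theorem theorem4p1:
  fixes \<Omega> :: "(real^'n) set" and lam \<delta> T :: real and S :: ereal
    and u :: "real^'n \<Rightarrow> real \<Rightarrow> real"
  assumes "lam > 0" and "\<delta> > 0"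
    and "open \<Omega>" and "\<Omega> \<noteq> {}" and "bounded \<Omega>" and "convex \<Omega>"
    and "maximal_solution_F \<Omega> lam \<delta> S u"
    and "quenching_time \<Omega> S u = ereal T"
  shows "compact (quenching_set \<Omega> T u) \<and> quenching_set \<Omega> T u \<subseteq> \<Omega>"
proof -
  define A where "A = {ereal t |t. 0 < t \<and> ereal t < S \<and> (\<forall>\<tau>\<in>{0..t}. sup_norm_on \<Omega> (\<lambda>x. u x \<tau>) < 1)}"
  have supA: "Sup A = ereal T" using assms(8) by (simp add: A_def quenching_time_def)
  then have "A \<noteq> {}" by (auto simp: bot_ereal_def)
  then obtain t where t: "0 < t" "ereal t \<in> A" by (auto simp: A_def)
  then have "ereal t \<le> ereal T" unfolding supA[symmetric] by (intro Sup_upper)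
  then have T: "0 < T" using t(1) by simp
  have "ereal T \<le> S" unfolding supA[symmetric] by (intro Sup_least) (auto simp: A_def)
  then have sub: "{0..<T} \<subseteq> time_interval S"
    by (auto simp: time_interval_def intro: less_le_trans[of _ "ereal T"])
  have sol: "solution_F \<Omega> lam \<delta> S u" using assms(7) by (simp add: maximal_solution_F_def)
  then obtain ut Du D2u where C21: "C21_on \<Omega> (time_interval S) u ut Du D2u"
    and pde: "\<And>x t. x \<in> \<Omega> \<Longrightarrow> t \<in> time_interval S \<Longrightarrow> u x t < 1 \<and>
           ut x t - (\<Sum>i\<in>UNIV. D2u x t $ i $ i) = lam * ((1 + \<delta> * (norm (Du x t))\<^sup>2) / (1 - u x t)\<^sup>2)"
    unfolding solution_F_def by blast
  interpret quenching_problem \<Omega> lam \<delta> T u ut "\<lambda>x t. \<Sum>i\<in>UNIV. D2u x t $ i $ i" Du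
  proof
    show "continuous_on (closure \<Omega> \<times> {0..<T}) (\<lambda>(x, t). u x t)"
      by (rule continuous_on_subset[of "closure \<Omega> \<times> time_interval S"]) (use sol sub in \<open>auto simp: solution_F_def\<close>)
    show "continuous_on (\<Omega> \<times> {0..<T}) (\<lambda>(x, t). Du x t)"
      by (rule continuous_on_subset[of "\<Omega> \<times> time_interval S"]) (use C21 sub in \<open>auto simp: C21_on_def\<close>)
    show "has_grad_lap (\<lambda>y. u y t) (Du x t) (\<Sum>i\<in>UNIV. D2u x t $ i $ i) x" if "x \<in> \<Omega>" "t \<in> {0..<T}" for x t
      by (rule has_grad_lap_matrix[OF assms(3) that(1), where Dg="\<lambda>y. Du y t"])
        (use C21 sub that in \<open>auto simp: C21_on_def\<close>)
    show "(u x has_real_derivative ut x t) (at t)" if "x \<in> \<Omega>" "t \<in> {0<..<T}" for x t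
    proof -
      have "t \<in> time_interval S" using that sub by auto
      then have "(u x has_real_derivative ut x t) (at t within time_interval S)"
        using C21 that(1) unfolding C21_on_def by blast
      then have "(u x has_real_derivative ut x t) (at t within {0<..<T})"
        by (rule has_field_derivative_subset) (use sub in auto)
      then show ?thesis using at_within_open[OF that(2) open_greaterThanLessThan] by simp
    qed
    show "ut x t - (\<Sum>i\<in>UNIV. D2u x t $ i $ i) = lam * ((1 + \<delta> * (norm (Du x t))\<^sup>2) / (1 - u x t)\<^sup>2)"
      if "x \<in> \<Omega>" "t \<in> {0<..<T}" for x t
      using pde[OF that(1), of t] sub that(2) by (simp add: subset_iff)
    show "u x t < 1" if "x \<in> \<Omega>" "t \<in> {0..<T}" for x t using pde[OF that(1), of t] sub that(2) by blast
    show "u x t = 0" if "x \<in> frontier \<Omega>" "t \<in> {0..<T}" for x t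
      using sol sub that unfolding solution_F_def by blast
    show "u x 0 = 0" if "x \<in> \<Omega>" for x using sol that unfolding solution_F_def by blast
  qed (fact assms T)+
  have fr: "quenching_set \<Omega> T u \<inter> frontier \<Omega> = {}" by (rule quenching_set_avoids_frontier)
  have cl: "quenching_set \<Omega> T u \<subseteq> closure \<Omega>" by (auto simp: quenching_set_def)
  have "bounded (quenching_set \<Omega> T u)" using cl bounded_closure[OF assms(5)] bounded_subset by blast
  then have "compact (quenching_set \<Omega> T u)" using closed_quenching_set by (simp add: compact_eq_bounded_closed)
  moreover have "quenching_set \<Omega> T u \<subseteq> \<Omega>" using cl fr closure_cases by blast
  ultimately show ?thesis by blast
qed

end
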